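(* Let $H$ be a complex separable Hilbert space. Let $$E_1=\{T\in B(H):\ \partial\mathbb{D}\cap\sigma_{lre}(T)\neq\emptyset\}$$ and $$E_2=\{T\in B(H):\ \partial\mathbb{D}\subseteq\rho_{s-F}(T)\ \text{and}\ \dim\operatorname{Ker}(\lambda-T)>0\ \text{for all}\ \lambda\in\partial\mathbb{D}\}.$$ Then $\overline{DC(H)}=\overline{LY(H)}=E_1\cup E_2$, where the closures are taken in the operator norm topology of $B(H)$.
   Context: $B(H)$ is the algebra of bounded linear operators on $H$; $\mathbb{D}$ is the open unit disk in $\mathbb{C}$ and $\partial\mathbb{D}$ the unit circle. Semi-Fredholm domain: $\lambda\in\rho_{s-F}(T)$ iff $\lambda-T$ is semi-Fredholm, i.e. $\operatorname{Ran}(\lambda-T)$ is closed and at least one of $\dim\operatorname{Ker}(\lambda-T)$, $\dim\operatorname{Ker}(\lambda-T)^*$ is finite. The Wolf spectrum is $\sigma_{lre}(T)=\mathbb{C}\setminus\rho_{s-F}(T)$. Let $f:X\to X$ be a continuous map on a complete separable metric space $(X,d)$ (for $T\in B(H)$ take $X=H$, $d(x,y)=\|x-y\|$, $f=T$). A pair $\{x,y\}\subset X$ is a Li-Yorke chaotic pair if $\limsup_{n\to\infty}d(f^n(x),f^n(y))>0$ and $\liminf_{n\to\infty}d(f^n(x),f^n(y))=0$. The map $f$ is Li-Yorke chaotic if there is an uncountable $\Gamma\subseteq X$ such that each pair of distinct points of $\Gamma$ is a Li-Yorke chaotic pair. For $x,y\in X$, $n\ge 1$, $\tau\in\mathbb{R}$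 put $F^n_{xy}(\tau)=\frac1n\#\{0\le i\le n-1:\ d(f^i(x),f^i(y))<\tau\}$, $F_{xy}(\tau)=\liminf_{n\to\infty}F^n_{xy}(\tau)$, $F^*_{xy}(\tau)=\limsup_{n\to\infty}F^n_{xy}(\tau)$. The pair $\{x,y\}$ is distributionally chaotic if $F^*_{xy}(\tau)=1$ for all $\tau>0$ and $F_{xy}(\epsilon)=0$ for some $\epsilon>0$. The map $f$ is distributionally chaotic if there is an uncountable $\Lambda\subseteq X$ such that each pair of distinct points of $\Lambda$ is a distributionally chaotic pair. $LY(H)$ and $DC(H)$ denote the sets of all Li-Yorke chaotic, respectively distributionally chaotic, operators in $B(H)$. *)

theory Defs
  imports "HOL-Analysis.Analysis" "HOL-Library.Extended_Nat"
begin

class complex_vector = real_vector +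
  fixes scaleC :: "complex \<Rightarrow> 'a \<Rightarrow> 'a" (infixr "*\<^sub>C" 75)
  assumes scaleC_add_right: "a *\<^sub>C (x + y) = a *\<^sub>C x + a *\<^sub>C y"
    and scaleC_add_left: "(a + b) *\<^sub>C x = a *\<^sub>C x + b *\<^sub>C x"
    and scaleC_scaleC: "a *\<^sub>C b *\<^sub>C x = (a * b) *\<^sub>C x"
    and scaleC_one: "1 *\<^sub>C x = x"
    and scaleR_scaleC: "r *\<^sub>R x = complex_of_real r *\<^sub>C x"

text \<open>The last axiom says that the norm is the one induced by the inner product; together with
  the norm axioms it makes the inner product positive definite.\<close>

class complex_inner = complex_vector + real_normed_vector +
  fixes cinner :: "'a \<Rightarrow> 'a \<Rightarrow> complex"
  assumes cinner_commute: "cinner x y = cnj (cinner y x)"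
    and cinner_add_left: "cinner (x + y) z = cinner x z + cinner y z"
    and cinner_scaleC_left: "cinner (a *\<^sub>C x) y = a * cinner x y"
    and cinner_self: "cinner x x = complex_of_real ((norm x)\<^sup>2)"

class complex_hilbert = complex_inner + banach

lemma vector_space_scaleC:
  "vector_space (scaleC :: complex \<Rightarrow> 'a \<Rightarrow> 'a::complex_vector)"
  by unfold_locales
    (simp_all add: scaleC_add_right scaleC_add_left scaleC_scaleC scaleC_one)

text \<open>The library's \<open>dim\<close> is 0 on subspaces without a finite basis, so infinite dimension is
  treated separately.\<close>

definition cdim :: "'a::complex_vector set \<Rightarrow> enat" where
  "cdim S = (if \<exists>B. finite B \<and> S \<subseteq> module.span scaleC B
             then enat (vector_space.dim scaleC S) else \<infinity>)"


text \<open>The algebra $B(H)$: the library type of bounded real-linear maps supplies the operator norm;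
  the complex-linear ones are singled out.\<close>

definition bounded_operators :: "('h::complex_hilbert \<Rightarrow>\<^sub>L 'h) set" where
  "bounded_operators = {T. \<forall>a x. blinfun_apply T (a *\<^sub>C x) = a *\<^sub>C blinfun_apply T x}"

text \<open>Closure relative to $B(H)$ in the operator norm topology.\<close>

definition op_closure :: "('h::complex_hilbert \<Rightarrow>\<^sub>L 'h) set \<Rightarrow> ('h \<Rightarrow>\<^sub>L 'h) set" where
  "op_closure S = (top_of_set bounded_operators) closure_of S"

definition shifted :: "complex \<Rightarrow> ('h::complex_hilbert \<Rightarrow>\<^sub>L 'h) \<Rightarrow> 'h \<Rightarrow> 'h" where
  "shifted l T = (\<lambda>x. l *\<^sub>C x - blinfun_apply T x)"

definition op_kernel :: "('h::complex_hilbert \<Rightarrow> 'h) \<Rightarrow> 'h set" where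
  "op_kernel A = {x. A x = 0}"

definition hilbert_adjoint :: "('h::complex_hilbert \<Rightarrow> 'h) \<Rightarrow> 'h \<Rightarrow> 'h" where
  "hilbert_adjoint A = (SOME A'. \<forall>x y. cinner (A x) y = cinner x (A' y))"


definition semi_Fredholm :: "('h::complex_hilbert \<Rightarrow> 'h) \<Rightarrow> bool" where
  "semi_Fredholm A \<longleftrightarrow>
     closed (range A) \<and> (cdim (op_kernel A) < \<infinity> \<or> cdim (op_kernel (hilbert_adjoint A)) < \<infinity>)"

definition semi_Fredholm_domain :: "('h::complex_hilbert \<Rightarrow>\<^sub>L 'h) \<Rightarrow> complex set" where
  "semi_Fredholm_domain T = {l. semi_Fredholm (shifted l T)}"

definition Wolf_spectrum :: "('h::complex_hilbert \<Rightarrow>\<^sub>L 'h) \<Rightarrow> complex set" where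
  "Wolf_spectrum T = - semi_Fredholm_domain T"


text \<open>Upper and lower limits are taken in the extended reals, since the distances along a pair of
  orbits may be unbounded.\<close>

definition Li_Yorke_pair :: "('x::metric_space \<Rightarrow> 'x) \<Rightarrow> 'x \<Rightarrow> 'x \<Rightarrow> bool" where
  "Li_Yorke_pair f x y \<longleftrightarrow>
     limsup (\<lambda>n. ereal (dist ((f ^^ n) x) ((f ^^ n) y))) > 0 \<and>
     liminf (\<lambda>n. ereal (dist ((f ^^ n) x) ((f ^^ n) y))) = 0"

definition Li_Yorke_chaotic :: "('x::metric_space \<Rightarrow> 'x) \<Rightarrow> bool" where
  "Li_Yorke_chaotic f \<longleftrightarrow> (\<exists>\<Gamma>. uncountable \<Gamma> \<and> pairwise (Li_Yorke_pair f) \<Gamma>)"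

definition orbit_freq :: "('x::metric_space \<Rightarrow> 'x) \<Rightarrow> 'x \<Rightarrow> 'x \<Rightarrow> nat \<Rightarrow> real \<Rightarrow> real" where
  "orbit_freq f x y n \<tau> = real (card {i. i < n \<and> dist ((f ^^ i) x) ((f ^^ i) y) < \<tau>}) / real n"

definition lower_distribution :: "('x::metric_space \<Rightarrow> 'x) \<Rightarrow> 'x \<Rightarrow> 'x \<Rightarrow> real \<Rightarrow> ereal" where
  "lower_distribution f x y \<tau> = liminf (\<lambda>n. ereal (orbit_freq f x y n \<tau>))"

definition upper_distribution :: "('x::metric_space \<Rightarrow> 'x) \<Rightarrow> 'x \<Rightarrow> 'x \<Rightarrow> real \<Rightarrow> ereal" where
  "upper_distribution f x y \<tau> = limsup (\<lambda>n. ereal (orbit_freq f x y n \<tau>))"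

definition distributionally_chaotic_pair :: "('x::metric_space \<Rightarrow> 'x) \<Rightarrow> 'x \<Rightarrow> 'x \<Rightarrow> bool" where
  "distributionally_chaotic_pair f x y \<longleftrightarrow>
     (\<forall>\<tau>>0. upper_distribution f x y \<tau> = 1) \<and> (\<exists>\<epsilon>>0. lower_distribution f x y \<epsilon> = 0)"

definition distributionally_chaotic :: "('x::metric_space \<Rightarrow> 'x) \<Rightarrow> bool" where
  "distributionally_chaotic f \<longleftrightarrow>
     (\<exists>\<Lambda>. uncountable \<Lambda> \<and> pairwise (distributionally_chaotic_pair f) \<Lambda>)"

definition LY :: "('h::complex_hilbert \<Rightarrow>\<^sub>L 'h) set" where
  "LY = {T \<in> bounded_operators. Li_Yorke_chaotic (blinfun_apply T)}"

definition DC :: "('h::complex_hilbert \<Rightarrow>\<^sub>L 'h) set" where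
  "DC = {T \<in> bounded_operators. distributionally_chaotic (blinfun_apply T)}"

end

theory Submission
  imports Defs
begin

text \<open>Write $A_\lambda = \lambda - T$. Say that $A$ is upper semi-Fredholm if it is bounded below on the
  orthogonal complement of some finite orthonormal set; this amounts to closed range and
  finite-dimensional kernel, and in this form it is visibly stable under small perturbations.

  Both $E_1$ and $E_2$ lie in the closure of the distributionally chaotic operators, because of
  one source of chaos: an infinite Jordan chain $A_\lambda e_0 = 0$, $A_\lambda e_{n+1} = e_n$
  with $|\lambda| = 1$, $e_0 \neq 0$ and geometrically bounded norms. Its generating series $E(z)
  = \sum z^n e_n$ is an eigenvector of $T$ for the eigenvalue $\lambda - z$. For small $t > 0$ the
  vectors $E(t\lambda)$ span a space of vectors whose orbits tend to $0$, and the closure of this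
  space contains $E(-t\lambda)$, whose orbit tends to infinity. A Baire category argument gives a
  vector whose orbit is near $0$ on a set of times of upper density $1$ and large on another such
  set, and the real multiples of this vector form a scrambled set
  (\<open>Jordan_chain_imp_DC\<close>). If some $A_\lambda$ with $|\lambda| = 1$ is not upper
  semi-Fredholm, it is arbitrarily small on an orthonormal sequence, and a small perturbation
  turns that sequence into such a chain (\<open>DC_near_not_upper_semi_Fredholm\<close>). If all
  of them are upper semi-Fredholm with nonzero kernels, then $A_1$ maps its hyperrange, the
  intersection of the ranges of its powers, onto itself, and this space contains the eigenvectors
  of $T$ for eigenvalues near $1$ other than $1$. Limits of such eigenvectors lie in the kernel of
  $A_1$ as well, and lifting one of them repeatedly inside the hyperrange produces a chain for $T$
  itself.

  Conversely, suppose that every $A_\lambda$ on the circle is semi-Fredholm and that one of them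
  is injective. Consider the points of the circle where $A_\lambda$ is upper semi-Fredholm and its
  kernel meets its hyperrange trivially. Around such a point all other $A_\mu$ are injective,
  whereas around any other point of the circle none is. So both sets are open in the circle, and
  by connectedness the first one is the whole circle (\<open>circle_regular\<close>). The upper
  semi-Fredholm property on the circle and injectivity at one point persist under small
  perturbations, so $E_1 \cup E_2$ is closed in $B(H)$ (\<open>circle_regular_open\<close>).
  Finally there are no Li-Yorke pairs (\<open>decay_of_circle_regular\<close>). If all $A_\lambda$
  on the circle are bounded below by $c$, a discrete Parseval identity over the roots of unity
  bounds $c^2 \sum_{n<N} \|T^n w\|^2$ by $(\|w\| + \|T^N w\|)^2$, and an orbit that returns
  arbitrarily close to $0$ must decay geometrically. In general finitely many points of the circle
  are eigenvalues; they are removed by passing to the range of a power of $A_\lambda$, and the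
  decay is carried back by solving $y_{n+1} = \lambda y_n - u_n$ backwards from a time at which
  $y_n$ is small.\<close>

section \<open>Inner products and orthogonal projections\<close>

interpretation cvs: vector_space "scaleC :: complex \<Rightarrow> 'a \<Rightarrow> 'a::complex_vector"
  by (rule vector_space_scaleC)

lemma cinner_add_right: "cinner (x::'h::complex_inner) (y + z) = cinner x y + cinner x z"
proof -
  have "cinner x (y + z) = cnj (cinner (y + z) x)" by (rule cinner_commute)
  also have "\<dots> = cnj (cinner y x) + cnj (cinner z x)" by (simp add: cinner_add_left)
  also have "\<dots> = cinner x y + cinner x z" by (metis cinner_commute)
  finally show ?thesis .
qed

lemma cinner_scaleC_right: "cinner (x::'h::complex_inner) (a *\<^sub>C y) = cnj a * cinner x y"
  by (metis cinner_commute cinner_scaleC_left complex_cnj_mult)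

lemma cinner_zero_left [simp]: "cinner 0 (x::'h::complex_inner) = 0"
  using cinner_add_left[of 0 0 x] by simp

lemma cinner_zero_right [simp]: "cinner (x::'h::complex_inner) 0 = 0"
  using cinner_add_right[of x 0 0] by simp

lemma cinner_minus_left: "cinner (- x) (y::'h::complex_inner) = - cinner x y"
  using cinner_add_left[of "-x" x y] by (simp add: add_eq_0_iff2)

lemma cinner_minus_right: "cinner (x::'h::complex_inner) (- y) = - cinner x y"
  using cinner_add_right[of x "-y" y] by (simp add: add_eq_0_iff2)

lemma cinner_diff_left: "cinner (x - y) (z::'h::complex_inner) = cinner x z - cinner y z"
  using cinner_add_left[of x "-y" z] by (simp add: cinner_minus_left)

lemma cinner_diff_right: "cinner (x::'h::complex_inner) (y - z) = cinner x y - cinner x z"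
  using cinner_add_right[of x y "-z"] by (simp add: cinner_minus_right)

lemma cinner_sum_left: "cinner (\<Sum>i\<in>I. f i) (y::'h::complex_inner) = (\<Sum>i\<in>I. cinner (f i) y)"
  by (induction I rule: infinite_finite_induct) (auto simp: cinner_add_left)

lemma cinner_sum_right: "cinner (y::'h::complex_inner) (\<Sum>i\<in>I. f i) = (\<Sum>i\<in>I. cinner y (f i))"
  by (induction I rule: infinite_finite_induct) (auto simp: cinner_add_right)

lemmas cinner_simps = cinner_add_left cinner_add_right cinner_diff_left cinner_diff_right
  cinner_scaleC_left cinner_scaleC_right cinner_minus_left cinner_minus_right

lemma cinner_eq_0_commute: "cinner x y = 0 \<longleftrightarrow> cinner y (x::'h::complex_inner) = 0"
  by (metis cinner_commute complex_cnj_zero)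

lemma norm_scaleC: "norm (a *\<^sub>C (x::'h::complex_inner)) = cmod a * norm x"
proof -
  have "complex_of_real ((norm (a *\<^sub>C x))\<^sup>2) = (a * cnj a) * complex_of_real ((norm x)\<^sup>2)"
    unfolding cinner_self[symmetric] cinner_scaleC_left cinner_scaleC_right by simp
  also have "\<dots> = complex_of_real ((cmod a * norm x)\<^sup>2)"
    by (simp add: complex_norm_square[symmetric] power_mult_distrib)
  finally have "(norm (a *\<^sub>C x))\<^sup>2 = (cmod a * norm x)\<^sup>2"
    using of_real_eq_iff by blast
  then show ?thesis by (simp add: power2_eq_iff_nonneg)
qed

lemma norm_add_square:
  "(norm (x + y))\<^sup>2 = (norm x)\<^sup>2 + 2 * Re (cinner x y) + (norm (y::'h::complex_inner))\<^sup>2"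
proof -
  have "complex_of_real ((norm (x + y))\<^sup>2) = cinner x x + (cinner x y + cnj (cinner x y)) + cinner y y"
    unfolding cinner_self[symmetric] using cinner_commute[of y x] by (simp add: cinner_simps)
  also have "\<dots> = complex_of_real ((norm x)\<^sup>2 + 2 * Re (cinner x y) + (norm y)\<^sup>2)"
    by (simp add: cinner_self complex_add_cnj)
  finally show ?thesis using of_real_eq_iff by blast
qed

lemma parallelogram_law:
  "(norm (x - y))\<^sup>2 + (norm (x + y))\<^sup>2 = 2 * (norm x)\<^sup>2 + 2 * (norm (y::'h::complex_inner))\<^sup>2"
  using norm_add_square[of x y] norm_add_square[of x "- y"] by (simp add: cinner_minus_right)

lemma pythagoras: "cinner x y = 0 \<Longrightarrow> (norm (x + y))\<^sup>2 = (norm x)\<^sup>2 + (norm (y::'h::complex_inner))\<^sup>2"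
  by (simp add: norm_add_square)

lemma norm_le_norm_add_orthogonal:
  "cinner x y = 0 \<Longrightarrow> norm x \<le> norm (x + (y::'h::complex_inner))"
  using pythagoras[of x y] by (metis le_add_same_cancel1 norm_ge_zero power2_le_imp_le zero_le_power2)

lemma cmod_cinner_self [simp]: "cmod (cinner x x) = (norm (x::'h::complex_inner))\<^sup>2"
  by (simp add: cinner_self norm_power)

lemma line_projection_orthogonal:
  fixes x y :: "'h::complex_inner"
  assumes "y \<noteq> 0"
  defines "a \<equiv> cinner x y / cinner y y"
  shows "cinner (a *\<^sub>C y) (x - a *\<^sub>C y) = 0"
proof -
  have yy: "cinner y y \<noteq> 0" using assms by (simp add: cinner_self)
  have "cnj a * cinner y y = cnj (cinner x y)"
    using yy cinner_commute[of y y] unfolding a_def complex_cnj_divide by (metis nonzero_divide_eq_eq)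
  then show ?thesis
    using cinner_commute[of y x] by (simp add: cinner_simps algebra_simps)
qed

lemma cinner_Cauchy_Schwarz: "cmod (cinner x y) \<le> norm x * norm (y::'h::complex_inner)"
proof (cases "y = 0")
  case False
  define a where "a = cinner x y / cinner y y"
  have "norm (a *\<^sub>C y) \<le> norm x"
    using norm_le_norm_add_orthogonal[OF line_projection_orthogonal[OF False, of x]] by (simp add: a_def)
  moreover have "norm (a *\<^sub>C y) * norm y = cmod (cinner x y)"
    using False by (simp add: norm_scaleC a_def norm_divide power2_eq_square)
  ultimately show ?thesis by (metis mult_right_mono norm_ge_zero)
qed auto

lemma cinner_self_eq_0 [simp]: "cinner x x = 0 \<longleftrightarrow> (x::'h::complex_inner) = 0"
  by (simp add: cinner_self)

lemma bounded_bilinear_cinner: "bounded_bilinear (cinner :: 'h::complex_inner \<Rightarrow> 'h \<Rightarrow> complex)"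
proof
  show "\<exists>K. \<forall>a b. norm (cinner a b) \<le> norm a * norm (b::'h) * K"
    using cinner_Cauchy_Schwarz by (intro exI[of _ 1]) auto
qed (auto simp: cinner_simps scaleR_scaleC scaleR_conv_of_real)

lemma bounded_bilinear_scaleC: "bounded_bilinear (scaleC :: complex \<Rightarrow> 'h \<Rightarrow> 'h::complex_inner)"
proof
  show "\<exists>K. \<forall>a b. norm (a *\<^sub>C (b::'h)) \<le> norm a * norm b * K"
    by (intro exI[of _ 1]) (auto simp: norm_scaleC)
qed (auto simp: scaleC_add_left scaleC_add_right scaleR_scaleC scaleC_scaleC scaleR_conv_of_real mult.commute)

lemmas tendsto_cinner = bounded_bilinear.tendsto[OF bounded_bilinear_cinner]
lemmas tendsto_scaleC = bounded_bilinear.tendsto[OF bounded_bilinear_scaleC]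

text \<open>The projection is the point of \<open>M\<close> nearest to \<open>x\<close>, a limit of almost
  nearest points.\<close>

theorem orthogonal_projection_exists:
  fixes M :: "'h::complex_hilbert set"
  assumes M: "cvs.subspace M" "closed M"
  shows "\<exists>p\<in>M. \<forall>m\<in>M. cinner (x - p) m = 0"
proof -
  define d where "d = infdist x M"
  have ne: "M \<noteq> {}" using cvs.subspace_0[OF M(1)] by auto
  have dle: "d \<le> norm (x - m)" if "m \<in> M" for m
    using infdist_le[OF that, of x] by (simp add: d_def dist_norm)
  have d0: "0 \<le> d" by (simp add: d_def infdist_nonneg)
  have "\<exists>m\<in>M. norm (x - m) < d + 1 / Suc n" for n
  proof -
    have "(INF m\<in>M. dist x m) < d + 1 / Suc n" using ne by (simp add: d_def infdist_notempty)
    then show ?thesis using ne by (subst (asm) cInf_less_iff) (auto simp: dist_norm intro!: bdd_belowI[of _ 0])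
  qed
  then obtain m where m: "\<And>n. m n \<in> M" "\<And>n. norm (x - m n) < d + 1 / Suc n" by metis
  have lim: "(\<lambda>n. norm (x - m n)) \<longlonglongrightarrow> d"
  proof (rule tendsto_sandwich[of "\<lambda>_. d" _ _ "\<lambda>n. d + 1 / Suc n"])
    show "(\<lambda>n. d + 1 / real (Suc n)) \<longlonglongrightarrow> d"
      using tendsto_add[OF tendsto_const LIMSEQ_inverse_real_of_nat, of d] by (simp add: inverse_eq_divide)
  qed (use m dle in \<open>auto intro!: eventuallyI less_imp_le\<close>)
  \<comment> \<open>The midpoint of two almost minimizers lies in \<open>M\<close>, so the parallelogram law makes them close.\<close>
  have par: "(norm (m i - m j))\<^sup>2 \<le> 2 * (norm (x - m i))\<^sup>2 + 2 * (norm (x - m j))\<^sup>2 - 4 * d\<^sup>2" for i j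
  proof -
    let ?a = "x - m i" and ?b = "x - m j"
    have mid: "(1/2) *\<^sub>R (m i + m j) \<in> M"
      unfolding scaleR_scaleC using M m cvs.subspace_add cvs.subspace_scale by blast
    have "?a + ?b = (x + x) - (m i + m j)" by simp
    then have "x - (1/2) *\<^sub>R (m i + m j) = (1/2) *\<^sub>R (?a + ?b)"
      by (simp only: scaleR_right_diff_distrib scaleR_half_double)
    then have "norm (x - (1/2) *\<^sub>R (m i + m j)) = norm (?a + ?b) / 2" by (simp only: norm_scaleR)
    with dle[OF mid] have "2 * d \<le> norm (?a + ?b)" by simp
    then have "4 * d\<^sup>2 \<le> (norm (?a + ?b))\<^sup>2"
      using power_mono[of "2*d" "norm (?a + ?b)" 2] d0 by (simp add: power_mult_distrib)
    moreover have "norm (?a - ?b) = norm (m i - m j)" by (simp add: norm_minus_commute)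
    moreover note parallelogram_law[of ?a ?b]
    ultimately show ?thesis by simp
  qed
  have "Cauchy m"
  proof (rule metric_CauchyI)
    fix e :: real assume e: "e > 0"
    have "(\<lambda>n. (norm (x - m n))\<^sup>2) \<longlonglongrightarrow> d\<^sup>2" using lim by (intro tendsto_power)
    then have "\<forall>\<^sub>F n in sequentially. (norm (x - m n))\<^sup>2 < d\<^sup>2 + e\<^sup>2 / 4"
      by (rule order_tendstoD) (use e in auto)
    then obtain N where N: "\<And>n. n \<ge> N \<Longrightarrow> (norm (x - m n))\<^sup>2 < d\<^sup>2 + e\<^sup>2 / 4"
      unfolding eventually_sequentially by blast
    have "dist (m i) (m j) < e" if "i \<ge> N" "j \<ge> N" for i j
    proof -
      have "(norm (m i - m j))\<^sup>2 < e\<^sup>2" using par[of i j] N[OF that(1)] N[OF that(2)] by argo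
      then show ?thesis using e by (simp add: dist_norm power2_less_imp_less)
    qed
    then show "\<exists>N. \<forall>i\<ge>N. \<forall>j\<ge>N. dist (m i) (m j) < e" by blast
  qed
  then obtain p where p: "m \<longlonglongrightarrow> p" using Cauchy_convergent convergent_def by blast
  have pM: "p \<in> M" using M(2) m(1) p closed_sequentially by blast
  have "(\<lambda>n. norm (x - m n)) \<longlonglongrightarrow> norm (x - p)" using p by (intro tendsto_intros)
  then have dp: "norm (x - p) = d" using lim LIMSEQ_unique by blast
  have "cinner (x - p) q = 0" if q: "q \<in> M" for q
  proof (rule ccontr)
    assume n0: "cinner (x - p) q \<noteq> 0"
    then have q0: "q \<noteq> 0" by auto
    define a where "a = cinner (x - p) q / cinner q q"
    have "(norm (x - p))\<^sup>2 = (norm (a *\<^sub>C q))\<^sup>2 + (norm ((x - p) - a *\<^sub>C q))\<^sup>2"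
      using pythagoras[OF line_projection_orthogonal[OF q0, of "x - p"]] by (simp add: a_def)
    moreover have "d\<^sup>2 \<le> (norm ((x - p) - a *\<^sub>C q))\<^sup>2"
      using dle[of "p + a *\<^sub>C q"] pM q M d0
      by (intro power_mono) (auto simp: cvs.subspace_add cvs.subspace_scale diff_diff_eq)
    ultimately have "norm (a *\<^sub>C q) = 0" using dp by simp
    then show False using q0 n0 by (simp add: norm_scaleC a_def)
  qed
  then show ?thesis using pM by blast
qed

section \<open>Adjoints and finite orthonormal sets\<close>

definition bounded_clinear :: "('h::complex_hilbert \<Rightarrow> 'k::complex_inner) \<Rightarrow> bool" where
  "bounded_clinear A \<longleftrightarrow> bounded_linear A \<and> (\<forall>a x. A (a *\<^sub>C x) = a *\<^sub>C A x)"

lemma bounded_clinearD: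
  assumes "bounded_clinear A"
  shows "A (x + y) = A x + A y" "A (x - y) = A x - A y" "A 0 = 0" "A (- x) = - A x"
    "A (a *\<^sub>C x) = a *\<^sub>C A x" "A (r *\<^sub>R x) = r *\<^sub>R A x" "A (sum f I) = (\<Sum>i\<in>I. A (f i))"
  using assms linear_simps[of A] unfolding bounded_clinear_def
  by (auto simp: linear_sum bounded_linear.linear)

lemma bounded_clinear_tendsto:
  "bounded_clinear A \<Longrightarrow> (f \<longlongrightarrow> x) F \<Longrightarrow> ((\<lambda>n. A (f n)) \<longlongrightarrow> A x) F"
  unfolding bounded_clinear_def by (auto intro: bounded_linear.tendsto)

lemma bounded_clinear_bound:
  assumes "bounded_clinear A" obtains C where "C > 0" "\<And>x. norm (A x) \<le> C * norm x"
  using assms bounded_linear.pos_bounded[of A] unfolding bounded_clinear_def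
  by (metis mult.commute)

lemma closed_op_kernel: "bounded_clinear A \<Longrightarrow> closed (op_kernel A)"
  unfolding op_kernel_def bounded_clinear_def
  by (intro closed_Collect_eq) (auto intro: bounded_linear.continuous_on continuous_on_id)

lemma subspace_op_kernel: "bounded_clinear A \<Longrightarrow> cvs.subspace (op_kernel A)"
  unfolding op_kernel_def by (rule cvs.subspaceI) (auto simp: bounded_clinearD)

lemma Riesz_representation:
  fixes f :: "'h::complex_hilbert \<Rightarrow> complex"
  assumes bl: "bounded_linear f" and hom: "\<And>a x. f (a *\<^sub>C x) = a * f x"
  shows "\<exists>z. \<forall>x. f x = cinner x z"
proof (cases "\<forall>x. f x = 0")
  case True then show ?thesis by (intro exI[of _ 0]) auto
next
  case False
  then obtain u where u: "f u \<noteq> 0" by blast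
  interpret f: bounded_linear f by fact
  let ?M = "{x. f x = 0}"
  have M: "cvs.subspace ?M" by (rule cvs.subspaceI) (auto simp: f.add f.zero hom)
  have cl: "closed ?M" by (intro closed_Collect_eq f.continuous_on continuous_on_id continuous_on_const)
  obtain p where p: "f p = 0" "\<And>m. f m = 0 \<Longrightarrow> cinner (u - p) m = 0"
    using orthogonal_projection_exists[OF M cl, of u] by auto
  let ?w = "u - p"
  have fw: "f ?w = f u" using p by (simp add: f.diff)
  then have ww: "cinner ?w ?w \<noteq> 0" using u f.zero by (metis cinner_self_eq_0)
  have "f x = cinner x (cnj (f u / cinner ?w ?w) *\<^sub>C ?w)" for x
  proof -
    have "f (x - (f x / f u) *\<^sub>C ?w) = 0" using u by (simp add: f.diff hom p)
    then have "cinner ?w (x - (f x / f u) *\<^sub>C ?w) = 0" by (rule p)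
    then have "cinner (x - (f x / f u) *\<^sub>C ?w) ?w = 0" using cinner_eq_0_commute by blast
    then have "cinner x ?w = (f x / f u) * cinner ?w ?w" unfolding cinner_diff_left[of x "_ *\<^sub>C _"] cinner_scaleC_left by simp
    then show ?thesis unfolding cinner_scaleC_right complex_cnj_cnj using ww u by simp
  qed
  then show ?thesis by blast
qed

lemma adjoint_exists:
  fixes A :: "'h::complex_hilbert \<Rightarrow> 'h"
  assumes A: "bounded_clinear A"
  shows "\<exists>A'. \<forall>x y. cinner (A x) y = cinner x (A' y)"
proof -
  have "\<exists>z. \<forall>x. cinner (A x) y = cinner x z" for y
  proof (rule Riesz_representation)
    show "bounded_linear (\<lambda>x. cinner (A x) y)"
      using A bounded_linear_compose[OF bounded_bilinear.bounded_linear_left[OF bounded_bilinear_cinner]]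
      unfolding bounded_clinear_def by blast
  qed (use A in \<open>simp add: bounded_clinearD cinner_scaleC_left\<close>)
  then show ?thesis by metis
qed

lemma hilbert_adjoint:
  "bounded_clinear A \<Longrightarrow> cinner (A x) y = cinner x (hilbert_adjoint A y)"
  using someI_ex[OF adjoint_exists[of A]] unfolding hilbert_adjoint_def by blast

lemma cinner_ext: "(\<And>x. cinner x y = cinner x z) \<Longrightarrow> y = (z::'h::complex_inner)"
  by (metis cinner_diff_right cinner_self_eq_0 eq_iff_diff_eq_0)

lemma bounded_clinear_hilbert_adjoint:
  fixes A :: "'h::complex_hilbert \<Rightarrow> 'h"
  assumes A: "bounded_clinear A"
  shows "bounded_clinear (hilbert_adjoint A)"
proof -
  let ?A' = "hilbert_adjoint A"
  note adj = hilbert_adjoint[OF A, symmetric]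
  obtain C where C: "C > 0" "\<And>x. norm (A x) \<le> C * norm x" using bounded_clinear_bound[OF A] by blast
  have add: "?A' (x + y) = ?A' x + ?A' y" for x y
    by (rule cinner_ext) (simp add: adj cinner_simps)
  have sc: "?A' (a *\<^sub>C x) = a *\<^sub>C ?A' x" for a x
    by (rule cinner_ext) (simp add: adj cinner_simps)
  have bd: "norm (?A' y) \<le> norm y * C" for y
  proof (cases "?A' y = 0")
    case False
    have "(norm (?A' y))\<^sup>2 = cmod (cinner (?A' y) (?A' y))" by simp
    also have "\<dots> = cmod (cinner (A (?A' y)) y)" by (simp add: adj)
    also have "\<dots> \<le> norm (A (?A' y)) * norm y" by (rule cinner_Cauchy_Schwarz)
    also have "\<dots> \<le> C * norm (?A' y) * norm y" by (intro mult_right_mono C norm_ge_zero)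
    finally have "norm (?A' y) * norm (?A' y) \<le> norm (?A' y) * (norm y * C)"
      by (simp add: power2_eq_square mult_ac)
    then show ?thesis using False by simp
  qed (use C in simp)
  show ?thesis unfolding bounded_clinear_def
    using add sc bd by (auto intro!: bounded_linear_intro[of _ C] simp: scaleR_scaleC)
qed

definition orthonormal :: "'h::complex_inner set \<Rightarrow> bool" where
  "orthonormal B \<longleftrightarrow> (\<forall>x\<in>B. norm x = 1) \<and> (\<forall>x\<in>B. \<forall>y\<in>B. x \<noteq> y \<longrightarrow> cinner x y = 0)"

lemma orthonormal_insert:
  assumes "orthonormal B" "norm x = 1" "\<And>b. b \<in> B \<Longrightarrow> cinner x b = 0"
  shows "orthonormal (insert x B)"
  using assms cinner_eq_0_commute unfolding orthonormal_def by blast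

lemma orthonormal_expansion_residual:
  fixes B :: "'h::complex_inner set"
  assumes "finite B" "orthonormal B" "b \<in> B"
  shows "cinner (x - (\<Sum>b\<in>B. cinner x b *\<^sub>C b)) b = 0"
proof -
  have "(\<Sum>c\<in>B. cinner x c * cinner c b) = (\<Sum>c\<in>B. if c = b then cinner x b else 0)"
    using assms unfolding orthonormal_def by (intro sum.cong) (auto simp: cinner_self)
  then show ?thesis using assms
    by (simp add: cinner_diff_left cinner_sum_left cinner_scaleC_left)
qed

lemma finite_orthonormal_span:
  fixes F :: "'h::complex_inner set"
  assumes "finite F"
  shows "\<exists>B. finite B \<and> orthonormal B \<and> F \<subseteq> cvs.span B"
  using assms
proof (induction F)
  case empty then show ?case by (intro exI[of _ "{}"]) (auto simp: orthonormal_def)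
next
  case (insert x F)
  then obtain B where B: "finite B" "orthonormal B" "F \<subseteq> cvs.span B" by blast
  define r where "r = x - (\<Sum>b\<in>B. cinner x b *\<^sub>C b)"
  have s: "(\<Sum>b\<in>B. cinner x b *\<^sub>C b) \<in> cvs.span B"
    by (intro cvs.span_sum cvs.span_scale cvs.span_base)
  show ?case
  proof (cases "r = 0")
    case True
    then show ?thesis using B s by (auto simp: r_def)
  next
    case False
    let ?u = "complex_of_real (1 / norm r) *\<^sub>C r"
    have "orthonormal (insert ?u B)"
    proof (rule orthonormal_insert[OF B(2)])
      show "norm ?u = 1" using False by (simp add: norm_scaleC norm_divide)
      show "cinner ?u b = 0" if "b \<in> B" for b
        using orthonormal_expansion_residual[OF B(1,2) that, of x] by (simp add: cinner_scaleC_left r_def)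
    qed
    moreover have "x \<in> cvs.span (insert ?u B)"
    proof -
      have "r = complex_of_real (norm r) *\<^sub>C ?u" using False by (simp add: scaleC_scaleC scaleC_one)
      then have "r \<in> cvs.span (insert ?u B)" by (metis cvs.span_base cvs.span_scale insertI1)
      moreover have "(\<Sum>b\<in>B. cinner x b *\<^sub>C b) \<in> cvs.span (insert ?u B)"
        using s cvs.span_mono[of B "insert ?u B"] by blast
      ultimately have "r + (\<Sum>b\<in>B. cinner x b *\<^sub>C b) \<in> cvs.span (insert ?u B)" by (rule cvs.span_add)
      then show ?thesis by (simp add: r_def)
    qed
    moreover have "F \<subseteq> cvs.span (insert ?u B)" using B cvs.span_mono[of B "insert ?u B"] by blast
    ultimately show ?thesis using B(1) by (intro exI[of _ "insert ?u B"]) auto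
  qed
qed

lemma cinner_span_eq_0:
  assumes "y \<in> cvs.span B" "\<And>b. b \<in> B \<Longrightarrow> cinner x b = 0"
  shows "cinner x (y::'h::complex_inner) = 0"
  using assms(1)
  by (induction rule: cvs.span_induct_alt) (auto simp: cinner_simps assms(2))

text \<open>Finiteness of \<open>cdim\<close>, in a form that can be shown without exhibiting a basis.\<close>

definition finitely_spanned :: "'a::complex_vector set \<Rightarrow> bool" where
  "finitely_spanned V \<longleftrightarrow> (\<exists>F. finite F \<and> V \<subseteq> cvs.span F)"

lemma cdim_finite_iff: "cdim V < \<infinity> \<longleftrightarrow> finitely_spanned V"
  unfolding cdim_def finitely_spanned_def by auto

lemma finitely_spanned_orthonormal:
  fixes V :: "'h::complex_inner set"
  assumes "finitely_spanned V"
  obtains B where "finite B" "orthonormal B" "V \<subseteq> cvs.span B"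
proof -
  obtain F where "finite F" "V \<subseteq> cvs.span F" using assms unfolding finitely_spanned_def by blast
  moreover obtain B where "finite B" "orthonormal B" "F \<subseteq> cvs.span B"
    using finite_orthonormal_span \<open>finite F\<close> by blast
  ultimately show thesis using that cvs.span_minimal[OF _ cvs.subspace_span] by (meson subset_trans)
qed

text \<open>Removing one functional enlarges the joint zero set by at most one dimension: a vector on which
  the functional does not vanish accounts for all the rest.\<close>

lemma finitely_spanned_by_functionals:
  fixes V :: "'a::complex_vector set"
  assumes "finite \<Phi>" and V: "cvs.subspace V"
    and lin: "\<And>f. f \<in> \<Phi> \<Longrightarrow> (\<forall>x y. f (x + y) = f x + f y) \<and> (\<forall>a x. f (a *\<^sub>C x) = a * f x)"
    and fs: "finitely_spanned {v\<in>V. \<forall>f\<in>\<Phi>. f v = (0::complex)}"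
  shows "finitely_spanned V"
  using assms(1) lin fs
proof (induction \<Phi>)
  case (insert g \<Phi>)
  let ?W = "{v\<in>V. \<forall>f\<in>\<Phi>. f v = 0}"
  obtain F where F: "finite F" "{v\<in>V. \<forall>f\<in>insert g \<Phi>. f v = 0} \<subseteq> cvs.span F"
    using insert.prems unfolding finitely_spanned_def by blast
  have "finitely_spanned ?W"
  proof (cases "\<exists>u\<in>?W. g u \<noteq> 0")
    case False
    then show ?thesis using F unfolding finitely_spanned_def by (intro exI[of _ F]) auto
  next
    case True
    then obtain u where u: "u \<in> ?W" "g u \<noteq> 0" by blast
    have "w \<in> cvs.span (insert u F)" if w: "w \<in> ?W" for w
    proof -
      let ?a = "- g w / g u"
      have "w + ?a *\<^sub>C u \<in> {v\<in>V. \<forall>f\<in>insert g \<Phi>. f v = 0}"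
      proof -
        have 1: "w + ?a *\<^sub>C u \<in> V" using w u V by (blast intro: cvs.subspace_add cvs.subspace_scale)
        have 2: "f (w + ?a *\<^sub>C u) = f w + ?a * f u" if "f \<in> insert g \<Phi>" for f
          using insert.prems(1)[OF that] by metis
        have "f (w + ?a *\<^sub>C u) = 0" if "f \<in> insert g \<Phi>" for f
          unfolding 2[OF that] using w u that by auto
        then show ?thesis using 1 by blast
      qed
      then have "w + ?a *\<^sub>C u \<in> cvs.span (insert u F)" using F(2) cvs.span_mono[of F "insert u F"] by blast
      moreover have "?a *\<^sub>C u \<in> cvs.span (insert u F)" by (intro cvs.span_scale cvs.span_base) auto
      ultimately have "w + ?a *\<^sub>C u - ?a *\<^sub>C u \<in> cvs.span (insert u F)" by (rule cvs.span_diff)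
      then show ?thesis by simp
    qed
    then show ?thesis using F(1) unfolding finitely_spanned_def by (intro exI[of _ "insert u F"]) auto
  qed
  then show ?case using insert by auto
qed auto

text \<open>This is how infinite dimension enters all later arguments: finitely many orthogonality conditions
  cannot exhaust the space.\<close>

lemma not_finitely_spanned_orthogonal:
  fixes V :: "'h::complex_inner set"
  assumes V: "cvs.subspace V" "\<not> finitely_spanned V" and B: "finite B"
  shows "\<exists>v\<in>V. norm v = 1 \<and> (\<forall>b\<in>B. cinner v b = 0)"
proof -
  let ?W = "{v\<in>V. \<forall>f\<in>(\<lambda>b v. cinner v b) ` B. f v = 0}"
  have "\<not> finitely_spanned ?W"
  proof
    assume "finitely_spanned ?W"
    then have "finitely_spanned V"
      by (rule finitely_spanned_by_functionals[rotated 3]) (use B V in \<open>auto simp: cinner_simps\<close>)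
    then show False using V by blast
  qed
  moreover have "finitely_spanned {0::'h}" unfolding finitely_spanned_def by (intro exI[of _ "{}"]) auto
  ultimately obtain w where w: "w \<in> ?W" "w \<noteq> 0"
    unfolding finitely_spanned_def by (metis (no_types, lifting) insertCI subset_eq)
  then show ?thesis using V
    by (intro bexI[of _ "complex_of_real (1 / norm w) *\<^sub>C w"])
      (auto simp: norm_scaleC norm_divide cinner_scaleC_left cvs.subspace_scale)
qed

section \<open>Upper semi-Fredholm operators\<close>

text \<open>The open mapping theorem for the map onto its range, a Banach space since it is closed. By Baire,
  the closure of the image of some ball has interior in the range; hence every \<open>y\<close> in
  the range is approximated with error \<open>norm y / 2\<close> by images of vectors of norm at
  most \<open>K * norm y\<close>, and the errors are corrected successively.\<close>

lemma closed_range_lower_bound: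
  fixes A :: "'a::banach \<Rightarrow> 'b::banach"
  assumes A: "bounded_linear A" and cl: "closed (range A)"
  obtains c where "c > 0" "\<And>x. \<exists>x'. A x' = A x \<and> c * norm x' \<le> norm (A x)"
proof -
  interpret A: bounded_linear A by fact
  let ?R = "range A"
  let ?C = "\<lambda>n::nat. closure (A ` cball 0 (real n))"
  have CR: "?C n \<subseteq> ?R" for n by (intro closure_minimal cl) auto
  have U: "(\<Union>n. ?C n) = ?R"
  proof
    show "?R \<subseteq> (\<Union>n. ?C n)"
    proof
      fix y assume "y \<in> ?R"
      then obtain x where x: "y = A x" by blast
      obtain n where "norm x \<le> real n" using real_arch_simple by blast
      then have "y \<in> A ` cball 0 (real n)" using x by auto
      then show "y \<in> (\<Union>n. ?C n)" using closure_subset[of "A ` cball 0 (real n)"] by blast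
    qed
  qed (use CR in blast)
  have "\<exists>n. top_of_set ?R interior_of ?C n \<noteq> {}"
  proof (rule ccontr)
    assume "\<not> ?thesis"
    then have "top_of_set ?R interior_of \<Union>(range ?C) = {}"
    proof (intro Baire_category_alt disjI1)
      show "completely_metrizable_space (top_of_set ?R)"
        using completely_metrizable_space_closedin[OF completely_metrizable_space_euclidean] cl
        by (simp add: closed_closedin[symmetric])
      show "closedin (top_of_set ?R) T \<and> top_of_set ?R interior_of T = {}" if "T \<in> range ?C" for T
        using that \<open>\<not> (\<exists>n. top_of_set ?R interior_of ?C n \<noteq> {})\<close> CR by (blast intro: closed_subset closed_closure)
    qed auto
    moreover have "top_of_set ?R interior_of ?R = ?R"
      by (metis interior_of_topspace topspace_euclidean_subtopology)
    ultimately show False using U by simp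
  qed
  then obtain n y0 where "y0 \<in> top_of_set ?R interior_of ?C n" by blast
  then obtain S where S: "openin (top_of_set ?R) S" "y0 \<in> S" "S \<subseteq> ?C n"
    unfolding interior_of_def by blast
  then obtain r where r: "r > 0" "ball y0 r \<inter> ?R \<subseteq> ?C n" and y0: "y0 \<in> ?R"
    unfolding openin_contains_ball by blast
  define K where "K = 4 * (real n) / r"
  have K0: "K \<ge> 0" using r by (simp add: K_def)
  \<comment> \<open>Differences of points of the ball around \<open>y0\<close> fill a ball around the origin.\<close>
  have approx: "\<exists>x. norm x \<le> K * norm y \<and> norm (y - A x) \<le> norm y / 2" if y: "y \<in> ?R" for y
  proof (cases "y = 0")
    case True then show ?thesis by (intro exI[of _ 0]) (simp add: A.zero)
  next
    case False
    define s where "s = r / (2 * norm y)"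
    have s: "s > 0" using r False by (simp add: s_def)
    have 1: "y0 + s *\<^sub>R y \<in> ?R" using y y0 by (metis A.add A.scaleR rangeE rangeI)
    have "norm (s *\<^sub>R y) < r" using False r s by (simp add: s_def)
    then have "y0 + s *\<^sub>R y \<in> ball y0 r \<inter> ?R" using 1 by (simp add: dist_norm)
    moreover have "y0 \<in> ball y0 r \<inter> ?R" using r(1) y0 by simp
    ultimately have "y0 + s *\<^sub>R y \<in> ?C n" "y0 \<in> ?C n" using r(2) by blast+
    moreover have e: "s * norm y / 4 > 0" using False s by simp
    ultimately have "\<exists>u\<in>A ` cball 0 (real n). dist u (y0 + s *\<^sub>R y) < s * norm y / 4"
      "\<exists>u\<in>A ` cball 0 (real n). dist u y0 < s * norm y / 4"
      unfolding closure_approachable by blast+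
    then obtain a b where a: "norm a \<le> n" "dist (A a) (y0 + s *\<^sub>R y) < s * norm y / 4"
      and b: "norm b \<le> n" "dist (A b) y0 < s * norm y / 4" by auto
    let ?x = "(1 / s) *\<^sub>R (a - b)"
    have "norm ?x \<le> (1 / s) * (2 * n)"
      using s a(1) b(1) norm_triangle_ineq4[of a b] by (simp add: divide_right_mono)
    also have "\<dots> = K * norm y" by (simp add: K_def s_def)
    finally have 2: "norm ?x \<le> K * norm y" .
    have "s *\<^sub>R (y - A ?x) = (y0 + s *\<^sub>R y - A a) - (y0 - A b)"
      using s by (simp add: algebra_simps A.scaleR A.diff)
    then have "s * norm (y - A ?x) = norm ((y0 + s *\<^sub>R y - A a) - (y0 - A b))"
      using s by (metis abs_of_pos norm_scaleR)
    also have "\<dots> \<le> dist (A a) (y0 + s *\<^sub>R y) + dist (A b) y0"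
      unfolding dist_norm by (metis norm_minus_commute norm_triangle_ineq4)
    also have "\<dots> \<le> s * (norm y / 2)" using a b by simp
    finally have "norm (y - A ?x) \<le> norm y / 2" using s by simp
    then show ?thesis using 2 by blast
  qed
  then obtain h where h: "\<And>y. y \<in> ?R \<Longrightarrow> norm (h y) \<le> K * norm y"
    "\<And>y. y \<in> ?R \<Longrightarrow> norm (y - A (h y)) \<le> norm y / 2" by metis
  have main: "\<exists>x'. A x' = y \<and> norm x' \<le> (2 * K + 1) * norm y" if y: "y \<in> ?R" for y
  proof -
    define z where "z k = ((\<lambda>y. y - A (h y)) ^^ k) y" for k
    have zS: "z (Suc k) = z k - A (h (z k))" for k by (simp add: z_def)
    have zR: "z k \<in> ?R" for k
    proof (induction k)
      case (Suc k) then show ?case unfolding zS by (metis A.diff rangeE rangeI)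
    qed (simp add: z_def y)
    have zn: "norm (z k) \<le> norm y * (1/2) ^ k" for k
    proof (induction k)
      case (Suc k) then show ?case using h(2)[OF zR[of k]] unfolding zS by simp
    qed (simp add: z_def)
    have hn: "norm (h (z k)) \<le> K * norm y * (1/2) ^ k" for k
      using h(1)[OF zR[of k]] mult_left_mono[OF zn[of k] K0] by (simp add: mult.assoc)
    have geo: "(\<lambda>k. K * norm y * (1/2) ^ k) sums (K * norm y * 2)"
      using geometric_sums[of "1/2::real"] by (intro sums_mult) auto
    have sm: "summable (\<lambda>k. norm (h (z k)))"
      by (rule summable_comparison_test'[OF sums_summable[OF geo], of 0]) (use hn in auto)
    have "z \<longlonglongrightarrow> 0"
    proof (rule Lim_null_comparison)
      show "(\<lambda>k. norm y * (1/2) ^ k) \<longlonglongrightarrow> 0" by (intro tendsto_mult_right_zero LIMSEQ_power_zero) auto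
    qed (use zn in auto)
    then have "(\<lambda>k. z k - z (Suc k)) sums (z 0 - 0)" by (rule telescope_sums')
    then have "(\<lambda>k. A (h (z k))) sums y" by (simp add: zS) (simp add: z_def)
    moreover have "(\<lambda>k. A (h (z k))) sums A (\<Sum>k. h (z k))"
      by (intro A.sums summable_sums summable_norm_cancel[OF sm])
    ultimately have 1: "A (\<Sum>k. h (z k)) = y" using sums_unique2 by blast
    have "norm (\<Sum>k. h (z k)) \<le> (\<Sum>k. norm (h (z k)))" by (rule summable_norm[OF sm])
    also have "\<dots> \<le> K * norm y * 2"
      using suminf_le[OF hn sm sums_summable[OF geo]] sums_unique[OF geo] by simp
    also have "\<dots> \<le> (2 * K + 1) * norm y" by (simp add: algebra_simps)
    finally show ?thesis using 1 by blast
  qed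
  show thesis
  proof (rule that[of "1 / (2 * K + 1)"])
    show "1 / (2 * K + 1) > 0" using K0 by simp
    show "\<exists>x'. A x' = A x \<and> 1 / (2 * K + 1) * norm x' \<le> norm (A x)" for x
      using main[of "A x"] K0 by (auto simp: divide_le_eq mult.commute)
  qed
qed

text \<open>Equivalent to closed range and finite-dimensional kernel, see
  \<open>upper_semi_Fredholm_iff\<close>; the lower bound makes stability under perturbation
  immediate.\<close>

definition upper_semi_Fredholm :: "('h::complex_hilbert \<Rightarrow> 'h) \<Rightarrow> bool" where
  "upper_semi_Fredholm A \<longleftrightarrow> (\<exists>B c. finite B \<and> orthonormal B \<and> c > 0 \<and>
     (\<forall>x. (\<forall>b\<in>B. cinner x b = 0) \<longrightarrow> c * norm x \<le> norm (A x)))"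

lemma convergent_coefficients_subsequence:
  fixes x :: "nat \<Rightarrow> 'h::complex_inner"
  assumes bd: "\<And>n. norm (x n) \<le> K" and "finite B"
  shows "\<exists>r::nat\<Rightarrow>nat. strict_mono r \<and> (\<forall>b\<in>B. convergent (\<lambda>n. cinner (x (r n)) b))"
  using \<open>finite B\<close>
proof (induction B)
  case empty show ?case by (intro exI[of _ id]) (auto simp: strict_mono_def)
next
  case (insert b B)
  then obtain r :: "nat \<Rightarrow> nat" where r: "strict_mono r" "\<And>b. b \<in> B \<Longrightarrow> convergent (\<lambda>n. cinner (x (r n)) b)"
    by blast
  have "norm (cinner (x (r n)) b) \<le> K * norm b" for n
    using cinner_Cauchy_Schwarz[of "x (r n)" b] mult_right_mono[OF bd[of "r n"], of "norm b"] by simp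
  then have "bounded (range (\<lambda>n. cinner (x (r n)) b))" by (intro boundedI) auto
  then obtain l s where s: "strict_mono (s::nat\<Rightarrow>nat)" "((\<lambda>n. cinner (x (r n)) b) \<circ> s) \<longlonglongrightarrow> l"
    using bounded_imp_convergent_subsequence by blast
  have "convergent (\<lambda>n. cinner (x ((r \<circ> s) n)) c)" if "c \<in> B" for c
    using convergent_subseq_convergent[OF r(2)[OF that] s(1)] by (simp add: o_def)
  moreover have "convergent (\<lambda>n. cinner (x ((r \<circ> s) n)) b)" using s(2) by (auto simp: o_def convergent_def)
  ultimately show ?case using r(1) s(1) by (intro exI[of _ "r \<circ> s"]) (auto simp: strict_mono_def)
qed

text \<open>A substitute for compactness. The components along the finite orthonormal set converge along a
  subsequence, and the lower bound makes the remaining components a Cauchy sequence.\<close>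

lemma upper_semi_Fredholm_subsequence:
  fixes A :: "'h::complex_hilbert \<Rightarrow> 'h"
  assumes A: "bounded_clinear A" "upper_semi_Fredholm A"
    and bd: "\<And>n. norm (x n) \<le> K" and conv: "convergent (\<lambda>n. A (x n))"
  obtains r y where "strict_mono (r::nat \<Rightarrow> nat)" "(\<lambda>n. x (r n)) \<longlonglongrightarrow> y"
proof -
  obtain B c where B: "finite B" "orthonormal B" "c > 0"
    "\<And>x. (\<And>b. b\<in>B \<Longrightarrow> cinner x b = 0) \<Longrightarrow> c * norm x \<le> norm (A x)"
    using A(2) unfolding upper_semi_Fredholm_def by blast
  obtain r :: "nat \<Rightarrow> nat" where r: "strict_mono r" "\<And>b. b \<in> B \<Longrightarrow> convergent (\<lambda>n. cinner (x (r n)) b)"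
    using convergent_coefficients_subsequence[of x K B] bd B by blast
  define p where "p n = (\<Sum>b\<in>B. cinner (x (r n)) b *\<^sub>C b)" for n
  define q where "q n = x (r n) - p n" for n
  from r(2) obtain L where L: "\<And>b. b \<in> B \<Longrightarrow> (\<lambda>n. cinner (x (r n)) b) \<longlonglongrightarrow> L b"
    unfolding convergent_def by metis
  have p: "p \<longlonglongrightarrow> (\<Sum>b\<in>B. L b *\<^sub>C b)"
    unfolding p_def by (intro tendsto_sum tendsto_scaleC L tendsto_const)
  obtain l where "(\<lambda>n. A (x n)) \<longlonglongrightarrow> l" using conv convergent_def by blast
  then have "(\<lambda>n. A (x (r n))) \<longlonglongrightarrow> l" using LIMSEQ_subseq_LIMSEQ[OF _ r(1)] by (fastforce simp: o_def)
  then have "(\<lambda>n. A (q n)) \<longlonglongrightarrow> l - A (\<Sum>b\<in>B. L b *\<^sub>C b)"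
    unfolding q_def bounded_clinearD(2)[OF A(1)] using p
    by (intro tendsto_diff bounded_clinear_tendsto[OF A(1)]) auto
  then have cau: "Cauchy (\<lambda>n. A (q n))" by (rule LIMSEQ_imp_Cauchy)
  have "Cauchy q"
  proof (rule metric_CauchyI)
    fix e :: real assume "e > 0"
    then obtain N where N: "\<And>m n. m \<ge> N \<Longrightarrow> n \<ge> N \<Longrightarrow> dist (A (q m)) (A (q n)) < c * e"
      using metric_CauchyD[OF cau, of "c * e"] B(3) by auto
    have "dist (q m) (q n) < e" if "m \<ge> N" "n \<ge> N" for m n
    proof -
      have "cinner (q m - q n) b = 0" if "b \<in> B" for b
        using orthonormal_expansion_residual[OF B(1,2) that, of "x (r m)"]
          orthonormal_expansion_residual[OF B(1,2) that, of "x (r n)"]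
        unfolding q_def p_def cinner_diff_left[of "_ - _" "_ - _"] by simp
      then have "c * norm (q m - q n) \<le> norm (A (q m - q n))" by (rule B(4))
      also have "\<dots> < c * e" using N[OF that] by (simp add: dist_norm bounded_clinearD[OF A(1)])
      finally show ?thesis using B(3) by (simp add: dist_norm)
    qed
    then show "\<exists>M. \<forall>m\<ge>M. \<forall>n\<ge>M. dist (q m) (q n) < e" by blast
  qed
  then obtain l' where l': "q \<longlonglongrightarrow> l'" using Cauchy_convergent convergent_def by blast
  have "(\<lambda>n. x (r n)) \<longlonglongrightarrow> l' + (\<Sum>b\<in>B. L b *\<^sub>C b)"
    using tendsto_add[OF l' p] by (simp add: q_def)
  then show thesis using that r(1) by blast
qed

text \<open>On \<open>Y\<close> the operator is bounded below modulo \<open>op_kernel A \<inter> Y\<close>: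
  unit vectors orthogonal to that space with images tending to \<open>0\<close> would have a limit
  point that lies in it and is orthogonal to it.\<close>

lemma upper_semi_Fredholm_lower_bound:
  fixes A :: "'h::complex_hilbert \<Rightarrow> 'h"
  assumes A: "bounded_clinear A" "upper_semi_Fredholm A" and Y: "cvs.subspace Y" "closed Y"
  obtains c where "c > 0" "\<And>y. y \<in> Y \<Longrightarrow> \<exists>y'\<in>Y. A y' = A y \<and> c * norm y' \<le> norm (A y)"
proof -
  let ?N = "op_kernel A \<inter> Y"
  have N: "cvs.subspace ?N" "closed ?N"
    using A Y by (auto intro: cvs.subspace_inter subspace_op_kernel closed_op_kernel)
  have "\<exists>c>0. \<forall>y\<in>Y. (\<forall>m\<in>?N. cinner y m = 0) \<longrightarrow> c * norm y \<le> norm (A y)"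
  proof (rule ccontr)
    assume neg: "\<not> ?thesis"
    have "\<exists>y. y \<in> Y \<and> (\<forall>m\<in>?N. cinner y m = 0) \<and> norm y = 1 \<and> norm (A y) < 1 / real (Suc n)" for n
    proof -
      obtain y where y: "y \<in> Y" "\<forall>m\<in>?N. cinner y m = 0" "norm (A y) < 1 / real (Suc n) * norm y"
        using neg by (metis not_le of_nat_0_less_iff zero_less_Suc zero_less_divide_1_iff)
      then have y0: "y \<noteq> 0" using bounded_clinearD(3)[OF A(1)] by auto
      let ?a = "complex_of_real (1 / norm y)"
      have "norm (A (?a *\<^sub>C y)) < 1 / real (Suc n)"
        unfolding bounded_clinearD(5)[OF A(1)] using y0 y(3)
        by (simp add: norm_scaleC norm_divide divide_simps mult.commute)
      moreover have "norm (?a *\<^sub>C y) = 1" using y0 by (simp add: norm_scaleC norm_divide)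
      ultimately show ?thesis using y Y
        by (intro exI[of _ "?a *\<^sub>C y"]) (auto simp: cvs.subspace_scale cinner_scaleC_left)
    qed
    then obtain y where y: "\<And>n. y n \<in> Y" "\<And>n m. m \<in> ?N \<Longrightarrow> cinner (y n) m = 0" "\<And>n. norm (y n) = 1"
      "\<And>n. norm (A (y n)) < 1 / real (Suc n)" by metis
    have Ay: "(\<lambda>n. A (y n)) \<longlonglongrightarrow> 0"
      by (rule Lim_null_comparison[OF _ LIMSEQ_inverse_real_of_nat])
        (use y(4) in \<open>auto simp: inverse_eq_divide intro!: eventuallyI less_imp_le\<close>)
    have "norm (y n) \<le> 1" for n by (simp add: y(3))
    then obtain r l where r: "strict_mono (r::nat \<Rightarrow> nat)" "(\<lambda>n. y (r n)) \<longlonglongrightarrow> l"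
      using upper_semi_Fredholm_subsequence[OF A _ convergentI[OF Ay]] by blast
    have "l \<in> Y" by (rule closed_sequentially[OF Y(2) _ r(2)]) (rule y(1))
    moreover have "A l = 0"
      by (rule LIMSEQ_unique[OF bounded_clinear_tendsto[OF A(1) r(2)]])
        (use LIMSEQ_subseq_LIMSEQ[OF Ay r(1)] in \<open>simp add: o_def\<close>)
    ultimately have lN: "l \<in> ?N" by (simp add: op_kernel_def)
    have "(\<lambda>n. cinner (y (r n)) l) \<longlonglongrightarrow> cinner l l" by (intro tendsto_cinner r(2) tendsto_const)
    then have "cinner l l = 0" unfolding y(2)[OF lN] by (rule LIMSEQ_unique[OF _ tendsto_const])
    moreover have "norm l = 1"
      using LIMSEQ_unique[OF tendsto_norm[OF r(2)]] y(3) by simp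
    ultimately show False by auto
  qed
  then obtain c where c: "c > 0" "\<And>y. y \<in> Y \<Longrightarrow> (\<forall>m\<in>?N. cinner y m = 0) \<Longrightarrow> c * norm y \<le> norm (A y)"
    by blast
  have "\<exists>y'\<in>Y. A y' = A y \<and> c * norm y' \<le> norm (A y)" if y: "y \<in> Y" for y
  proof -
    obtain p where p: "p \<in> ?N" "\<And>m. m \<in> ?N \<Longrightarrow> cinner (y - p) m = 0"
      using orthogonal_projection_exists[OF N, of y] by blast
    have "y - p \<in> Y" using y p Y by (auto simp: cvs.subspace_diff)
    moreover have "A (y - p) = A y" using p by (simp add: bounded_clinearD[OF A(1)] op_kernel_def)
    ultimately show ?thesis using c(2)[of "y - p"] p(2) by metis
  qed
  then show thesis using that c(1) by blast
qed

lemma upper_semi_Fredholm_closed_image: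
  fixes A :: "'h::complex_hilbert \<Rightarrow> 'h"
  assumes A: "bounded_clinear A" "upper_semi_Fredholm A" and Y: "cvs.subspace Y" "closed Y"
  shows "closed (A ` Y)"
  unfolding closed_sequential_limits
proof (intro allI impI, elim conjE)
  fix z l assume z: "\<forall>n. z n \<in> A ` Y" and l: "z \<longlonglongrightarrow> l"
  obtain c where c: "c > 0" "\<And>y. y \<in> Y \<Longrightarrow> \<exists>y'\<in>Y. A y' = A y \<and> c * norm y' \<le> norm (A y)"
    using upper_semi_Fredholm_lower_bound[OF A Y] by blast
  have "\<exists>y'\<in>Y. A y' = z n \<and> c * norm y' \<le> norm (z n)" for n
    using z c(2) by (metis imageE)
  then obtain y where y: "\<And>n. y n \<in> Y" "\<And>n. A (y n) = z n" "\<And>n. c * norm (y n) \<le> norm (z n)" by metis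
  obtain K where K: "\<And>n. norm (z n) \<le> K"
    using convergent_imp_Bseq[OF convergentI[OF l]] unfolding Bseq_def by blast
  have "norm (y n) \<le> K / c" for n using y(3)[of n] K[of n] c(1) by (simp add: pos_le_divide_eq mult.commute)
  moreover have "convergent (\<lambda>n. A (y n))" unfolding y(2) by (rule convergentI[OF l])
  ultimately obtain r w where r: "strict_mono (r::nat\<Rightarrow>nat)" "(\<lambda>n. y (r n)) \<longlonglongrightarrow> w"
    using upper_semi_Fredholm_subsequence[OF A] by blast
  have "w \<in> Y" by (rule closed_sequentially[OF Y(2) _ r(2)]) (rule y(1))
  moreover have "(\<lambda>n. z (r n)) \<longlonglongrightarrow> A w"
    using bounded_clinear_tendsto[OF A(1) r(2)] unfolding y(2) .
  then have "A w = l"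
    by (rule LIMSEQ_unique) (use LIMSEQ_subseq_LIMSEQ[OF l r(1)] in \<open>simp add: o_def\<close>)
  ultimately show "l \<in> A ` Y" by blast
qed

lemma upper_semi_Fredholm_iff:
  fixes A :: "'h::complex_hilbert \<Rightarrow> 'h"
  assumes A: "bounded_clinear A"
  shows "upper_semi_Fredholm A \<longleftrightarrow> closed (range A) \<and> finitely_spanned (op_kernel A)"
proof
  assume U: "upper_semi_Fredholm A"
  then obtain B c where B: "finite B" "c > 0"
    "\<And>x. (\<forall>b\<in>B. cinner x b = 0) \<Longrightarrow> c * norm x \<le> norm (A x)"
    unfolding upper_semi_Fredholm_def by blast
  have "finitely_spanned (op_kernel A)"
  proof (rule ccontr)
    assume "\<not> ?thesis"
    then obtain v where "v \<in> op_kernel A" "norm v = 1" "\<forall>b\<in>B. cinner v b = 0"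
      using not_finitely_spanned_orthogonal[OF subspace_op_kernel[OF A] _ B(1)] by blast
    then show False using B(2) B(3)[of v] by (simp add: op_kernel_def)
  qed
  then show "closed (range A) \<and> finitely_spanned (op_kernel A)"
    using upper_semi_Fredholm_closed_image[OF A U, of UNIV] by simp
next
  assume *: "closed (range A) \<and> finitely_spanned (op_kernel A)"
  then obtain c where c: "c > 0" "\<And>x. \<exists>x'. A x' = A x \<and> c * norm x' \<le> norm (A x)"
    using closed_range_lower_bound[of A] A unfolding bounded_clinear_def by blast
  obtain B where B: "finite B" "orthonormal B" "op_kernel A \<subseteq> cvs.span B"
    using * finitely_spanned_orthonormal by blast
  have "c * norm x \<le> norm (A x)" if x: "\<forall>b\<in>B. cinner x b = 0" for x
  proof -
    obtain x' where x': "A x' = A x" "c * norm x' \<le> norm (A x)" using c by blast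
    have "x' - x \<in> op_kernel A" using x' by (simp add: op_kernel_def bounded_clinearD[OF A])
    then have "cinner x (x' - x) = 0" using B(3) x cinner_span_eq_0 by blast
    then have "norm x \<le> norm x'" using norm_le_norm_add_orthogonal[of x "x' - x"] by simp
    then have "c * norm x \<le> c * norm x'" using c(1) by simp
    then show ?thesis using x'(2) by linarith
  qed
  then show "upper_semi_Fredholm A" unfolding upper_semi_Fredholm_def using B c(1) by blast
qed

lemma upper_semi_Fredholm_open:
  fixes A :: "'h::complex_hilbert \<Rightarrow> 'h"
  assumes "upper_semi_Fredholm A"
  obtains \<delta> where "\<delta> > 0" "\<And>D. (\<And>x. norm (D x - A x) \<le> \<delta> * norm x) \<Longrightarrow> upper_semi_Fredholm D"
proof -
  obtain B c where B: "finite B" "orthonormal B" "c > 0"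
    "\<And>x. (\<forall>b\<in>B. cinner x b = 0) \<Longrightarrow> c * norm x \<le> norm (A x)"
    using assms unfolding upper_semi_Fredholm_def by blast
  show thesis
  proof (rule that[of "c / 2"])
    fix D assume D: "\<And>x. norm (D x - A x) \<le> c / 2 * norm x"
    have "c / 2 * norm x \<le> norm (D x)" if x: "\<forall>b\<in>B. cinner x b = 0" for x
    proof -
      have "norm (A x) \<le> norm (D x) + norm (D x - A x)"
        using norm_triangle_ineq4[of "D x" "D x - A x"] by simp
      then show ?thesis using B(4)[OF x] D[of x] by argo
    qed
    then show "upper_semi_Fredholm D" unfolding upper_semi_Fredholm_def
      using B(1-3) by (intro exI[of _ B] exI[of _ "c/2"]) auto
  qed (use B in simp)
qed

lemma mem_span_if_orthogonal_to_complement: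
  fixes B :: "'h::complex_inner set"
  assumes B: "finite B" "orthonormal B" and z: "\<And>y. (\<forall>b\<in>B. cinner y b = 0) \<Longrightarrow> cinner z y = 0"
  shows "z \<in> cvs.span B"
proof -
  let ?p = "\<Sum>b\<in>B. cinner z b *\<^sub>C b"
  have p: "?p \<in> cvs.span B" by (intro cvs.span_sum cvs.span_scale cvs.span_base)
  have r: "\<forall>b\<in>B. cinner (z - ?p) b = 0" using orthonormal_expansion_residual[OF B] by blast
  then have "cinner z (z - ?p) = 0" by (rule z)
  moreover have "cinner (z - ?p) ?p = 0" using p r cinner_span_eq_0 by blast
  then have "cinner ?p (z - ?p) = 0" using cinner_eq_0_commute by blast
  ultimately have "cinner (z - ?p) (z - ?p) = 0" unfolding cinner_diff_left[of z ?p "z - ?p"] by simp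
  then show ?thesis using p by (metis cinner_self_eq_0 eq_iff_diff_eq_0)
qed

lemma subspace_image:
  assumes A: "bounded_clinear A" and Y: "cvs.subspace Y"
  shows "cvs.subspace (A ` Y)"
proof (rule cvs.subspaceI)
  show "0 \<in> A ` Y"
    using bounded_clinearD(3)[OF A] cvs.subspace_0[OF Y] by (intro image_eqI[of _ _ 0]) auto
  fix u v a assume "u \<in> A ` Y" "v \<in> A ` Y"
  then obtain x y where xy: "u = A x" "v = A y" "x \<in> Y" "y \<in> Y" by blast
  show "u + v \<in> A ` Y"
    using xy by (intro image_eqI[of _ _ "x + y"]) (auto simp: bounded_clinearD(1)[OF A] cvs.subspace_add[OF Y])
  show "a *\<^sub>C u \<in> A ` Y"
    using xy by (intro image_eqI[of _ _ "a *\<^sub>C x"]) (auto simp: bounded_clinearD(5)[OF A] cvs.subspace_scale[OF Y])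
qed

text \<open>A special case of the continuity of the index: closed range, infinite-dimensional kernel and
  finite-dimensional cokernel exclude injectivity of nearby operators \<open>D\<close>. The
  argument passes to adjoints. On the complement of the finite cokernel the adjoint of
  \<open>D\<close> is bounded below; if \<open>D\<close> were injective, the image of that
  complement would have finite codimension and hence contain a unit vector \<open>k\<close> of the
  kernel of \<open>A\<close>. But the range of the adjoint of \<open>A\<close> is orthogonal to
  \<open>k\<close>, and the two adjoints are too close for this.\<close>

lemma nearby_kernel_nontrivial:
  fixes A :: "'h::complex_hilbert \<Rightarrow> 'h"
  assumes A: "bounded_clinear A" and cl: "closed (range A)"
    and kinf: "\<not> finitely_spanned (op_kernel A)"
    and cofin: "finitely_spanned (op_kernel (hilbert_adjoint A))"
  obtains \<delta> where "\<delta> > 0" "\<And>D. bounded_clinear D \<Longrightarrow> (\<And>x. norm (D x - A x) \<le> \<delta> * norm x) \<Longrightarrow> op_kernel D \<noteq> {0}"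
proof -
  let ?A' = "hilbert_adjoint A"
  obtain c where c: "c > 0" "\<And>x. \<exists>x'. A x' = A x \<and> c * norm x' \<le> norm (A x)"
    using closed_range_lower_bound[of A] A cl unfolding bounded_clinear_def by blast
  obtain B where B: "finite B" "orthonormal B" "op_kernel ?A' \<subseteq> cvs.span B"
    using cofin finitely_spanned_orthonormal by blast
  have sR: "cvs.subspace (range A)" using A by (intro subspace_image) auto
  have lowA: "c * norm y \<le> norm (?A' y)" if y: "\<forall>b\<in>B. cinner y b = 0" for y
  proof -
    obtain p where p: "p \<in> range A" "\<And>m. m \<in> range A \<Longrightarrow> cinner (y - p) m = 0"
      using orthogonal_projection_exists[OF sR cl, of y] by blast
    have "cinner x (?A' (y - p)) = cinner x 0" for x
      using p(2)[of "A x"] cinner_eq_0_commute by (auto simp: hilbert_adjoint[OF A, symmetric])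
    then have "?A' (y - p) = 0" by (rule cinner_ext)
    then have "y - p \<in> op_kernel ?A'" by (simp add: op_kernel_def)
    then have "cinner y (y - p) = 0" using B(3) y cinner_span_eq_0 by blast
    moreover have "cinner p (y - p) = 0" using p cinner_eq_0_commute by blast
    ultimately have "cinner (y - p) (y - p) = 0" unfolding cinner_diff_left[of y p "y - p"] by simp
    then have "y \<in> range A" using p by simp
    then obtain x where x: "A x = y" "c * norm x \<le> norm y" using c(2) by (metis rangeE)
    have "norm y * norm y = cmod (cinner (A x) y)" using x by (simp add: power2_eq_square)
    also have "\<dots> = cmod (cinner x (?A' y))" by (simp add: hilbert_adjoint[OF A])
    also have "\<dots> \<le> norm x * norm (?A' y)" by (rule cinner_Cauchy_Schwarz)
    finally have "c * (norm y * norm y) \<le> c * (norm x * norm (?A' y))" using c(1) by (intro mult_left_mono) auto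
    also have "\<dots> \<le> norm y * norm (?A' y)" using mult_right_mono[OF x(2), of "norm (?A' y)"] by (simp add: mult.assoc)
    finally have "norm y * (c * norm y) \<le> norm y * norm (?A' y)" by (simp add: mult_ac)
    then show ?thesis by (cases "y = 0") auto
  qed
  show thesis
  proof (rule that[of "c / 3"])
    fix D assume D: "bounded_clinear D" and near: "\<And>x. norm (D x - A x) \<le> c / 3 * norm x"
    let ?D' = "hilbert_adjoint D"
    let ?P = "{y. \<forall>b\<in>B. cinner y b = 0}"
    have D': "bounded_clinear ?D'" using D by (rule bounded_clinear_hilbert_adjoint)
    have adj: "cmod (cinner w (?D' y - ?A' y)) \<le> c / 3 * norm w * norm y" for w y
    proof -
      have "cinner w (?D' y - ?A' y) = cinner (D w - A w) y"
        by (simp add: cinner_diff_left cinner_diff_right hilbert_adjoint[OF A] hilbert_adjoint[OF D])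
      then show ?thesis
        using order_trans[OF cinner_Cauchy_Schwarz mult_right_mono[OF near[of w] norm_ge_zero[of y]]] by (simp only:)
    qed
    have near': "norm (?D' y - ?A' y) \<le> c / 3 * norm y" for y
    proof (cases "?D' y - ?A' y = 0")
      case False
      have "norm (?D' y - ?A' y) * norm (?D' y - ?A' y) \<le> norm (?D' y - ?A' y) * (c / 3 * norm y)"
        using adj[of "?D' y - ?A' y" y] by (simp add: power2_eq_square mult_ac)
      then show ?thesis using False by simp
    qed (use c in simp)
    have lowD: "2 * c / 3 * norm y \<le> norm (?D' y)" if "y \<in> ?P" for y
    proof -
      have "norm (?A' y) \<le> norm (?D' y) + norm (?D' y - ?A' y)"
        using norm_triangle_ineq4[of "?D' y" "?D' y - ?A' y"] by simp
      moreover have "c * norm y \<le> norm (?A' y)" using lowA[of y] that by blast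
      ultimately show ?thesis using near'[of y] by argo
    qed
    then have "upper_semi_Fredholm ?D'" unfolding upper_semi_Fredholm_def
      using B(1,2) c(1) by (intro exI[of _ B] exI[of _ "2 * c / 3"]) auto
    moreover have P: "cvs.subspace ?P" "closed ?P"
    proof -
      show "cvs.subspace ?P" by (rule cvs.subspaceI) (auto simp: cinner_simps)
      have "?P = (\<Inter>b\<in>B. {y. cinner y b = 0})" by blast
      moreover have "closed {y. cinner y b = 0}" for b :: 'h
        by (intro closed_Collect_eq bounded_linear.continuous_on[OF bounded_bilinear.bounded_linear_left[OF bounded_bilinear_cinner]]
            continuous_on_id continuous_on_const)
      ultimately show "closed ?P" by (simp add: closed_INT)
    qed
    ultimately have clW: "closed (?D' ` ?P)" using upper_semi_Fredholm_closed_image D' by blast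
    have sW: "cvs.subspace (?D' ` ?P)" by (rule subspace_image[OF D' P(1)])
    show "op_kernel D \<noteq> {0}"
    proof
      assume inj: "op_kernel D = {0}"
      let ?V = "{w. D w \<in> cvs.span B}"
      have sV: "cvs.subspace ?V"
      proof (rule cvs.subspaceI)
        show "0 \<in> ?V" using cvs.span_zero[of B] bounded_clinearD(3)[OF D] by simp
        show "x + y \<in> ?V" if "x \<in> ?V" "y \<in> ?V" for x y
          using that cvs.span_add[of "D x" B "D y"] bounded_clinearD(1)[OF D, of x y] by simp
        show "a *\<^sub>C x \<in> ?V" if "x \<in> ?V" for a x
          using that cvs.span_scale[of "D x" B a] bounded_clinearD(5)[OF D, of a x] by simp
      qed
      let ?\<Phi> = "(\<lambda>b w. cinner (D w) b) ` B"
      let ?VZ = "{v \<in> ?V. \<forall>f\<in>?\<Phi>. f v = 0}"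
      have "v = 0" if v: "D v \<in> cvs.span B" "\<forall>f\<in>?\<Phi>. f v = 0" for v
      proof -
        have "cinner (D v) (D v) = 0" 
        proof (rule cinner_span_eq_0[OF v(1)])
          show "cinner (D v) b = 0" if "b \<in> B" for b using v(2) that by simp
        qed
        then have "v \<in> op_kernel D" by (simp add: op_kernel_def)
        then show "v = 0" using inj by simp
      qed
      then have "?VZ \<subseteq> cvs.span {}" by auto
      then have V0: "finitely_spanned ?VZ" unfolding finitely_spanned_def by (intro exI[of _ "{}"]) blast
      have lin: "(\<forall>x y. f (x + y) = f x + f y) \<and> (\<forall>a x. f (a *\<^sub>C x) = a * f x)" if "f \<in> ?\<Phi>" for f
        using that bounded_clinearD(1,5)[OF D] by (auto simp: cinner_add_left cinner_scaleC_left)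
      have fin: "finite ?\<Phi>" using B(1) by simp
      have "finitely_spanned ?V"
      proof (rule finitely_spanned_by_functionals)
        show "finite ?\<Phi>" by (rule fin)
        show "cvs.subspace ?V" by (rule sV)
        show "finitely_spanned ?VZ" by (rule V0)
        show "(\<forall>x y. f (x + y) = f x + f y) \<and> (\<forall>a x. f (a *\<^sub>C x) = a * f x)" if "f \<in> ?\<Phi>" for f
          by (rule lin[OF that])
      qed
      then obtain F where F: "finite F" "?V \<subseteq> cvs.span F" unfolding finitely_spanned_def by blast
      obtain k where k: "k \<in> op_kernel A" "norm k = 1" "\<forall>b\<in>F. cinner k b = 0"
        using not_finitely_spanned_orthogonal[OF subspace_op_kernel[OF A] kinf F(1)] by blast
      obtain p where p: "p \<in> ?D' ` ?P" "\<And>m. m \<in> ?D' ` ?P \<Longrightarrow> cinner (k - p) m = 0"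
        using orthogonal_projection_exists[OF sW clW, of k] by blast
      have "D (k - p) \<in> cvs.span B"
        by (rule mem_span_if_orthogonal_to_complement[OF B(1,2)]) (use p(2) in \<open>auto simp: hilbert_adjoint[OF D]\<close>)
      then have "k - p \<in> ?V" by simp
      then have "cinner k (k - p) = 0" using F(2) k(3) cinner_span_eq_0 by blast
      moreover have "cinner p (k - p) = 0" using p cinner_eq_0_commute by blast
      ultimately have "cinner (k - p) (k - p) = 0" unfolding cinner_diff_left[of k p "k - p"] by simp
      then have "k \<in> ?D' ` ?P" using p by simp
      then obtain y where y: "y \<in> ?P" "k = ?D' y" by blast
      have "cinner k (?A' y) = 0" using k(1) by (simp add: hilbert_adjoint[OF A, symmetric] op_kernel_def)
      then have "cinner k (?D' y - ?A' y) = cinner k k" using y by (simp add: cinner_diff_right)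
      then have "1 \<le> c / 3 * norm y" using adj[of k y] k(2) by simp
      moreover have "2 * c / 3 * norm y \<le> 1" using lowD[OF y(1)] y(2) k(2) by simp
      ultimately show False by simp
    qed
  qed (use c in simp)
qed

section \<open>Distributionally irregular vectors\<close>

definition distributionally_irregular :: "('a::real_normed_vector \<Rightarrow> 'a) \<Rightarrow> 'a \<Rightarrow> bool" where
  "distributionally_irregular T v \<longleftrightarrow>
     (\<forall>k::nat. \<exists>n\<ge>k. real n * (1 - 1 / Suc k) < card {i. i < n \<and> norm ((T ^^ i) v) < 1 / Suc k}) \<and>
     (\<forall>k::nat. \<exists>n\<ge>k. real n * (1 - 1 / Suc k) < card {i. i < n \<and> k < norm ((T ^^ i) v)})"

lemma funpow_linear:
  fixes T :: "'a::real_vector \<Rightarrow> 'a"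
  assumes "linear T" shows "linear (T ^^ n)"
proof (induction n)
  case 0 show ?case using linear_id by (simp add: id_def)
next
  case (Suc n) then show ?case using linear_compose[OF Suc assms] by (simp add: o_def)
qed

lemma funpow_bounded_linear:
  fixes T :: "'a::real_normed_vector \<Rightarrow> 'a"
  assumes "bounded_linear T" shows "bounded_linear (T ^^ n)"
proof (induction n)
  case 0 show ?case using bounded_linear_ident by (simp add: id_def)
next
  case (Suc n) then show ?case using bounded_linear_compose[OF assms Suc] by (simp add: o_def)
qed

lemma limsup_ge_frequently:
  fixes f :: "nat \<Rightarrow> ereal"
  assumes "\<And>N. \<exists>n\<ge>N. c \<le> f n" shows "c \<le> limsup f"
proof (rule ccontr)
  assume "\<not> c \<le> limsup f"
  then have "eventually (\<lambda>n. f n < c) sequentially" by (intro Limsup_lessD) auto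
  then show False using assms unfolding eventually_sequentially by (meson not_le)
qed

lemma liminf_le_frequently:
  fixes f :: "nat \<Rightarrow> ereal"
  assumes "\<And>N. \<exists>n\<ge>N. f n \<le> c" shows "liminf f \<le> c"
proof (rule ccontr)
  assume "\<not> liminf f \<le> c"
  then have "eventually (\<lambda>n. c < f n) sequentially" by (intro less_LiminfD) auto
  then show False using assms unfolding eventually_sequentially by (meson not_le)
qed

lemma orbit_freq_bounds: "0 \<le> orbit_freq f x y n \<tau>" "orbit_freq f x y n \<tau> \<le> 1"
proof -
  have "card {i. i < n \<and> dist ((f ^^ i) x) ((f ^^ i) y) < \<tau>} \<le> card {..<n}" by (intro card_mono) auto
  then show "orbit_freq f x y n \<tau> \<le> 1" unfolding orbit_freq_def by (cases "n = 0") auto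
qed (simp add: orbit_freq_def)

text \<open>The scrambled set consists of the real multiples of \<open>v\<close>: by linearity the distance of
  two of their orbits is a fixed positive multiple of the norm along the orbit of
  \<open>v\<close>.\<close>

lemma distributionally_irregular_imp_chaotic:
  fixes T :: "'a::real_normed_vector \<Rightarrow> 'a"
  assumes T: "linear T" and v: "distributionally_irregular T v"
  shows "distributionally_chaotic T"
proof -
  let ?N = "\<lambda>i. norm ((T ^^ i) v)"
  note lin = funpow_linear[OF T]
  have v1: "\<exists>n\<ge>k. real n * (1 - 1 / Suc k) < card {i. i < n \<and> ?N i < 1 / Suc k}"
    and v2: "\<exists>n\<ge>k. real n * (1 - 1 / Suc k) < card {i. i < n \<and> k < ?N i}" for k :: nat
    using v unfolding distributionally_irregular_def by blast+
  have "v \<noteq> 0"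
  proof
    assume "v = 0"
    then have "?N i = 0" for i using linear_0[OF lin] by simp
    then show False using v2[of 0] by simp
  qed
  then have "inj (\<lambda>a::real. a *\<^sub>R v)" by (auto simp: inj_def)
  then have unc: "uncountable (range (\<lambda>a::real. a *\<^sub>R v))"
    using uncountable_UNIV_real countable_image_inj_on by blast
  have "distributionally_chaotic_pair T (a *\<^sub>R v) (b *\<^sub>R v)" if ab: "a \<noteq> b" for a b :: real
  proof -
    define s where "s = \<bar>a - b\<bar>"
    have s: "s > 0" using ab by (simp add: s_def)
    have d: "dist ((T ^^ i) (a *\<^sub>R v)) ((T ^^ i) (b *\<^sub>R v)) = s * ?N i" for i
      by (simp add: s_def dist_norm linear_scale[OF lin] scaleR_left_diff_distrib[symmetric])
    have fr: "orbit_freq T (a *\<^sub>R v) (b *\<^sub>R v) n \<tau> = card {i. i < n \<and> s * ?N i < \<tau>} / n" for n \<tau>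
      by (simp add: orbit_freq_def d)
    have up: "upper_distribution T (a *\<^sub>R v) (b *\<^sub>R v) \<tau> = 1" if t: "\<tau> > 0" for \<tau>
    proof (rule antisym)
      show "upper_distribution T (a *\<^sub>R v) (b *\<^sub>R v) \<tau> \<le> 1"
        unfolding upper_distribution_def by (rule Limsup_bounded) (auto simp: orbit_freq_bounds)
      have "ereal (1 - e) \<le> upper_distribution T (a *\<^sub>R v) (b *\<^sub>R v) \<tau>" if e: "e > 0" for e
        unfolding upper_distribution_def
      proof (rule limsup_ge_frequently)
        fix N
        obtain k0 where k0: "s / \<tau> + 1 / e < real k0" using reals_Archimedean2 by blast
        define k where "k = max k0 (Suc N)"
        have k: "s / \<tau> + 1 / e < real (Suc k)" using k0 unfolding k_def by simp
        have k1: "s / \<tau> < real (Suc k)" and k2: "1 / e < real (Suc k)"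
          using k s t e by (smt (verit) zero_less_divide_iff)+
        obtain n where n: "n \<ge> k" "real n * (1 - 1 / Suc k) < card {i. i < n \<and> ?N i < 1 / Suc k}"
          using v1[of k] by blast
        have n0: "n > 0" using n(1) by (simp add: k_def)
        have "{i. i < n \<and> ?N i < 1 / Suc k} \<subseteq> {i. i < n \<and> s * ?N i < \<tau>}"
        proof safe
          fix i assume "?N i < 1 / Suc k"
          then have "s * ?N i < s * (1 / Suc k)" using s by (rule mult_strict_left_mono)
          also have "\<dots> \<le> \<tau>" using k1 t by (simp add: field_simps)
          finally show "s * ?N i < \<tau>" .
        qed
        then have "card {i. i < n \<and> ?N i < 1 / Suc k} \<le> card {i. i < n \<and> s * ?N i < \<tau>}"
          by (intro card_mono) auto
        then have "real n * (1 - 1 / Suc k) \<le> card {i. i < n \<and> s * ?N i < \<tau>}" using n(2) by linarith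
        then have "1 - 1 / Suc k \<le> card {i. i < n \<and> s * ?N i < \<tau>} / n"
          using n0 by (simp add: pos_le_divide_eq mult.commute)
        moreover have "1 / Suc k \<le> e" using k2 e by (simp add: field_simps)
        ultimately show "\<exists>n\<ge>N. ereal (1 - e) \<le> ereal (orbit_freq T (a *\<^sub>R v) (b *\<^sub>R v) n \<tau>)"
          using n(1) unfolding fr by (intro exI[of _ n]) (auto simp: k_def)
      qed
      then have *: "ereal (1 - inverse (Suc n)) \<le> upper_distribution T (a *\<^sub>R v) (b *\<^sub>R v) \<tau>" for n by simp
      have "(\<lambda>n. ereal (1 - inverse (Suc n))) \<longlonglongrightarrow> ereal (1 - 0)"
        by (intro tendsto_ereal tendsto_diff tendsto_const LIMSEQ_inverse_real_of_nat)
      then have "ereal (1 - 0) \<le> upper_distribution T (a *\<^sub>R v) (b *\<^sub>R v) \<tau>"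
        by (rule LIMSEQ_le_const2) (use * in blast)
      then show "1 \<le> upper_distribution T (a *\<^sub>R v) (b *\<^sub>R v) \<tau>" by (simp add: one_ereal_def)
    qed
    have low: "lower_distribution T (a *\<^sub>R v) (b *\<^sub>R v) 1 = 0"
    proof (rule antisym)
      show "0 \<le> lower_distribution T (a *\<^sub>R v) (b *\<^sub>R v) 1"
        unfolding lower_distribution_def by (rule Liminf_bounded) (auto simp: orbit_freq_bounds)
      have "lower_distribution T (a *\<^sub>R v) (b *\<^sub>R v) 1 \<le> 0 + ereal e" if e: "e > 0" for e
        unfolding lower_distribution_def
      proof (rule liminf_le_frequently)
        fix N
        obtain k0 where k0: "1 / s + 1 / e < real k0" using reals_Archimedean2 by blast
        define k where "k = max k0 (Suc N)"
        have k: "1 / s + 1 / e < real k" using k0 unfolding k_def by simp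
        have k1: "1 / s < real k" and k2: "1 / e < real (Suc k)"
          using k s e by (smt (verit) zero_less_divide_iff of_nat_Suc)+
        obtain n where n: "n \<ge> k" "real n * (1 - 1 / Suc k) < card {i. i < n \<and> k < ?N i}"
          using v2[of k] by blast
        have n0: "n > 0" using n(1) by (simp add: k_def)
        have dis: "{i. i < n \<and> s * ?N i < 1} \<inter> {i. i < n \<and> k < ?N i} = {}"
        proof safe
          fix i assume "k < ?N i" "s * ?N i < 1"
          moreover have "1 < s * k" using k1 s by (simp add: field_simps)
          ultimately show "i \<in> {}" using s by (smt (verit) mult_less_cancel_left_pos)
        qed
        have "card {i. i < n \<and> s * ?N i < 1} + card {i. i < n \<and> k < ?N i}
            = card ({i. i < n \<and> s * ?N i < 1} \<union> {i. i < n \<and> k < ?N i})"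
          using dis by (intro card_Un_disjoint[symmetric]) auto
        also have "\<dots> \<le> card {..<n}" by (intro card_mono) auto
        finally have "card {i. i < n \<and> s * ?N i < 1} \<le> n - real n * (1 - 1 / Suc k)"
          using n(2) by simp
        also have "\<dots> = n * (1 / Suc k)" by (simp add: algebra_simps)
        finally have "card {i. i < n \<and> s * ?N i < 1} / n \<le> 1 / Suc k"
          using n0 by (simp add: pos_divide_le_eq mult.commute)
        moreover have "1 / Suc k \<le> e" using k2 e by (simp add: field_simps)
        ultimately show "\<exists>n\<ge>N. ereal (orbit_freq T (a *\<^sub>R v) (b *\<^sub>R v) n 1) \<le> 0 + ereal e"
          using n(1) unfolding fr by (intro exI[of _ n]) (auto simp: k_def)
      qed
      then show "lower_distribution T (a *\<^sub>R v) (b *\<^sub>R v) 1 \<le> 0"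
        by (rule ereal_le_epsilon2[rule_format])
    qed
    show ?thesis unfolding distributionally_chaotic_pair_def using up low by (auto intro!: exI[of _ 1])
  qed
  then have "pairwise (distributionally_chaotic_pair T) (range (\<lambda>a::real. a *\<^sub>R v))"
    unfolding pairwise_def by auto
  then show ?thesis unfolding distributionally_chaotic_def using unc by (intro exI conjI)
qed

lemma eventually_imp_high_density:
  assumes "eventually P sequentially"
  shows "\<exists>n\<ge>k. real n * (1 - 1 / Suc k) < card {i. i < n \<and> P i}"
proof -
  obtain N where N: "\<And>i. i \<ge> N \<Longrightarrow> P i" using assms eventually_sequentially by auto
  define n where "n = Suc N * Suc k"
  have "n \<ge> Suc k" "n \<ge> Suc N" by (simp_all add: n_def)
  have "card {N..<n} \<le> card {i. i < n \<and> P i}" by (intro card_mono) (auto simp: N)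
  then have "real n - N \<le> card {i. i < n \<and> P i}" using \<open>n \<ge> Suc N\<close> by simp
  moreover have "real n * (1 - 1 / Suc k) = real n - Suc N" by (simp add: n_def field_simps)
  ultimately have "real n * (1 - 1 / Suc k) < card {i. i < n \<and> P i}" by simp
  then show ?thesis using \<open>n \<ge> Suc k\<close> by (intro exI[of _ n]) auto
qed

lemma open_card_greater:
  fixes c :: real
  assumes "\<And>i. open {v. P i v}"
  shows "open {v. c < card {i. i < (n::nat) \<and> P i v}}"
proof (subst open_subopen, safe)
  fix v assume v: "c < card {i. i < n \<and> P i v}"
  let ?S = "{i. i < n \<and> P i v}" and ?T = "\<Inter>i\<in>{i. i < n \<and> P i v}. {w. P i w}"
  have "open ?T" using assms by (intro open_INT) auto
  moreover have "c < card {i. i < n \<and> P i w}" if "w \<in> ?T" for w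
  proof -
    have "card ?S \<le> card {i. i < n \<and> P i w}" using that by (intro card_mono) auto
    then show ?thesis using v by linarith
  qed
  ultimately show "\<exists>T. open T \<and> v \<in> T \<and> T \<subseteq> {v. c < card {i. i < n \<and> P i v}}"
    by (intro exI[of _ ?T]) auto
qed

lemma closure_subspace:
  fixes S :: "'a::real_normed_vector set"
  assumes "subspace S" shows "subspace (closure S)"
proof (rule subspaceI)
  show "0 \<in> closure S" using subspace_0[OF assms] closure_subset by blast
  show "x + y \<in> closure S" if x: "x \<in> closure S" and y: "y \<in> closure S" for x y
  proof -
    obtain f g where "\<And>n. f n \<in> S" "f \<longlonglongrightarrow> x" "\<And>n. g n \<in> S" "g \<longlonglongrightarrow> y"
      using x y unfolding closure_sequential by blast
    then show ?thesis unfolding closure_sequential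
      using subspace_add[OF assms] by (intro exI[of _ "\<lambda>n. f n + g n"]) (auto intro: tendsto_add)
  qed
  show "c *\<^sub>R x \<in> closure S" if x: "x \<in> closure S" for x c
  proof -
    obtain f where "\<And>n. f n \<in> S" "f \<longlonglongrightarrow> x"
      using x unfolding closure_sequential by blast
    then show ?thesis unfolding closure_sequential
      using subspace_scale[OF assms] by (intro exI[of _ "\<lambda>n. c *\<^sub>R f n"]) (auto intro: tendsto_scaleR)
  qed
qed

text \<open>Both halves of irregularity are countable intersections of open conditions. The first holds on the
  dense set \<open>X\<close>, the second on the translates \<open>x + d *\<^sub>R y\<close>, which
  are dense as well; Baire category in \<open>closure X\<close> yields a vector with both
  properties.\<close>

theorem distributional_chaos_criterion:
  fixes T :: "'a::banach \<Rightarrow> 'a"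
  assumes T: "bounded_linear T" and X: "subspace X"
    and null: "\<And>x. x \<in> X \<Longrightarrow> (\<lambda>n. (T ^^ n) x) \<longlonglongrightarrow> 0"
    and y: "y \<in> closure X" and escape: "filterlim (\<lambda>n. norm ((T ^^ n) y)) at_top sequentially"
  shows "\<exists>v. distributionally_irregular T v"
proof -
  let ?Y = "closure X"
  define G where "G k = {v. \<exists>n\<ge>k. real n * (1 - 1 / Suc k) < card {i. i < n \<and> norm ((T ^^ i) v) < 1 / Suc k}}" for k
  define H where "H k = {v. \<exists>n\<ge>k. real n * (1 - 1 / Suc k) < card {i. i < n \<and> k < norm ((T ^^ i) v)}}" for k :: nat
  have cont: "continuous_on UNIV (\<lambda>v. norm ((T ^^ i) v))" for i
    using funpow_bounded_linear[OF T] by (intro continuous_on_norm bounded_linear.continuous_on[OF _ continuous_on_id]) auto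
  have "open (G k)" for k
  proof -
    have "G k = (\<Union>n\<in>{k..}. {v. real n * (1 - 1 / Suc k) < card {i. i < n \<and> norm ((T ^^ i) v) < 1 / Suc k}})"
      unfolding G_def by auto
    moreover have "open {v. norm ((T ^^ i) v) < 1 / Suc k}" for i
      using cont by (intro open_Collect_less continuous_on_const) auto
    ultimately show ?thesis by (simp only:) (intro open_UN ballI open_card_greater)
  qed
  moreover have "open (H k)" for k
  proof -
    have "H k = (\<Union>n\<in>{k..}. {v. real n * (1 - 1 / Suc k) < card {i. i < n \<and> k < norm ((T ^^ i) v)}})"
      unfolding H_def by auto
    moreover have "open {v. k < norm ((T ^^ i) v)}" for i
      using cont by (intro open_Collect_less continuous_on_const) auto
    ultimately show ?thesis by (simp only:) (intro open_UN ballI open_card_greater)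
  qed
  moreover have XG: "X \<subseteq> G k" for k
  proof
    fix x assume "x \<in> X"
    then have "(\<lambda>n. norm ((T ^^ n) x)) \<longlonglongrightarrow> 0" using null tendsto_norm_zero by blast
    then have "eventually (\<lambda>i. norm ((T ^^ i) x) < 1 / Suc k) sequentially" by (rule order_tendstoD) auto
    then show "x \<in> G k" unfolding G_def using eventually_imp_high_density by blast
  qed
  have XH: "x + d *\<^sub>R y \<in> H k" if x: "x \<in> X" and d: "d > 0" for x d k
  proof -
    have "(\<lambda>n. norm ((T ^^ n) x)) \<longlonglongrightarrow> 0" using null x tendsto_norm_zero by blast
    then have "eventually (\<lambda>i. norm ((T ^^ i) x) < 1) sequentially" by (rule order_tendstoD) auto
    moreover have "eventually (\<lambda>i. (k + 1) / d < norm ((T ^^ i) y)) sequentially"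
      using escape unfolding filterlim_at_top_dense by blast
    ultimately have "eventually (\<lambda>i. k < norm ((T ^^ i) (x + d *\<^sub>R y))) sequentially"
    proof eventually_elim
      case (elim i)
      have lin: "linear (T ^^ i)" using T bounded_linear.linear funpow_linear by blast
      have "k + 1 < d * norm ((T ^^ i) y)" using elim(2) d by (simp add: field_simps)
      moreover have "norm (d *\<^sub>R (T ^^ i) y) \<le> norm ((T ^^ i) x + d *\<^sub>R (T ^^ i) y) + norm ((T ^^ i) x)"
        using norm_triangle_ineq4[of "(T ^^ i) x + d *\<^sub>R (T ^^ i) y" "(T ^^ i) x"] by simp
      ultimately show ?case using elim(1) d by (simp add: linear_add[OF lin] linear_scale[OF lin])
    qed
    then show ?thesis unfolding H_def using eventually_imp_high_density by blast
  qed
  have sY: "subspace ?Y" using X by (rule closure_subspace)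
  have XcH: "x \<in> closure (?Y \<inter> H k)" if x: "x \<in> X" for x k
    unfolding closure_sequential
  proof (intro exI[of _ "\<lambda>j. x + (1 / Suc j) *\<^sub>R y"] conjI allI)
    show "x + (1 / Suc j) *\<^sub>R y \<in> ?Y \<inter> H k" for j
      using XH[OF x] sY y x closure_subset[of X] by (auto intro: subspace_add subspace_scale)
    have "(\<lambda>j. x + (1 / Suc j) *\<^sub>R y) \<longlonglongrightarrow> x + 0 *\<^sub>R y"
      using LIMSEQ_inverse_real_of_nat by (intro tendsto_intros) (simp add: inverse_eq_divide)
    then show "(\<lambda>j. x + (1 / Suc j) *\<^sub>R y) \<longlonglongrightarrow> x" by simp
  qed
  let ?\<G> = "(\<lambda>k. ?Y \<inter> G k) ` UNIV \<union> (\<lambda>k. ?Y \<inter> H k) ` UNIV"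
  have "top_of_set ?Y closure_of \<Inter>?\<G> = topspace (top_of_set ?Y)"
  proof (rule Baire_category)
    show "completely_metrizable_space (top_of_set ?Y) \<or> locally_compact_space (top_of_set ?Y) \<and> regular_space (top_of_set ?Y)"
      using completely_metrizable_space_closedin[OF completely_metrizable_space_euclidean, of ?Y]
      by (simp add: closed_closedin[symmetric])
    show "countable ?\<G>" by auto
    fix U assume U: "U \<in> ?\<G>"
    have "openin (top_of_set ?Y) U" using U calculation by (auto simp: openin_open)
    moreover have "?Y \<subseteq> closure U"
    proof (rule closure_minimal)
      have "?Y \<inter> G k \<supseteq> X" for k using XG closure_subset[of X] by blast
      then show "X \<subseteq> closure U" using U XcH closure_subset[of U] by blast
    qed simp
    then have "top_of_set ?Y closure_of U = topspace (top_of_set ?Y)"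
      using U by (auto simp: closure_of_subtopology Int_absorb1)
    ultimately show "openin (top_of_set ?Y) U \<and> top_of_set ?Y closure_of U = topspace (top_of_set ?Y)" by blast
  qed
  moreover have "0 \<in> ?Y" using subspace_0[OF sY] .
  ultimately have "\<Inter>?\<G> \<noteq> {}" by (metis closure_of_empty empty_iff topspace_euclidean_subtopology)
  then obtain v where v: "v \<in> \<Inter>?\<G>" by (metis ex_in_conv)
  have "v \<in> G k" "v \<in> H k" for k using v by auto
  then have "distributionally_irregular T v"
    unfolding distributionally_irregular_def G_def H_def by simp
  then show ?thesis ..
qed

section \<open>Eigenvectors from Jordan chains\<close>

lemma bounded_clinear_shifted:
  assumes "T \<in> bounded_operators" shows "bounded_clinear (shifted l T)"
proof -
  have "bounded_linear (\<lambda>x. l *\<^sub>C x - blinfun_apply T x)"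
    by (intro bounded_linear_sub bounded_bilinear.bounded_linear_right[OF bounded_bilinear_scaleC]
        blinfun.bounded_linear_right)
  then show ?thesis using assms unfolding bounded_clinear_def shifted_def bounded_operators_def
    by (simp add: cvs.scale_right_diff_distrib scaleC_scaleC mult.commute)
qed

lemma norm_shifted_diff_le:
  "norm (shifted l T x - shifted m S x) \<le> (cmod (l - m) + norm (T - S)) * norm x"
proof -
  have "shifted l T x - shifted m S x = (l - m) *\<^sub>C x - blinfun_apply (T - S) x"
    by (simp add: shifted_def cvs.scale_left_diff_distrib blinfun.diff_left)
  also have "norm \<dots> \<le> norm ((l - m) *\<^sub>C x) + norm (blinfun_apply (T - S) x)" by (rule norm_triangle_ineq4)
  also have "\<dots> \<le> cmod (l - m) * norm x + norm (T - S) * norm x"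
    by (intro add_mono norm_blinfun) (simp add: norm_scaleC)
  finally show ?thesis by (simp add: algebra_simps)
qed

lemma shifted_eigenvector_iff:
  "shifted l T x = \<mu> *\<^sub>C x \<longleftrightarrow> shifted (l - \<mu>) T x = 0"
  unfolding shifted_def by (auto simp: cvs.scale_left_diff_distrib algebra_simps)

text \<open>An infinite chain of generalized kernel vectors of at most geometric growth. The growth bound
  makes the generating series \<open>eigen\<close> converge near \<open>0\<close>, where its value
  at \<open>z\<close> is an eigenvector for the eigenvalue \<open>z\<close>.\<close>

locale Jordan_chain =
  fixes A :: "'h::complex_hilbert \<Rightarrow> 'h" and e :: "nat \<Rightarrow> 'h" and K C :: real
  assumes A: "bounded_clinear A"
    and e0: "A (e 0) = 0" and eS: "A (e (Suc n)) = e n" and ne0: "e 0 \<noteq> 0"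
    and bound: "norm (e n) \<le> K * C ^ n" and C: "C > 0"
begin

definition eigen :: "complex \<Rightarrow> 'h" where "eigen z = (\<Sum>n. z ^ n *\<^sub>C e n)"

lemma K: "K > 0"
proof -
  have "norm (e 0) \<le> K" using bound[of 0] by simp
  then show ?thesis using ne0 zero_less_norm_iff[of "e 0"] by linarith
qed

lemma term_bound: "norm (z ^ n *\<^sub>C e n) \<le> K * (C * cmod z) ^ n"
  using mult_left_mono[OF bound[of n], of "cmod z ^ n"]
  by (simp add: norm_scaleC norm_power power_mult_distrib mult_ac)

lemma
  assumes z: "C * cmod z \<le> 1/2"
  shows summable_eigen: "summable (\<lambda>n. z ^ n *\<^sub>C e n)"
    and eigen_remainder: "norm (eigen z - (\<Sum>k<n. z ^ k *\<^sub>C e k)) \<le> 2 * K * (C * cmod z) ^ n"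
proof -
  let ?q = "C * cmod z"
  have q: "0 \<le> ?q" "?q < 1" using z C by auto
  have geo: "summable (\<lambda>n. K * ?q ^ n)" using q by (intro summable_mult summable_geometric) auto
  show s: "summable (\<lambda>n. z ^ n *\<^sub>C e n)"
    by (rule summable_comparison_test'[OF geo, of 0]) (rule term_bound)
  have "eigen z - (\<Sum>k<n. z ^ k *\<^sub>C e k) = (\<Sum>k. z ^ (k + n) *\<^sub>C e (k + n))"
    unfolding eigen_def using suminf_split_initial_segment[OF s, of n] by simp
  also have "norm \<dots> \<le> (\<Sum>k. K * ?q ^ (k + n))"
    using summable_ignore_initial_segment[OF geo, of n] by (intro norm_suminf_le term_bound)
  also have "\<dots> = K * ?q ^ n * (1 / (1 - ?q))"
    using suminf_mult[OF summable_geometric[of ?q], of "K * ?q ^ n"] suminf_geometric[of ?q] q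
    by (simp add: power_add mult_ac)
  also have "\<dots> \<le> K * ?q ^ n * 2"
  proof (rule mult_left_mono)
    show "1 / (1 - ?q) \<le> 2" using z by (simp add: field_simps)
  qed (use q K in simp)
  finally show "norm (eigen z - (\<Sum>k<n. z ^ k *\<^sub>C e k)) \<le> 2 * K * (C * cmod z) ^ n" by (simp add: mult_ac)
qed

lemma A_eigen:
  assumes z: "C * cmod z \<le> 1/2"
  shows "A (eigen z) = z *\<^sub>C eigen z"
proof -
  have s: "(\<lambda>n. z ^ n *\<^sub>C e n) sums eigen z"
    unfolding eigen_def by (rule summable_sums[OF summable_eigen[OF z]])
  have "(\<lambda>n. A (z ^ n *\<^sub>C e n)) sums A (eigen z)"
    by (rule bounded_linear.sums[OF _ s]) (use A in \<open>simp add: bounded_clinear_def\<close>)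
  then have "(\<lambda>n. A (z ^ Suc n *\<^sub>C e (Suc n))) sums A (eigen z)"
    unfolding sums_Suc_iff[of "\<lambda>n. A (z ^ n *\<^sub>C e n)"] by (simp add: e0)
  moreover have "A (z ^ Suc n *\<^sub>C e (Suc n)) = z *\<^sub>C (z ^ n *\<^sub>C e n)" for n
    by (simp add: bounded_clinearD(5)[OF A] eS scaleC_scaleC)
  ultimately have "(\<lambda>n. z *\<^sub>C (z ^ n *\<^sub>C e n)) sums A (eigen z)" by simp
  moreover have "(\<lambda>n. z *\<^sub>C (z ^ n *\<^sub>C e n)) sums (z *\<^sub>C eigen z)"
    by (rule bounded_linear.sums[OF bounded_bilinear.bounded_linear_right[OF bounded_bilinear_scaleC] s])
  ultimately show ?thesis by (rule sums_unique2)
qed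

lemma eigen_nonzero:
  obtains r where "r > 0" "\<And>z. cmod z \<le> r \<Longrightarrow> C * cmod z \<le> 1/2 \<and> eigen z \<noteq> 0"
proof -
  define r where "r = min (1 / (2 * C)) (norm (e 0) / (4 * K * C))"
  show thesis
  proof (rule that[of r])
    show "r > 0" using C K ne0 by (simp add: r_def)
    fix z assume z: "cmod z \<le> r"
    have z1: "C * cmod z \<le> 1/2" using z C by (simp add: r_def pos_le_divide_eq mult_ac)
    have "cmod z \<le> norm (e 0) / (4 * K * C)" using z by (simp add: r_def)
    then have "2 * K * (C * cmod z) \<le> 2 * K * (C * (norm (e 0) / (4 * K * C)))"
      using C K by (intro mult_left_mono) auto
    also have "\<dots> < norm (e 0)" using C K ne0 by simp
    finally have "norm (eigen z - e 0) < norm (e 0)"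
      using eigen_remainder[OF z1, of 1] by simp
    then show "C * cmod z \<le> 1/2 \<and> eigen z \<noteq> 0" using z1 by auto
  qed
qed

end

lemma funpow_eigenvector:
  assumes T: "T \<in> bounded_operators" and x: "blinfun_apply T x = \<mu> *\<^sub>C x"
  shows "(blinfun_apply T ^^ n) x = \<mu> ^ n *\<^sub>C x"
  using T x unfolding bounded_operators_def
  by (induction n) (auto simp: scaleC_one scaleC_scaleC mult.commute)

text \<open>For small real \<open>t\<close> the vector \<open>F t = eigen (t * l)\<close> is an eigenvector of
  \<open>T\<close> for the eigenvalue \<open>(1 - t) * l\<close>, whose modulus is below
  \<open>1\<close> for \<open>t > 0\<close> and above \<open>1\<close> for \<open>t < 0\<close>.
  The criterion applies to the span of the former vectors: its closure contains the Taylor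
  coefficients of \<open>F\<close> at \<open>0\<close>, and therefore also \<open>F t\<close> for
  \<open>t < 0\<close>.\<close>

theorem Jordan_chain_imp_DC:
  fixes T :: "'h::complex_hilbert \<Rightarrow>\<^sub>L 'h"
  assumes T: "T \<in> bounded_operators" and l: "cmod l = 1"
    and "Jordan_chain (shifted l T) e K C"
  shows "T \<in> DC"
proof -
  interpret Jordan_chain "shifted l T" e K C by fact
  obtain r0 where r0: "r0 > 0" "\<And>z. cmod z \<le> r0 \<Longrightarrow> C * cmod z \<le> 1/2 \<and> eigen z \<noteq> 0"
    using eigen_nonzero by blast
  define r where "r = min r0 (1/2)"
  have r: "r > 0" "r < 1" using r0 by (auto simp: r_def)
  define F where "F t = eigen (complex_of_real t * l)" for t
  define f where "f n = l ^ n *\<^sub>C e n" for n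
  have cm: "cmod (complex_of_real t * l) = \<bar>t\<bar>" for t using l by (simp add: norm_mult)
  have small: "C * cmod (complex_of_real t * l) \<le> 1/2" and nz: "F t \<noteq> 0" if "\<bar>t\<bar> \<le> r" for t
    using r0(2)[of "complex_of_real t * l"] that unfolding cm by (auto simp: r_def F_def)
  have tm: "(complex_of_real t * l) ^ k *\<^sub>C e k = t ^ k *\<^sub>R f k" for t k
    by (simp add: f_def scaleR_scaleC scaleC_scaleC power_mult_distrib)
  have rem: "norm (F t - (\<Sum>k<n. t ^ k *\<^sub>R f k)) \<le> 2 * K * (C * \<bar>t\<bar>) ^ n" if "\<bar>t\<bar> \<le> r" for t n
    using eigen_remainder[OF small[OF that], of n] unfolding tm cm F_def .
  have TF: "blinfun_apply T (F t) = (complex_of_real (1 - t) * l) *\<^sub>C F t" if "\<bar>t\<bar> \<le> r" for t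
  proof -
    have "shifted (l - complex_of_real t * l) T (F t) = 0"
      using A_eigen[OF small[OF that]] unfolding shifted_eigenvector_iff F_def .
    then show ?thesis by (simp add: shifted_def algebra_simps)
  qed
  have TnF: "norm ((blinfun_apply T ^^ n) (F t)) = \<bar>1 - t\<bar> ^ n * norm (F t)" if "\<bar>t\<bar> \<le> r" for t n
    unfolding funpow_eigenvector[OF T TF[OF that]] using l
    by (simp add: norm_scaleC norm_power norm_mult del: of_real_diff)
  let ?X = "span (F ` {0<..r})"
  have bl: "bounded_linear (blinfun_apply T)" by (rule blinfun.bounded_linear_right)
  have lin: "linear (blinfun_apply T ^^ n)" for n
    using funpow_linear bounded_linear.linear[OF bl] by blast
  have sX: "subspace (closure ?X)" by (rule closure_subspace[OF subspace_span])
  have FX: "F t \<in> closure ?X" if "0 < t" "t \<le> r" for t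
    using that span_base[of "F t" "F ` {0<..r}"] closure_subset[of ?X] by auto
  \<comment> \<open>The Taylor coefficients of \<open>F\<close> at \<open>0\<close> are limits of combinations of values of \<open>F\<close> at positive points.\<close>
  have fX: "f n \<in> closure ?X" for n
  proof (induction n rule: less_induct)
    case (less n)
    define t where "t j = r / Suc j" for j
    have t: "0 < t j" "t j \<le> r" for j using r by (auto simp: t_def field_simps)
    have t0: "t \<longlonglongrightarrow> 0"
      using tendsto_mult_right_zero[OF LIMSEQ_inverse_real_of_nat, of r] by (simp add: t_def[abs_def] divide_inverse)
    define g where "g j = (1 / t j ^ n) *\<^sub>R (F (t j) - (\<Sum>k<n. t j ^ k *\<^sub>R f k))" for j
    have gX: "g j \<in> closure ?X" for j
      unfolding g_def using FX[OF t] less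
      by (intro subspace_scale[OF sX] subspace_diff[OF sX] subspace_sum[OF sX]) auto
    have "norm (g j - f n) \<le> 2 * K * C ^ Suc n * t j" for j
    proof -
      have "g j - f n = (1 / t j ^ n) *\<^sub>R (F (t j) - (\<Sum>k<Suc n. t j ^ k *\<^sub>R f k))"
        using t(1)[of j] by (simp add: g_def scaleR_right_diff_distrib scaleR_right_distrib algebra_simps)
      also have "norm \<dots> \<le> (1 / t j ^ n) * (2 * K * (C * \<bar>t j\<bar>) ^ Suc n)"
        using rem[of "t j" "Suc n"] t[of j] by (simp only: norm_scaleR) (intro mult_mono, auto)
      also have "\<dots> = 2 * K * C ^ Suc n * t j" using t[of j] by (simp add: power_mult_distrib)
      finally show ?thesis .
    qed
    moreover have "(\<lambda>j. 2 * K * C ^ Suc n * t j) \<longlonglongrightarrow> 0" by (intro tendsto_mult_right_zero t0)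
    ultimately have "(\<lambda>j. g j - f n) \<longlonglongrightarrow> 0" by (rule Lim_null_comparison[OF always_eventually[OF allI]])
    then have "g \<longlonglongrightarrow> f n" using LIM_zero_iff by blast
    then show ?case by (rule closed_sequentially[OF closed_closure gX])
  qed
  have "\<exists>v. distributionally_irregular (blinfun_apply T) v"
  proof (rule distributional_chaos_criterion[OF bl subspace_span])
    show "(\<lambda>n. (blinfun_apply T ^^ n) x) \<longlonglongrightarrow> 0" if "x \<in> ?X" for x
      using that
    proof (induction rule: span_induct_alt)
      case base then show ?case by (simp add: linear_0[OF lin])
    next
      case (step c x y)
      then obtain t where t: "x = F t" "0 < t" "t \<le> r" by auto
      have "(\<lambda>n. \<bar>1 - t\<bar> ^ n * norm (F t)) \<longlonglongrightarrow> 0"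
        using t r by (intro tendsto_mult_left_zero LIMSEQ_power_zero) auto
      then have "(\<lambda>n. norm ((blinfun_apply T ^^ n) x)) \<longlonglongrightarrow> 0"
        using TnF[of t] t by simp
      then have "(\<lambda>n. (blinfun_apply T ^^ n) x) \<longlonglongrightarrow> 0" by (rule tendsto_norm_zero_cancel)
      then have "(\<lambda>n. c *\<^sub>R (blinfun_apply T ^^ n) x + (blinfun_apply T ^^ n) y) \<longlonglongrightarrow> c *\<^sub>R 0 + 0"
        using step by (intro tendsto_intros)
      then show ?case by (simp add: linear_add[OF lin] linear_scale[OF lin])
    qed
    show "F (- r) \<in> closure ?X"
    proof (rule closed_sequentially[OF closed_closure])
      show "(\<Sum>k<n. (- r) ^ k *\<^sub>R f k) \<in> closure ?X" for n
        using fX by (intro subspace_sum[OF sX] subspace_scale[OF sX]) auto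
      have "(\<lambda>n. F (- r) - (\<Sum>k<n. (- r) ^ k *\<^sub>R f k)) \<longlonglongrightarrow> 0"
      proof (rule Lim_null_comparison[OF always_eventually])
        show "\<forall>n. norm (F (- r) - (\<Sum>k<n. (- r) ^ k *\<^sub>R f k)) \<le> 2 * K * (C * \<bar>- r\<bar>) ^ n"
          using rem[of "- r"] r by auto
        have "C * \<bar>- r\<bar> < 1" using small[of r] r unfolding cm by auto
        then show "(\<lambda>n. 2 * K * (C * \<bar>- r\<bar>) ^ n) \<longlonglongrightarrow> 0"
          using C by (intro tendsto_mult_right_zero LIMSEQ_power_zero) (auto simp: abs_mult)
      qed
      then have "(\<lambda>n. F (- r) - (F (- r) - (\<Sum>k<n. (- r) ^ k *\<^sub>R f k))) \<longlonglongrightarrow> F (- r) - 0"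
        by (intro tendsto_diff tendsto_const)
      then show "(\<lambda>n. \<Sum>k<n. (- r) ^ k *\<^sub>R f k) \<longlonglongrightarrow> F (- r)" by simp
    qed
    have "filterlim (\<lambda>n. (1 + r) ^ n * norm (F (- r))) at_top sequentially"
    proof (rule filterlim_at_top_mult_tendsto_pos[OF tendsto_const])
      show "0 < norm (F (- r))" using nz[of "- r"] r by simp
      show "filterlim (\<lambda>n. (1 + r) ^ n) at_top sequentially"
        unfolding filterlim_at_top_dense
      proof
        fix B
        obtain N where "B < (1 + r) ^ N" using real_arch_pow[of "1 + r" B] r by auto
        then have "B < (1 + r) ^ n" if "n \<ge> N" for n
          using power_increasing[OF that, of "1 + r"] r by linarith
        then show "eventually (\<lambda>n. B < (1 + r) ^ n) sequentially" unfolding eventually_sequentially by blast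
      qed
    qed
    then show "filterlim (\<lambda>n. norm ((blinfun_apply T ^^ n) (F (- r)))) at_top sequentially"
      using TnF[of "- r"] r by simp
  qed
  then show ?thesis
    unfolding DC_def using T distributionally_irregular_imp_chaotic bounded_linear.linear[OF bl] by blast
qed

section \<open>The kernel inside the hyperrange\<close>

definition hyperrange :: "('a \<Rightarrow> 'a) \<Rightarrow> 'a set" where
  "hyperrange A = (\<Inter>n. range (A ^^ n))"

lemma range_funpow_Suc: "range (A ^^ Suc n) = A ` range (A ^^ n)"
  by (simp add: image_comp[symmetric] o_def image_image)

lemma range_funpow_antimono:
  fixes A :: "'a \<Rightarrow> 'a"
  shows "m \<le> n \<Longrightarrow> range (A ^^ n) \<subseteq> range (A ^^ m)"
proof
  fix x assume "m \<le> n" "x \<in> range (A ^^ n)"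
  then obtain y where "x = (A ^^ (m + (n - m))) y" by auto
  then have "x = (A ^^ m) ((A ^^ (n - m)) y)" by (simp only: funpow_add o_apply)
  then show "x \<in> range (A ^^ m)" by blast
qed

lemma funpow_image_closed_subspace:
  fixes A :: "'h::complex_hilbert \<Rightarrow> 'h"
  assumes A: "bounded_clinear A" "upper_semi_Fredholm A" and Y: "cvs.subspace Y" "closed Y"
  shows "cvs.subspace ((A ^^ n) ` Y) \<and> closed ((A ^^ n) ` Y)"
proof (induction n)
  case (Suc n)
  have "(A ^^ Suc n) ` Y = A ` ((A ^^ n) ` Y)" by (simp add: image_comp)
  then show ?case using Suc subspace_image[OF A(1)] upper_semi_Fredholm_closed_image[OF A] by simp
qed (use Y in simp)

lemma hyperrange_closed_subspace:
  fixes A :: "'h::complex_hilbert \<Rightarrow> 'h"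
  assumes A: "bounded_clinear A" "upper_semi_Fredholm A"
  shows "cvs.subspace (hyperrange A)" "closed (hyperrange A)"
  using funpow_image_closed_subspace[OF A, of UNIV] unfolding hyperrange_def
  by (auto intro!: cvs.subspace_Inter closed_INT)

text \<open>If the decreasing sequence of spaces \<open>op_kernel A \<inter> range (A ^^ n)\<close> did not
  become stationary, unit vectors orthogonal to a later member could be chosen from infinitely
  many of them. They would form an orthonormal sequence in the kernel, which has no convergent
  subsequence.\<close>

lemma kernel_range_stabilizes:
  fixes A :: "'h::complex_hilbert \<Rightarrow> 'h"
  assumes A: "bounded_clinear A" "upper_semi_Fredholm A"
  shows "\<exists>n. op_kernel A \<inter> range (A ^^ n) \<subseteq> hyperrange A"
proof (rule ccontr)
  assume neg: "\<not> ?thesis"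
  let ?W = "\<lambda>n. op_kernel A \<inter> range (A ^^ n)"
  have W: "cvs.subspace (?W n)" "closed (?W n)" for n
    using funpow_image_closed_subspace[OF A, of UNIV n] A
    by (auto intro!: cvs.subspace_inter closed_Int subspace_op_kernel closed_op_kernel)
  have "\<exists>m k. k \<in> ?W n \<and> norm k = 1 \<and> (\<forall>w\<in>?W m. cinner k w = 0)" for n
  proof -
    obtain x m where x: "x \<in> ?W n" "x \<notin> range (A ^^ m)"
      using neg unfolding hyperrange_def by blast
    obtain p where p: "p \<in> ?W m" "\<And>w. w \<in> ?W m \<Longrightarrow> cinner (x - p) w = 0"
      using orthogonal_projection_exists[OF W[of m], of x] by blast
    have "m > n" using x range_funpow_antimono[of m n A] by (meson IntD2 not_less subsetD)
    then have "p \<in> ?W n" using p(1) range_funpow_antimono[of n m A] by auto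
    then have xp: "x - p \<in> ?W n" using x(1) cvs.subspace_diff[OF W(1)] by blast
    have "x - p \<noteq> 0" using p(1) x by auto
    then show ?thesis
      using cvs.subspace_scale[OF W(1) xp, of "complex_of_real (1 / norm (x - p))"] p(2)
      by (intro exI[of _ m] exI[of _ "complex_of_real (1 / norm (x - p)) *\<^sub>C (x - p)"])
        (simp add: norm_scaleC norm_divide cinner_scaleC_left)
  qed
  then obtain m k where mk: "\<And>n. k n \<in> ?W n" "\<And>n. norm (k n) = 1" "\<And>n w. w \<in> ?W (m n) \<Longrightarrow> cinner (k n) w = 0"
    by metis
  have mono: "n \<le> m n" for n
  proof (rule ccontr)
    assume "\<not> n \<le> m n"
    then have "k n \<in> ?W (m n)" using mk(1)[of n] range_funpow_antimono[of "m n" n A] by auto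
    then have "cinner (k n) (k n) = 0" by (rule mk(3))
    then show False using mk(2)[of n] by simp
  qed
  define N where "N j = (m ^^ j) 0" for j
  have NS: "N (Suc j) = m (N j)" for j by (simp add: N_def)
  have Nmono: "N i \<le> N j" if "i \<le> j" for i j
    by (rule lift_Suc_mono_le[OF _ that]) (simp add: NS mono)
  have orth: "cinner (k (N i)) (k (N j)) = 0" if "i < j" for i j
  proof -
    have "N (Suc i) \<le> N j" using that by (intro Nmono) simp
    then have "k (N j) \<in> ?W (m (N i))" using mk(1)[of "N j"] range_funpow_antimono[of "N (Suc i)" "N j" A]
      unfolding NS by auto
    then show ?thesis by (rule mk(3))
  qed
  have Ak: "A (k (N j)) = 0" for j using mk(1)[of "N j"] by (simp add: op_kernel_def)
  have bd: "norm (k (N j)) \<le> 1" for j by (simp add: mk(2))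
  have "convergent (\<lambda>j. A (k (N j)))" unfolding Ak by (rule convergent_const)
  from upper_semi_Fredholm_subsequence[OF A bd this]
  obtain r y where r: "strict_mono (r::nat\<Rightarrow>nat)" "(\<lambda>j. k (N (r j))) \<longlonglongrightarrow> y" .
  obtain M where M: "\<And>i j. i \<ge> M \<Longrightarrow> j \<ge> M \<Longrightarrow> dist (k (N (r i))) (k (N (r j))) < 1"
    using metric_CauchyD[OF LIMSEQ_imp_Cauchy[OF r(2)], of 1] by auto
  have "cinner (k (N (r M))) (- k (N (r (Suc M)))) = 0"
    using orth[of "r M" "r (Suc M)"] strict_monoD[OF r(1), of M "Suc M"] by (simp add: cinner_minus_right)
  from norm_le_norm_add_orthogonal[OF this] have "1 \<le> norm (k (N (r M)) - k (N (r (Suc M))))" by (simp add: mk(2))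
  then show False using M[of M "Suc M"] by (simp add: dist_norm)
qed

text \<open>Any two preimages of \<open>y\<close> differ by a kernel vector. From the stage on at which the
  kernel part is stationary, this difference lies in the hyperrange, so a single preimage belongs
  to all ranges.\<close>

lemma image_hyperrange:
  fixes A :: "'h::complex_hilbert \<Rightarrow> 'h"
  assumes A: "bounded_clinear A" "upper_semi_Fredholm A"
  shows "A ` hyperrange A = hyperrange A"
proof
  show "A ` hyperrange A \<subseteq> hyperrange A"
  proof safe
    fix x assume x: "x \<in> hyperrange A"
    have "A x \<in> range (A ^^ n)" for n
    proof -
      have "x \<in> range (A ^^ n)" using x unfolding hyperrange_def by blast
      then have "A x \<in> range (A ^^ Suc n)" unfolding range_funpow_Suc by blast
      then show ?thesis using range_funpow_antimono[of n "Suc n" A] by auto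
    qed
    then show "A x \<in> hyperrange A" unfolding hyperrange_def by blast
  qed
  obtain n0 where n0: "op_kernel A \<inter> range (A ^^ n0) \<subseteq> hyperrange A"
    using kernel_range_stabilizes[OF A] by blast
  show "hyperrange A \<subseteq> A ` hyperrange A"
  proof
    fix y assume y: "y \<in> hyperrange A"
    have "\<exists>x\<in>range (A ^^ n). A x = y" for n
    proof -
      have "y \<in> range (A ^^ Suc n)" using y unfolding hyperrange_def by blast
      then show ?thesis unfolding range_funpow_Suc by blast
    qed
    then obtain x where x: "\<And>n. x n \<in> range (A ^^ n)" "\<And>n. A (x n) = y" by metis
    have sub: "cvs.subspace (range (A ^^ n))" for n
      using funpow_image_closed_subspace[OF A, of UNIV n] by simp
    have "x n0 \<in> range (A ^^ n)" for n
    proof (cases "n \<le> n0")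
      case True then show ?thesis using x(1)[of n0] range_funpow_antimono[of n n0 A] by blast
    next
      case False
      then have "x n \<in> range (A ^^ n0)" using x(1)[of n] range_funpow_antimono[of n0 n A] by auto
      then have "x n0 - x n \<in> range (A ^^ n0)" using x(1)[of n0] cvs.subspace_diff[OF sub] by blast
      moreover have "x n0 - x n \<in> op_kernel A" using x(2) by (simp add: op_kernel_def bounded_clinearD(2)[OF A(1)])
      ultimately have "x n0 - x n \<in> range (A ^^ n)" using n0 unfolding hyperrange_def by blast
      then have "(x n0 - x n) + x n \<in> range (A ^^ n)" using x(1)[of n] cvs.subspace_add[OF sub] by blast
      then show ?thesis by simp
    qed
    then have "x n0 \<in> hyperrange A" unfolding hyperrange_def by blast
    then show "y \<in> A ` hyperrange A" using x(2)[of n0] by blast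
  qed
qed

lemma eigenvector_in_hyperrange:
  assumes A: "bounded_clinear A" and x: "A x = \<mu> *\<^sub>C x" and mu: "\<mu> \<noteq> 0"
  shows "x \<in> hyperrange A"
proof -
  have p: "(A ^^ n) (a *\<^sub>C x) = (\<mu> ^ n * a) *\<^sub>C x" for n a
    by (induction n) (auto simp: bounded_clinearD(5)[OF A] x scaleC_scaleC mult_ac)
  have "x = (A ^^ n) (inverse \<mu> ^ n *\<^sub>C x)" for n
    unfolding p using mu by (simp add: power_mult_distrib[symmetric] scaleC_one)
  then show ?thesis unfolding hyperrange_def by blast
qed

text \<open>Since \<open>A\<close> maps its hyperrange onto itself with a linear bound on preimages, a kernel
  vector in it can be lifted again and again.\<close>

lemma Jordan_chain_exists:
  fixes A :: "'h::complex_hilbert \<Rightarrow> 'h"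
  assumes A: "bounded_clinear A" "upper_semi_Fredholm A" and Z: "op_kernel A \<inter> hyperrange A \<noteq> {0}"
  obtains e K C where "Jordan_chain A e K C"
proof -
  let ?M = "hyperrange A"
  note M = hyperrange_closed_subspace[OF A]
  obtain c where c: "c > 0" "\<And>y. y \<in> ?M \<Longrightarrow> \<exists>y'\<in>?M. A y' = A y \<and> c * norm y' \<le> norm (A y)"
    using upper_semi_Fredholm_lower_bound[OF A M] by blast
  have "\<exists>x\<in>?M. A x = y \<and> c * norm x \<le> norm y" if "y \<in> ?M" for y
    using that c(2) image_hyperrange[OF A] by (metis imageE)
  then obtain h where h: "\<And>y. y \<in> ?M \<Longrightarrow> h y \<in> ?M" "\<And>y. y \<in> ?M \<Longrightarrow> A (h y) = y"
    "\<And>y. y \<in> ?M \<Longrightarrow> c * norm (h y) \<le> norm y" by metis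
  obtain e0 where e0: "e0 \<in> ?M" "A e0 = 0" "e0 \<noteq> 0"
    using Z cvs.subspace_0[OF M(1)] bounded_clinearD(3)[OF A(1)] unfolding op_kernel_def by blast
  define e where "e n = (h ^^ n) e0" for n
  have eM: "e n \<in> ?M" for n by (induction n) (auto simp: e_def e0 h)
  have "norm (e n) \<le> norm e0 * (1 / c) ^ n" for n
  proof (induction n)
    case (Suc n)
    have "norm (e (Suc n)) \<le> norm (e n) * (1 / c)"
      using h(3)[OF eM[of n]] c(1) by (simp add: e_def field_simps)
    also have "\<dots> \<le> norm e0 * (1 / c) ^ n * (1 / c)" using Suc c(1) by (intro mult_right_mono) auto
    finally show ?case by (simp add: mult_ac)
  qed (simp add: e_def)
  then have "Jordan_chain A e (norm e0) (1 / c)"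
    using A(1) c(1) e0 h(2)[OF eM] by unfold_locales (auto simp: e_def)
  then show thesis by (rule that)
qed

text \<open>The next two lemmas are the dichotomy on which the connectedness argument rests: if the kernel
  meets the hyperrange, the eigenvalue persists in a full neighbourhood, otherwise it is isolated.\<close>

lemma nearby_eigenvectors:
  fixes T :: "'h::complex_hilbert \<Rightarrow>\<^sub>L 'h"
  assumes T: "T \<in> bounded_operators" and U: "upper_semi_Fredholm (shifted l T)"
    and Z: "op_kernel (shifted l T) \<inter> hyperrange (shifted l T) \<noteq> {0}"
  obtains r where "r > 0" "\<And>m. cmod (m - l) < r \<Longrightarrow> op_kernel (shifted m T) \<noteq> {0}"
proof -
  obtain e K C where J: "Jordan_chain (shifted l T) e K C"
    using Jordan_chain_exists[OF bounded_clinear_shifted[OF T] U Z] by blast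
  interpret Jordan_chain "shifted l T" e K C by fact
  obtain r where r: "r > 0" "\<And>z. cmod z \<le> r \<Longrightarrow> C * cmod z \<le> 1/2 \<and> eigen z \<noteq> 0"
    using eigen_nonzero by blast
  show thesis
  proof (rule that[OF r(1)])
    fix m assume "cmod (m - l) < r"
    then have z: "C * cmod (l - m) \<le> 1/2" "eigen (l - m) \<noteq> 0"
      using r(2)[of "l - m"] by (auto simp: norm_minus_commute)
    have "shifted (l - (l - m)) T (eigen (l - m)) = 0"
      using A_eigen[OF z(1)] unfolding shifted_eigenvector_iff .
    then show "op_kernel (shifted m T) \<noteq> {0}" using z(2) by (auto simp: op_kernel_def)
  qed
qed

text \<open>Eigenvectors for eigenvalues \<open>\<mu> \<noteq> 0\<close> of \<open>A\<close> lie in the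
  hyperrange of \<open>A\<close>; normalized and with \<open>\<mu>\<close> tending to
  \<open>0\<close> they have a limit point in the kernel and in the hyperrange.\<close>

lemma nearby_injective:
  fixes T :: "'h::complex_hilbert \<Rightarrow>\<^sub>L 'h"
  assumes T: "T \<in> bounded_operators" and U: "upper_semi_Fredholm (shifted l T)"
    and Z: "op_kernel (shifted l T) \<inter> hyperrange (shifted l T) = {0}"
  obtains r where "r > 0" "\<And>m. cmod (m - l) < r \<Longrightarrow> m \<noteq> l \<Longrightarrow> op_kernel (shifted m T) = {0}"
proof -
  let ?A = "shifted l T"
  note A = bounded_clinear_shifted[OF T, of l]
  have "\<exists>r>0. \<forall>m. cmod (m - l) < r \<longrightarrow> m \<noteq> l \<longrightarrow> op_kernel (shifted m T) = {0}"
  proof (rule ccontr)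
    assume neg: "\<not> ?thesis"
    have "\<exists>m x. cmod (m - l) < 1 / Suc n \<and> x \<in> hyperrange ?A \<and> norm x = 1 \<and> ?A x = (l - m) *\<^sub>C x" for n
    proof -
      have "(1::real) / Suc n > 0" by simp
      with neg have "\<not> (\<forall>m. cmod (m - l) < 1 / Suc n \<longrightarrow> m \<noteq> l \<longrightarrow> op_kernel (shifted m T) = {0})" by metis
      then obtain m where m: "cmod (m - l) < 1 / Suc n" "m \<noteq> l" "op_kernel (shifted m T) \<noteq> {0}"
        by auto
      have "0 \<in> op_kernel (shifted m T)" by (simp add: op_kernel_def shifted_def)
      then obtain x where x: "shifted m T x = 0" "x \<noteq> 0" using m(3) by (auto simp: op_kernel_def)
      let ?a = "complex_of_real (1 / norm x)"
      have "shifted m T (?a *\<^sub>C x) = 0" unfolding bounded_clinearD(5)[OF bounded_clinear_shifted[OF T]] x(1) by simp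
      then have "?A (?a *\<^sub>C x) = (l - m) *\<^sub>C (?a *\<^sub>C x)" unfolding shifted_eigenvector_iff by simp
      moreover have "norm (?a *\<^sub>C x) = 1" using x(2) by (simp add: norm_scaleC norm_divide)
      moreover have "?a *\<^sub>C x \<in> hyperrange ?A"
        by (rule eigenvector_in_hyperrange[OF A calculation(1)]) (use m(2) in simp)
      ultimately show ?thesis using m(1) by (intro exI[of _ m] exI[of _ "?a *\<^sub>C x"]) simp
    qed
    then obtain m x where mx: "\<And>n. cmod (m n - l) < 1 / Suc n" "\<And>n. x n \<in> hyperrange ?A"
      "\<And>n. norm (x n) = 1" "\<And>n. ?A (x n) = (l - m n) *\<^sub>C x n" by metis
    have Ax: "(\<lambda>n. ?A (x n)) \<longlonglongrightarrow> 0"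
    proof (rule Lim_null_comparison[OF always_eventually LIMSEQ_inverse_real_of_nat], intro allI)
      show "norm (?A (x n)) \<le> inverse (Suc n)" for n
        using mx(1)[of n] mx(3)[of n] unfolding mx(4) norm_scaleC by (simp add: norm_minus_commute inverse_eq_divide)
    qed
    have "norm (x n) \<le> 1" for n by (simp add: mx(3))
    then obtain r y where r: "strict_mono (r::nat\<Rightarrow>nat)" "(\<lambda>n. x (r n)) \<longlonglongrightarrow> y"
      using upper_semi_Fredholm_subsequence[OF A U _ convergentI[OF Ax]] by blast
    have "y \<in> hyperrange ?A"
      by (rule closed_sequentially[OF hyperrange_closed_subspace(2)[OF A U] _ r(2)]) (rule mx(2))
    moreover have "?A y = 0"
      by (rule LIMSEQ_unique[OF bounded_clinear_tendsto[OF A r(2)]])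
        (use LIMSEQ_subseq_LIMSEQ[OF Ax r(1)] in \<open>simp add: o_def\<close>)
    ultimately have "y = 0" using Z unfolding op_kernel_def by blast
    moreover have "norm y = 1"
      using LIMSEQ_unique[OF tendsto_norm[OF r(2)]] mx(3) by simp
    ultimately show False by simp
  qed
  then show thesis using that by blast
qed

section \<open>Perturbation to a distributionally chaotic operator\<close>

definition orthonormal_sequence :: "(nat \<Rightarrow> 'h::complex_inner) \<Rightarrow> bool" where
  "orthonormal_sequence e \<longleftrightarrow> (\<forall>m n. cinner (e m) (e n) = (if m = n then 1 else 0))"

lemma norm_orthonormal_sum:
  assumes e: "orthonormal_sequence e" and "finite F"
  shows "(norm (\<Sum>n\<in>F. c n *\<^sub>C e n))\<^sup>2 = (\<Sum>n\<in>F. (cmod (c n))\<^sup>2)"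
  using \<open>finite F\<close>
proof (induction F)
  case (insert m F)
  have n1: "norm (e m) = 1" using e cmod_cinner_self[of "e m"] unfolding orthonormal_sequence_def
    by (simp add: power2_eq_1_iff) (smt (verit) norm_ge_zero)
  have "cinner (e m) (e n) = 0" if "n \<in> F" for n
    using that insert(2) e unfolding orthonormal_sequence_def by auto
  then have "cinner (c m *\<^sub>C e m) (\<Sum>n\<in>F. c n *\<^sub>C e n) = 0"
    by (simp add: cinner_sum_right cinner_scaleC_left cinner_scaleC_right)
  from pythagoras[OF this] show ?case using insert n1 by (simp add: norm_scaleC)
qed auto

lemma Bessel_inequality:
  assumes e: "orthonormal_sequence e"
  shows "(\<Sum>n<N. (cmod (cinner x (e n)))\<^sup>2) \<le> (norm x)\<^sup>2"
proof -
  let ?p = "\<Sum>n<N. cinner x (e n) *\<^sub>C e n"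
  have "cinner (x - ?p) (e m) = 0" if "m < N" for m
  proof -
    have "cinner ?p (e m) = (\<Sum>n<N. if n = m then cinner x (e m) else 0)"
      unfolding cinner_sum_left cinner_scaleC_left using e unfolding orthonormal_sequence_def
      by (intro sum.cong) auto
    then show ?thesis using that by (simp add: cinner_diff_left)
  qed
  then have "cinner (x - ?p) ?p = 0" by (simp add: cinner_sum_right cinner_scaleC_right)
  then have "cinner ?p (x - ?p) = 0" using cinner_eq_0_commute by blast
  from norm_le_norm_add_orthogonal[OF this] have "norm ?p \<le> norm x" by simp
  then have "(norm ?p)\<^sup>2 \<le> (norm x)\<^sup>2" by (intro power_mono) auto
  then show ?thesis using norm_orthonormal_sum[OF e, of "{..<N}"] by simp
qed

lemma orthonormal_series:
  fixes e :: "nat \<Rightarrow> 'h::complex_hilbert"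
  assumes e: "orthonormal_sequence e" and c: "\<And>N. (\<Sum>n<N. (cmod (c n))\<^sup>2) \<le> M\<^sup>2" and M: "0 \<le> M"
  shows "summable (\<lambda>n. c n *\<^sub>C e n)" and "norm (\<Sum>n. c n *\<^sub>C e n) \<le> M"
proof -
  have sc: "summable (\<lambda>n. (cmod (c n))\<^sup>2)" by (rule summableI_nonneg_bounded) (use c in auto)
  show s: "summable (\<lambda>n. c n *\<^sub>C e n)"
    unfolding summable_Cauchy
  proof (intro allI impI)
    fix d :: real assume d: "d > 0"
    then have "0 < d\<^sup>2" by simp
    then have "\<exists>N. \<forall>m\<ge>N. \<forall>n. norm (\<Sum>k=m..<n. (cmod (c k))\<^sup>2) < d\<^sup>2"
      using sc[unfolded summable_Cauchy] by blast
    then obtain N where N: "\<And>m n. m \<ge> N \<Longrightarrow> norm (\<Sum>k=m..<n. (cmod (c k))\<^sup>2) < d\<^sup>2" by blast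
    have "norm (\<Sum>k=m..<n. c k *\<^sub>C e k) < d" if "m \<ge> N" for m n
    proof (rule power2_less_imp_less)
      show "(norm (\<Sum>k=m..<n. c k *\<^sub>C e k))\<^sup>2 < d\<^sup>2"
        using N[OF that, of n] norm_orthonormal_sum[OF e, of "{m..<n}" c] by (simp add: sum_nonneg)
    qed (use d in simp)
    then show "\<exists>N. \<forall>m\<ge>N. \<forall>n. norm (\<Sum>k=m..<n. c k *\<^sub>C e k) < d" by blast
  qed
  have "norm (\<Sum>n<N. c n *\<^sub>C e n) \<le> M" for N
  proof (rule power2_le_imp_le[OF _ M])
    show "(norm (\<Sum>n<N. c n *\<^sub>C e n))\<^sup>2 \<le> M\<^sup>2"
      using c[of N] norm_orthonormal_sum[OF e, of "{..<N}" c] by simp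
  qed
  then show "norm (\<Sum>n. c n *\<^sub>C e n) \<le> M"
    by (intro LIMSEQ_le_const2[OF tendsto_norm[OF summable_LIMSEQ[OF s]]]) blast
qed

text \<open>Failure of the lower bound off every finite orthonormal set lets the sequence be chosen greedily,
  each vector orthogonal to the previous ones.\<close>

lemma almost_kernel_orthonormal_sequence:
  fixes A :: "'h::complex_hilbert \<Rightarrow> 'h"
  assumes A: "bounded_clinear A" and nU: "\<not> upper_semi_Fredholm A" and d: "\<And>n. d n > 0"
  obtains e where "orthonormal_sequence e" "\<And>n. norm (A (e n)) \<le> d n"
proof -
  have "\<exists>x. norm x = 1 \<and> (\<forall>b\<in>B. cinner x b = 0) \<and> norm (A x) \<le> c" if B: "finite B" "orthonormal B" "c > 0" for B c
  proof -
    obtain x where x: "\<forall>b\<in>B. cinner x b = 0" "norm (A x) < c * norm x"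
      using nU B unfolding upper_semi_Fredholm_def by (meson not_le)
    then have "x \<noteq> 0" using bounded_clinearD(3)[OF A] by auto
    then show ?thesis using x
      by (intro exI[of _ "complex_of_real (1 / norm x) *\<^sub>C x"])
        (simp add: norm_scaleC norm_divide cinner_scaleC_left bounded_clinearD(5)[OF A] divide_le_eq mult.commute)
  qed
  then obtain h where h: "\<And>B c. finite B \<Longrightarrow> orthonormal B \<Longrightarrow> c > 0 \<Longrightarrow>
      norm (h B c) = 1 \<and> (\<forall>b\<in>B. cinner (h B c) b = 0) \<and> norm (A (h B c)) \<le> c" by metis
  define B where "B = rec_nat {} (\<lambda>n B. insert (h B (d n)) B)"
  have BS: "B 0 = {}" "B (Suc n) = insert (h (B n) (d n)) (B n)" for n by (simp_all add: B_def)
  have BO: "finite (B n) \<and> orthonormal (B n)" for n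
  proof (induction n)
    case 0 show ?case by (simp add: BS orthonormal_def)
  next
    case (Suc n) then show ?case unfolding BS using h[of "B n" "d n"] d by (auto intro!: orthonormal_insert)
  qed
  define e where "e n = h (B n) (d n)" for n
  have e: "norm (e n) = 1" "\<And>b. b \<in> B n \<Longrightarrow> cinner (e n) b = 0" "norm (A (e n)) \<le> d n" for n
    using h[of "B n" "d n"] BO[of n] d[of n] unfolding e_def by blast+
  have mem: "e m \<in> B n" if "m < n" for m n
    using that by (induction n) (auto simp: BS e_def less_Suc_eq)
  have "cinner (e m) (e n) = (if m = n then 1 else 0)" for m n
  proof (cases m n rule: linorder_cases)
    case less
    then show ?thesis using e(2)[OF mem[OF less]] cinner_eq_0_commute[of "e m" "e n"] by simp
  next
    case equal then show ?thesis by (simp add: cinner_self e(1))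
  next
    case greater
    then show ?thesis using e(2)[OF mem[OF greater]] by simp
  qed
  then show thesis using that e(3) unfolding orthonormal_sequence_def by blast
qed

text \<open>On an orthonormal sequence along which \<open>shifted l T\<close> is summably small, a small
  perturbation replaces it by \<open>s\<close> times a backward shift; the vectors \<open>e
  n\<close>, rescaled by \<open>(1 / s) ^ n\<close>, then form a Jordan chain.\<close>

lemma DC_near_not_upper_semi_Fredholm:
  fixes T :: "'h::complex_hilbert \<Rightarrow>\<^sub>L 'h"
  assumes T: "T \<in> bounded_operators" and l: "cmod l = 1"
    and nU: "\<not> upper_semi_Fredholm (shifted l T)" and eps: "\<epsilon> > 0"
  shows "\<exists>S\<in>DC. norm (S - T) \<le> \<epsilon>"
proof -
  let ?A = "shifted l T"
  note A = bounded_clinear_shifted[OF T, of l]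
  define s where "s = \<epsilon> / 2"
  have s: "s > 0" using eps by (simp add: s_def)
  define d where "d n = s / 2 * (1/2) ^ n" for n
  have dpos: "d n > 0" for n using s by (simp add: d_def)
  have dsum: "d sums s" unfolding d_def[abs_def] using sums_mult[OF geometric_sums[of "1/2::real"], of "s/2"] by simp
  from almost_kernel_orthonormal_sequence[OF A nU, of d, OF dpos]
  obtain e where e: "orthonormal_sequence e" and Ae: "\<And>n. norm (?A (e n)) \<le> d n" by blast
  have ee: "cinner (e m) (e n) = (if m = n then 1 else 0)" for m n
    using e unfolding orthonormal_sequence_def by blast
  have ne: "norm (e n) = 1" for n
    using norm_orthonormal_sum[OF e, of "{n}" "\<lambda>_. 1"] by (simp add: power2_eq_1_iff) (smt (verit) norm_ge_zero)
  have e_tail: "(\<Sum>n<N. (cmod (cinner x (e (Suc n))))\<^sup>2) \<le> (norm x)\<^sup>2" for x N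
  proof -
    have "(\<Sum>n<N. (cmod (cinner x (e (Suc n))))\<^sup>2) \<le> (\<Sum>n<Suc N. (cmod (cinner x (e n)))\<^sup>2)"
      unfolding sum.lessThan_Suc_shift by simp
    also have "\<dots> \<le> (norm x)\<^sup>2" by (rule Bessel_inequality[OF e])
    finally show ?thesis .
  qed
  \<comment> \<open>Adding \<open>K1\<close> to \<open>T\<close> makes the \<open>e n\<close> eigenvectors for \<open>l\<close>; \<open>K2\<close> is the backward shift along them.\<close>
  define K1 where "K1 x = (\<Sum>n. cinner x (e n) *\<^sub>C ?A (e n))" for x
  define K2 where "K2 x = (\<Sum>n. cinner x (e (Suc n)) *\<^sub>C e n)" for x
  have b1: "norm (cinner x (e n) *\<^sub>C ?A (e n)) \<le> norm x * d n" for x n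
    unfolding norm_scaleC using cinner_Cauchy_Schwarz[of x "e n"] Ae[of n] ne[of n]
    by (intro mult_mono) auto
  have s1: "summable (\<lambda>n. cinner x (e n) *\<^sub>C ?A (e n))" for x
    by (rule summable_comparison_test'[OF summable_mult[OF sums_summable[OF dsum], of "norm x"], of 0]) (rule b1)
  have n1: "norm (K1 x) \<le> norm x * s" for x
  proof -
    have "norm (K1 x) \<le> (\<Sum>n. norm x * d n)" unfolding K1_def
      by (rule norm_suminf_le[OF b1 summable_mult[OF sums_summable[OF dsum]]])
    then show ?thesis using suminf_mult[OF sums_summable[OF dsum], of "norm x"] sums_unique[OF dsum] by simp
  qed
  note s2 = orthonormal_series(1)[OF e e_tail norm_ge_zero] and n2 = orthonormal_series(2)[OF e e_tail norm_ge_zero, folded K2_def]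
  define K where "K x = K1 x - s *\<^sub>R K2 x" for x
  have suminf_C: "(\<Sum>n. a *\<^sub>C f n) = a *\<^sub>C suminf f" if "summable f" for a and f :: "nat \<Rightarrow> 'h"
    by (rule bounded_linear.suminf[OF bounded_bilinear.bounded_linear_right[OF bounded_bilinear_scaleC] that, symmetric])
  have addK: "K (x + y) = K x + K y" for x y
  proof -
    have "K1 (x + y) = K1 x + K1 y"
      unfolding K1_def using suminf_add[OF s1[of x] s1[of y]] by (simp add: cinner_add_left scaleC_add_left)
    moreover have "K2 (x + y) = K2 x + K2 y"
      unfolding K2_def using suminf_add[OF s2[of x] s2[of y]] by (simp add: cinner_add_left scaleC_add_left)
    ultimately show ?thesis by (simp add: K_def scaleR_right_distrib)
  qed
  have scK: "K (a *\<^sub>C x) = a *\<^sub>C K x" for a x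
  proof -
    have "K1 (a *\<^sub>C x) = a *\<^sub>C K1 x"
      unfolding K1_def suminf_C[OF s1, symmetric] by (simp add: cinner_scaleC_left scaleC_scaleC)
    moreover have "K2 (a *\<^sub>C x) = a *\<^sub>C K2 x"
      unfolding K2_def suminf_C[OF s2, symmetric] by (simp add: cinner_scaleC_left scaleC_scaleC)
    ultimately show ?thesis by (simp add: K_def cvs.scale_right_diff_distrib scaleR_scaleC scaleC_scaleC mult.commute)
  qed
  have nK: "norm (K x) \<le> norm x * \<epsilon>" for x
  proof -
    have "norm (K x) \<le> norm (K1 x) + norm (s *\<^sub>R K2 x)" unfolding K_def by (rule norm_triangle_ineq4)
    also have "\<dots> \<le> norm x * s + s * norm x"
      using n1[of x] n2[of x] s by (intro add_mono) auto
    finally show ?thesis by (simp add: s_def mult.commute)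
  qed
  have bl: "bounded_linear K"
    by (rule bounded_linear_intro[OF addK _ nK]) (simp add: scaleR_scaleC scK)
  define S where "S = T + Blinfun K"
  have Sx: "blinfun_apply S x = blinfun_apply T x + K x" for x
    by (simp add: S_def blinfun.add_left bounded_linear_Blinfun_apply[OF bl])
  have SB: "S \<in> bounded_operators"
    using T unfolding bounded_operators_def by (simp add: Sx scK scaleC_add_right)
  have "norm (S - T) \<le> \<epsilon>"
    by (rule norm_blinfun_bound) (use eps nK in \<open>auto simp: S_def bounded_linear_Blinfun_apply[OF bl] mult.commute\<close>)
  moreover have "Jordan_chain (shifted l S) (\<lambda>n. complex_of_real (1 / s) ^ n *\<^sub>C e n) 1 (1 / s)"
  proof
    show bS: "bounded_clinear (shifted l S)" by (rule bounded_clinear_shifted[OF SB])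
    have sh: "shifted l S x = ?A x - K x" for x by (simp add: shifted_def Sx)
    have K1e: "K1 (e m) = ?A (e m)" for m
    proof -
      have "(\<lambda>n. cinner (e m) (e n) *\<^sub>C ?A (e n)) = (\<lambda>n. if n = m then ?A (e m) else 0)"
        by (auto simp: ee)
      then show ?thesis unfolding K1_def using sums_single[of m "\<lambda>_. ?A (e m)"] sums_unique by fastforce
    qed
    have "K2 (e 0) = 0" unfolding K2_def by (simp add: ee)
    then show "shifted l S (complex_of_real (1 / s) ^ 0 *\<^sub>C e 0) = 0" by (simp add: sh K_def K1e)
    have K2e: "K2 (e (Suc m)) = e m" for m
    proof -
      have "(\<lambda>n. cinner (e (Suc m)) (e (Suc n)) *\<^sub>C e n) = (\<lambda>n. if n = m then e m else 0)"
        by (auto simp: ee)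
      then show ?thesis unfolding K2_def using sums_single[of m "\<lambda>_. e m"] sums_unique by fastforce
    qed
    show "shifted l S (complex_of_real (1 / s) ^ Suc n *\<^sub>C e (Suc n)) = complex_of_real (1 / s) ^ n *\<^sub>C e n" for n
    proof -
      have "shifted l S (e (Suc n)) = complex_of_real s *\<^sub>C e n"
        by (simp add: sh K_def K1e K2e scaleR_scaleC)
      then show ?thesis using s unfolding bounded_clinearD(5)[OF bS] by (simp add: scaleC_scaleC)
    qed
    show "complex_of_real (1 / s) ^ 0 *\<^sub>C e 0 \<noteq> 0" using ne[of 0] by auto
    show "norm (complex_of_real (1 / s) ^ n *\<^sub>C e n) \<le> 1 * (1 / s) ^ n" for n
      using s by (simp add: norm_scaleC ne norm_power norm_divide)
    show "1 / s > 0" using s by simp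
  qed
  then have "S \<in> DC" by (rule Jordan_chain_imp_DC[OF SB l])
  ultimately show ?thesis by blast
qed

section \<open>Kernels along the unit circle\<close>

lemma cdim_pos_iff:
  fixes S :: "'a::complex_vector set"
  assumes S: "cvs.subspace S" shows "cdim S > 0 \<longleftrightarrow> S \<noteq> {0}"
proof
  assume "cdim S > 0"
  moreover have "cdim {0::'a} = 0"
  proof -
    have dim: "cvs.dim {0::'a} = 0" using cvs.dim_unique[of "{}" "{0}" 0] by (simp add: cvs.dependent_def)
    have ex: "\<exists>B. finite B \<and> {0::'a} \<subseteq> cvs.span B" by (intro exI[of _ "{}"]) auto
    show ?thesis unfolding cdim_def if_P[OF ex] dim by (simp add: zero_enat_def)
  qed
  ultimately show "S \<noteq> {0}" by auto
next
  assume ne: "S \<noteq> {0}"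
  show "cdim S > 0"
  proof (rule ccontr)
    assume "\<not> ?thesis"
    then have 0: "cdim S = 0" by simp
    then obtain F where F: "finite F" "S \<subseteq> cvs.span F" unfolding cdim_def by (auto split: if_splits)
    then have d: "cvs.dim S = 0" using 0 unfolding cdim_def by (auto simp: zero_enat_def split: if_splits)
    obtain B where B: "B \<subseteq> S" "cvs.independent B" "S \<subseteq> cvs.span B" "card B = cvs.dim S"
      using cvs.basis_exists by blast
    have "finite B" using cvs.independent_span_bound[OF F(1) B(2)] B(1) F(2) by blast
    then have "B = {}" using B(4) d by simp
    then show False using B(3) ne cvs.subspace_0[OF S] by auto
  qed
qed

lemma semi_Fredholm_cases:
  assumes A: "bounded_clinear A" and "semi_Fredholm A"
  shows "upper_semi_Fredholm A \<or> closed (range A) \<and> \<not> finitely_spanned (op_kernel A) \<and>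
    finitely_spanned (op_kernel (hilbert_adjoint A))"
  using assms unfolding upper_semi_Fredholm_iff[OF A] semi_Fredholm_def cdim_finite_iff by blast

lemma upper_semi_Fredholm_imp_semi_Fredholm:
  "bounded_clinear A \<Longrightarrow> upper_semi_Fredholm A \<Longrightarrow> semi_Fredholm A"
  unfolding upper_semi_Fredholm_iff semi_Fredholm_def cdim_finite_iff by blast

lemma zero_in_op_kernel: "0 \<in> op_kernel (shifted l T)"
  by (simp add: op_kernel_def shifted_def)

lemma upper_semi_Fredholm_shifted_open:
  fixes T :: "'h::complex_hilbert \<Rightarrow>\<^sub>L 'h"
  assumes "upper_semi_Fredholm (shifted l T)"
  obtains r where "r > 0" "\<And>m S. cmod (l - m) + norm (T - S) < r \<Longrightarrow> upper_semi_Fredholm (shifted m S)"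
proof -
  obtain r where r: "r > 0" "\<And>D. (\<And>x. norm (D x - shifted l T x) \<le> r * norm x) \<Longrightarrow> upper_semi_Fredholm D"
    using upper_semi_Fredholm_open[OF assms] by blast
  show thesis
  proof (rule that[OF r(1)], rule r(2))
    fix m and S :: "'h \<Rightarrow>\<^sub>L 'h" and x :: 'h
    assume "cmod (l - m) + norm (T - S) < r"
    then have "(cmod (m - l) + norm (S - T)) * norm x \<le> r * norm x"
      by (intro mult_right_mono) (auto simp: norm_minus_commute)
    then show "norm (shifted m S x - shifted l T x) \<le> r * norm x"
      using norm_shifted_diff_le[of m S x l T] by linarith
  qed
qed

text \<open>Let \<open>P\<close> be the set of points of the circle with both properties. It is open, and
  nearby points are points of injectivity. Off \<open>P\<close> there is no injectivity in a whole
  neighbourhood, either by \<open>nearby_eigenvectors\<close> or, where the kernel is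
  infinite-dimensional, by \<open>nearby_kernel_nontrivial\<close>; such a neighbourhood cannot
  meet \<open>P\<close>. So \<open>P\<close> is open and closed, and it contains
  \<open>l0\<close>.\<close>

theorem circle_regular:
  fixes T :: "'h::complex_hilbert \<Rightarrow>\<^sub>L 'h"
  assumes T: "T \<in> bounded_operators"
    and sF: "\<And>l. l \<in> sphere 0 1 \<Longrightarrow> semi_Fredholm (shifted l T)"
    and l0: "l0 \<in> sphere 0 1" "op_kernel (shifted l0 T) = {0}"
  assumes l: "l \<in> sphere 0 1"
  shows "upper_semi_Fredholm (shifted l T)"
    and "op_kernel (shifted l T) \<inter> hyperrange (shifted l T) = {0}"
proof -
  note A = bounded_clinear_shifted[OF T]
  define P where "P = {l \<in> sphere 0 1. upper_semi_Fredholm (shifted l T) \<and>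
    op_kernel (shifted l T) \<inter> hyperrange (shifted l T) = {0}}"
  have injP: "\<exists>r>0. \<forall>m. cmod (m - l) < r \<longrightarrow> m \<noteq> l \<longrightarrow> op_kernel (shifted m T) = {0}" if "l \<in> P" for l
  proof -
    have U: "upper_semi_Fredholm (shifted l T)"
      and Z: "op_kernel (shifted l T) \<inter> hyperrange (shifted l T) = {0}" using that by (auto simp: P_def)
    from nearby_injective[OF T U Z] show ?thesis by metis
  qed
  have noninj: "\<exists>r>0. \<forall>m. cmod (m - l) < r \<longrightarrow> op_kernel (shifted m T) \<noteq> {0}" if l: "l \<in> sphere 0 1 - P" for l
  proof (cases "upper_semi_Fredholm (shifted l T)")
    case True
    then have "op_kernel (shifted l T) \<inter> hyperrange (shifted l T) \<noteq> {0}" using l by (simp add: P_def)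
    then show ?thesis using nearby_eigenvectors[OF T True] by metis
  next
    case False
    then have *: "closed (range (shifted l T))" "\<not> finitely_spanned (op_kernel (shifted l T))"
      "finitely_spanned (op_kernel (hilbert_adjoint (shifted l T)))"
      using semi_Fredholm_cases[OF A sF] l by blast+
    obtain r where r: "r > 0" "\<And>D. bounded_clinear D \<Longrightarrow> (\<And>x. norm (D x - shifted l T x) \<le> r * norm x) \<Longrightarrow> op_kernel D \<noteq> {0}"
      using nearby_kernel_nontrivial[OF A *] by metis
    have "op_kernel (shifted m T) \<noteq> {0}" if "cmod (m - l) < r" for m
    proof (rule r(2)[OF A])
      fix x :: 'h
      have "(cmod (m - l) + norm (T - T)) * norm x \<le> r * norm x" using that by (intro mult_right_mono) auto
      then show "norm (shifted m T x - shifted l T x) \<le> r * norm x"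
        using norm_shifted_diff_le[of m T x l T] by linarith
    qed
    then show ?thesis using r(1) by blast
  qed
  have opP: "openin (top_of_set (sphere 0 1)) P"
    unfolding openin_contains_ball
  proof (intro conjI ballI)
    fix l assume lP: "l \<in> P"
    obtain r1 where r1: "r1 > 0" "\<And>m S. cmod (l - m) + norm (T - S) < r1 \<Longrightarrow> upper_semi_Fredholm (shifted m S)"
      using upper_semi_Fredholm_shifted_open lP unfolding P_def by blast
    obtain r2 where r2: "r2 > 0" "\<And>m. cmod (m - l) < r2 \<Longrightarrow> m \<noteq> l \<Longrightarrow> op_kernel (shifted m T) = {0}"
      using injP[OF lP] by blast
    have "m \<in> P" if m: "m \<in> ball l (min r1 r2) \<inter> sphere 0 1" for m
    proof (cases "m = l")
      case False
      then have "op_kernel (shifted m T) = {0}" using r2(2)[of m] m by (auto simp: dist_norm norm_minus_commute)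
      moreover have U: "upper_semi_Fredholm (shifted m T)" using r1(2)[of m T] m by (auto simp: dist_norm)
      moreover have "0 \<in> hyperrange (shifted m T)"
        using hyperrange_closed_subspace(1)[OF A U] by (rule cvs.subspace_0)
      ultimately show ?thesis using m unfolding P_def by auto
    qed (use lP in simp)
    then show "\<exists>e>0. ball l e \<inter> sphere 0 1 \<subseteq> P" using r1(1) r2(1) by (intro exI[of _ "min r1 r2"]) auto
  next
    show "P \<subseteq> sphere 0 1" unfolding P_def by blast
  qed
  have "openin (top_of_set (sphere 0 1)) (sphere 0 1 - P)"
    unfolding openin_contains_ball
  proof (intro conjI ballI)
    fix l assume lP: "l \<in> sphere 0 1 - P"
    obtain r where r: "r > 0" "\<And>m. cmod (m - l) < r \<Longrightarrow> op_kernel (shifted m T) \<noteq> {0}"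
      using noninj[OF lP] by blast
    have "m \<notin> P" if m: "cmod (m - l) < r" for m
    proof
      assume "m \<in> P"
      then obtain r' where r': "r' > 0" "\<And>n. cmod (n - m) < r' \<Longrightarrow> n \<noteq> m \<Longrightarrow> op_kernel (shifted n T) = {0}"
        using injP[OF \<open>m \<in> P\<close>] by auto
      define t where "t = min r' (r - cmod (m - l)) / 2"
      have t: "t > 0" "t < r'" "t < r - cmod (m - l)" using r'(1) m by (auto simp: t_def)
      let ?n = "m + complex_of_real t"
      have "cmod (?n - l) < r" using norm_triangle_ineq[of "m - l" "complex_of_real t"] t
        by (simp add: algebra_simps)
      moreover have "cmod (?n - m) < r'" "?n \<noteq> m" using t by auto
      ultimately show False using r(2)[of ?n] r'(2)[of ?n] by simp
    qed
    then have "ball l r \<inter> sphere 0 1 \<subseteq> sphere 0 1 - P" by (auto simp: dist_norm norm_minus_commute)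
    then show "\<exists>e>0. ball l e \<inter> sphere 0 1 \<subseteq> sphere 0 1 - P" using r(1) by blast
  qed blast
  moreover have "P \<subseteq> sphere 0 1" unfolding P_def by blast
  ultimately have clP: "closedin (top_of_set (sphere 0 1)) P"
    unfolding closedin_def topspace_euclidean_subtopology by (intro conjI)
  have "l0 \<in> P"
  proof -
    have "\<not> \<not> finitely_spanned (op_kernel (shifted l0 T))"
      unfolding l0(2) finitely_spanned_def by (auto intro!: exI[of _ "{}"])
    then have U: "upper_semi_Fredholm (shifted l0 T)" using semi_Fredholm_cases[OF A sF[OF l0(1)]] by blast
    then have "0 \<in> hyperrange (shifted l0 T)"
      using hyperrange_closed_subspace(1)[OF A U] cvs.subspace_0 by blast
    then show ?thesis using U l0 unfolding P_def by auto
  qed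
  moreover have "connected (sphere (0::complex) 1)" by (rule connected_sphere) simp
  ultimately have "P = sphere 0 1" using opP clP unfolding connected_clopen by (metis empty_iff)
  then have "l \<in> P" using l by simp
  then show "upper_semi_Fredholm (shifted l T)"
    and "op_kernel (shifted l T) \<inter> hyperrange (shifted l T) = {0}" unfolding P_def by blast+
qed

text \<open>Compactness of the circle makes the stability of the upper semi-Fredholm property uniform;
  injectivity at the single point \<open>l0\<close> is stable because \<open>shifted l0 T\<close>
  is bounded below.\<close>

lemma circle_regular_open:
  fixes T :: "'h::complex_hilbert \<Rightarrow>\<^sub>L 'h"
  assumes T: "T \<in> bounded_operators"
    and U: "\<And>l. l \<in> sphere 0 1 \<Longrightarrow> upper_semi_Fredholm (shifted l T)"
    and l0: "l0 \<in> sphere 0 1" "op_kernel (shifted l0 T) = {0}"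
  obtains d where "d > 0" "\<And>S l. norm (S - T) < d \<Longrightarrow> l \<in> sphere 0 1 \<Longrightarrow> upper_semi_Fredholm (shifted l S)"
    "\<And>S. norm (S - T) < d \<Longrightarrow> op_kernel (shifted l0 S) = {0}"
proof -
  note A = bounded_clinear_shifted[OF T]
  have "\<exists>d>0. \<forall>S l. norm (S - T) < d \<longrightarrow> l \<in> sphere 0 1 \<longrightarrow> upper_semi_Fredholm (shifted l S)"
  proof (rule ccontr)
    assume neg: "\<not> ?thesis"
    have "\<exists>S l. norm (S - T) < inverse (Suc n) \<and> l \<in> sphere 0 1 \<and> \<not> upper_semi_Fredholm (shifted l S)" for n
      using neg by (metis inverse_positive_iff_positive of_nat_0_less_iff zero_less_Suc)
    then obtain S l where Sl: "\<And>n. norm (S n - T) < inverse (Suc n)" "\<And>n. l n \<in> sphere 0 1"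
      "\<And>n. \<not> upper_semi_Fredholm (shifted (l n) (S n))" by metis
    have "seq_compact (sphere (0::complex) 1)" by (intro compact_imp_seq_compact compact_sphere)
    from seq_compactE[OF this, of l] Sl(2)
    obtain m r where m: "m \<in> sphere 0 1" "strict_mono (r::nat\<Rightarrow>nat)" "(l \<circ> r) \<longlonglongrightarrow> m" by blast
    obtain \<rho> where \<rho>: "\<rho> > 0" "\<And>k S. cmod (m - k) + norm (T - S) < \<rho> \<Longrightarrow> upper_semi_Fredholm (shifted k S)"
      using upper_semi_Fredholm_shifted_open[OF U[OF m(1)]] by blast
    have "(\<lambda>n. norm (T - S n)) \<longlonglongrightarrow> 0"
      by (rule Lim_null_comparison[OF always_eventually[OF allI] LIMSEQ_inverse_real_of_nat])
        (use Sl(1) in \<open>simp add: norm_minus_commute less_imp_le\<close>)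
    from LIMSEQ_subseq_LIMSEQ[OF this m(2)] have "(\<lambda>n. norm (T - S (r n))) \<longlonglongrightarrow> 0" by (simp add: o_def)
    moreover have "(\<lambda>n. cmod (m - l (r n))) \<longlonglongrightarrow> cmod (m - m)"
      using m(3) by (intro tendsto_intros) (simp add: o_def)
    ultimately have "(\<lambda>n. cmod (m - l (r n)) + norm (T - S (r n))) \<longlonglongrightarrow> cmod (m - m) + 0" by (intro tendsto_add)
    then have "eventually (\<lambda>n. cmod (m - l (r n)) + norm (T - S (r n)) < \<rho>) sequentially"
      by (rule order_tendstoD) (use \<rho>(1) in simp)
    then obtain n where "cmod (m - l (r n)) + norm (T - S (r n)) < \<rho>"
      unfolding eventually_sequentially by blast
    then show False using \<rho>(2) Sl(3) by blast
  qed
  then obtain d where d: "d > 0" "\<And>S l. norm (S - T) < d \<Longrightarrow> l \<in> sphere 0 1 \<Longrightarrow> upper_semi_Fredholm (shifted l S)"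
    by blast
  obtain c where c: "c > 0" "\<And>y. y \<in> UNIV \<Longrightarrow> \<exists>y'\<in>UNIV. shifted l0 T y' = shifted l0 T y \<and> c * norm y' \<le> norm (shifted l0 T y)"
    using upper_semi_Fredholm_lower_bound[OF A U[OF l0(1)], of UNIV] by auto
  have low: "c * norm y \<le> norm (shifted l0 T y)" for y
  proof -
    obtain y' where y': "shifted l0 T y' = shifted l0 T y" "c * norm y' \<le> norm (shifted l0 T y)" using c(2)[of y] by auto
    then have "y' - y \<in> op_kernel (shifted l0 T)" by (simp add: op_kernel_def bounded_clinearD(2)[OF A])
    then show ?thesis using y' l0(2) by simp
  qed
  show thesis
  proof (rule that[of "min c d"])
    show "op_kernel (shifted l0 S) = {0}" if S: "norm (S - T) < min c d" for S
    proof -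
      have "y = 0" if y: "shifted l0 S y = 0" for y
      proof (rule ccontr)
        assume "y \<noteq> 0"
        then have "norm (S - T) * norm y < c * norm y" using S by simp
        then show False using low[of y] norm_shifted_diff_le[of l0 T y l0 S] y by (simp add: norm_minus_commute)
      qed
      then show ?thesis using zero_in_op_kernel[of l0 S] unfolding op_kernel_def by auto
    qed
  qed (use c(1) d in auto)
qed

section \<open>Decay of returning orbits\<close>

lemma cis_root_of_unity: "N > 0 \<Longrightarrow> cis (2 * pi / real N) ^ N = 1"
  by (simp add: Complex.DeMoivre)

lemma root_of_unity_orthogonality:
  fixes N :: nat
  defines "\<omega> \<equiv> cis (2 * pi / N)"
  assumes "m < N" "n < N"
  shows "(\<Sum>k<N. (\<omega> ^ k) ^ m * cnj ((\<omega> ^ k) ^ n)) = (if m = n then of_nat N else 0)"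
proof -
  define q where "q = \<omega> ^ m * cnj (\<omega> ^ n)"
  have N: "N > 0" using assms by simp
  have wN: "\<omega> ^ N = 1" unfolding \<omega>_def using N by (rule cis_root_of_unity)
  have unit: "\<omega> ^ n * cnj (\<omega> ^ n) = 1"
    unfolding complex_norm_square[symmetric] by (simp add: norm_power \<omega>_def)
  have term_eq: "(\<omega> ^ k) ^ m * cnj ((\<omega> ^ k) ^ n) = q ^ k" for k
    by (simp add: q_def power_mult_distrib power_mult[symmetric] mult.commute)
  have qN: "q ^ N = 1"
  proof -
    have "q ^ N = (\<omega> ^ N) ^ m * cnj ((\<omega> ^ N) ^ n)" by (rule term_eq[symmetric])
    then show ?thesis by (simp add: wN)
  qed
  show ?thesis
  proof (cases "m = n")
    case True
    then have "q = 1" using unit by (simp add: q_def)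
    then show ?thesis unfolding term_eq using True by simp
  next
    case False
    have "inj_on (\<lambda>k. cis (2 * pi * real k / real N)) {..<N}"
      using Complex.bij_betw_roots_unity[OF N] unfolding bij_betw_def by blast
    moreover have "\<omega> ^ k = cis (2 * pi * real k / real N)" for k
      by (simp add: \<omega>_def Complex.DeMoivre mult_ac)
    ultimately have "\<omega> ^ m \<noteq> \<omega> ^ n" using False assms(2,3) unfolding inj_on_def by auto
    moreover have "q = 1 \<Longrightarrow> \<omega> ^ m = \<omega> ^ n"
      using unit unfolding q_def by (metis mult.commute mult.left_commute mult.right_neutral)
    ultimately have "q \<noteq> 1" by blast
    then show ?thesis unfolding term_eq using False qN geometric_sum[of q N] by simp
  qed
qed

text \<open>Parseval's identity on the cyclic group of order \<open>N\<close>, with values in the Hilbert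
  space.\<close>

lemma discrete_Parseval:
  fixes x :: "nat \<Rightarrow> 'h::complex_inner" and N :: nat
  defines "\<omega> \<equiv> cis (2 * pi / N)"
  shows "(\<Sum>k<N. (norm (\<Sum>n<N. (\<omega> ^ k) ^ n *\<^sub>C x n))\<^sup>2) = N * (\<Sum>n<N. (norm (x n))\<^sup>2)"
proof -
  have "complex_of_real (\<Sum>k<N. (norm (\<Sum>n<N. (\<omega> ^ k) ^ n *\<^sub>C x n))\<^sup>2)
      = (\<Sum>k<N. cinner (\<Sum>m<N. (\<omega> ^ k) ^ m *\<^sub>C x m) (\<Sum>n<N. (\<omega> ^ k) ^ n *\<^sub>C x n))"
    by (simp only: of_real_sum cinner_self)
  also have "\<dots> = (\<Sum>k<N. \<Sum>m<N. \<Sum>n<N. ((\<omega> ^ k) ^ m * cnj ((\<omega> ^ k) ^ n)) * cinner (x m) (x n))"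
    by (simp only: cinner_sum_left) (simp only: cinner_sum_right cinner_scaleC_left cinner_scaleC_right mult_ac sum_distrib_left)
  also have "\<dots> = (\<Sum>m<N. \<Sum>n<N. (\<Sum>k<N. (\<omega> ^ k) ^ m * cnj ((\<omega> ^ k) ^ n)) * cinner (x m) (x n))"
    unfolding sum_distrib_right by (subst sum.swap) (intro sum.cong sum.swap refl)
  also have "\<dots> = (\<Sum>m<N. \<Sum>n<N. (if m = n then of_nat N * cinner (x m) (x m) else 0))"
    unfolding \<omega>_def by (intro sum.cong refl, subst root_of_unity_orthogonality) auto
  also have "\<dots> = (\<Sum>m<N. of_nat N * cinner (x m) (x m))" by simp
  also have "\<dots> = complex_of_real (N * (\<Sum>n<N. (norm (x n))\<^sup>2))"
    by (simp add: cinner_self sum_distrib_left)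
  finally show ?thesis using of_real_eq_iff by blast
qed

lemma uniform_lower_bound_circle:
  fixes T :: "'h::complex_hilbert \<Rightarrow>\<^sub>L 'h"
  assumes T: "T \<in> bounded_operators"
    and U: "\<And>l. l \<in> sphere 0 1 \<Longrightarrow> upper_semi_Fredholm (shifted l T)"
    and Y: "cvs.subspace Y" "closed Y"
    and inj: "\<And>l. l \<in> sphere 0 1 \<Longrightarrow> op_kernel (shifted l T) \<inter> Y = {0}"
  shows "\<exists>c>0. \<forall>l\<in>sphere 0 1. \<forall>y\<in>Y. c * norm y \<le> norm (shifted l T y)"
proof (rule ccontr)
  assume neg: "\<not> ?thesis"
  note A = bounded_clinear_shifted[OF T]
  have "\<exists>l y. l \<in> sphere 0 1 \<and> y \<in> Y \<and> norm y = 1 \<and> norm (shifted l T y) \<le> inverse (Suc n)" for n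
  proof -
    have "inverse (real (Suc n)) > 0" by simp
    then obtain l y where ly: "l \<in> sphere 0 1" "y \<in> Y" "norm (shifted l T y) < inverse (Suc n) * norm y"
      using neg by (meson not_le)
    then have y0: "y \<noteq> 0" using bounded_clinearD(3)[OF A] by auto
    let ?a = "complex_of_real (1 / norm y)"
    have "norm (shifted l T (?a *\<^sub>C y)) = norm (shifted l T y) / norm y"
      unfolding bounded_clinearD(5)[OF A] by (simp add: norm_scaleC norm_divide)
    also have "\<dots> \<le> inverse (Suc n)" using less_imp_le[OF ly(3)] y0 by (simp add: pos_divide_le_eq)
    finally have "norm (shifted l T (?a *\<^sub>C y)) \<le> inverse (Suc n)" .
    moreover have "norm (?a *\<^sub>C y) = 1" using y0 by (simp add: norm_scaleC norm_divide)
    moreover have "?a *\<^sub>C y \<in> Y" using ly(2) by (rule cvs.subspace_scale[OF Y(1)])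
    ultimately show ?thesis using ly(1) by blast
  qed
  then obtain l y where ly: "\<And>n. l n \<in> sphere 0 1" "\<And>n. y n \<in> Y" "\<And>n. norm (y n) = 1"
    "\<And>n. norm (shifted (l n) T (y n)) \<le> inverse (Suc n)" by metis
  have "seq_compact (sphere (0::complex) 1)" by (intro compact_imp_seq_compact compact_sphere)
  from seq_compactE[OF this, of l] ly(1)
  obtain m r where m: "m \<in> sphere 0 1" "strict_mono (r::nat\<Rightarrow>nat)" "(l \<circ> r) \<longlonglongrightarrow> m" by blast
  have "(\<lambda>n. cmod (m - l (r n))) \<longlonglongrightarrow> cmod (m - m)"
    using m(3) by (intro tendsto_intros) (simp add: o_def)
  then have "(\<lambda>n. cmod (m - l (r n))) \<longlonglongrightarrow> 0" by simp
  moreover have "(\<lambda>n. inverse (real (Suc (r n)))) \<longlonglongrightarrow> 0"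
    using LIMSEQ_subseq_LIMSEQ[OF LIMSEQ_inverse_real_of_nat m(2)] by (simp add: o_def)
  ultimately have g: "(\<lambda>n. cmod (m - l (r n)) + inverse (Suc (r n))) \<longlonglongrightarrow> 0 + 0" by (intro tendsto_add)
  have "norm (shifted m T (y (r n))) \<le> cmod (m - l (r n)) + inverse (Suc (r n))" for n
  proof -
    have "norm (shifted m T (y (r n))) \<le> norm (shifted m T (y (r n)) - shifted (l (r n)) T (y (r n)))
        + norm (shifted (l (r n)) T (y (r n)))"
      using norm_triangle_ineq[of "shifted m T (y (r n)) - shifted (l (r n)) T (y (r n))" "shifted (l (r n)) T (y (r n))"] by simp
    also have "\<dots> \<le> cmod (m - l (r n)) + inverse (Suc (r n))"
      using norm_shifted_diff_le[of m T "y (r n)" "l (r n)" T] ly(3)[of "r n"] ly(4)[of "r n"]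
      by (intro add_mono) auto
    finally show ?thesis .
  qed
  then have Ay: "(\<lambda>n. shifted m T (y (r n))) \<longlonglongrightarrow> 0"
    by (rule Lim_null_comparison[OF always_eventually[OF allI] g[unfolded add_0]])
  have bd: "norm (y (r n)) \<le> 1" for n by (simp add: ly(3))
  from upper_semi_Fredholm_subsequence[OF A U[OF m(1)] bd convergentI[OF Ay]]
  obtain s z where s: "strict_mono (s::nat\<Rightarrow>nat)" "(\<lambda>n. y (r (s n))) \<longlonglongrightarrow> z" .
  have "z \<in> Y" by (rule closed_sequentially[OF Y(2) _ s(2)]) (rule ly(2))
  moreover have "shifted m T z = 0"
    by (rule LIMSEQ_unique[OF bounded_clinear_tendsto[OF A s(2)]])
      (use LIMSEQ_subseq_LIMSEQ[OF Ay s(1)] in \<open>simp add: o_def\<close>)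
  ultimately have "z = 0" using inj[OF m(1)] unfolding op_kernel_def by blast
  moreover have "norm z = 1"
    using LIMSEQ_unique[OF tendsto_norm[OF s(2)]] ly(3) by simp
  ultimately show False by simp
qed

definition returns_to_zero :: "('a::real_normed_vector \<Rightarrow> 'a) \<Rightarrow> 'a \<Rightarrow> bool" where
  "returns_to_zero T v \<longleftrightarrow> (\<forall>\<epsilon>>0. \<forall>N. \<exists>n\<ge>N. norm ((T ^^ n) v) < \<epsilon>)"

definition decays_geometrically :: "('a::real_normed_vector \<Rightarrow> 'a) \<Rightarrow> 'a \<Rightarrow> bool" where
  "decays_geometrically T v \<longleftrightarrow> (\<exists>C r. 0 \<le> r \<and> r < 1 \<and> (\<forall>n. norm ((T ^^ n) v) \<le> C * r ^ n))"

lemma funpow_mem: "T ` Y \<subseteq> Y \<Longrightarrow> v \<in> Y \<Longrightarrow> (T ^^ n) v \<in> Y"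
  by (induction n) auto

text \<open>For a root of unity \<open>z\<close> put \<open>y = (\<Sum>n<N. z ^ n *\<^sub>C (T ^^ n)
  w)\<close>. Because of \<open>z ^ N = 1\<close> the operator \<open>1 - z T\<close> maps
  \<open>y\<close> to \<open>w - (T ^^ N) w\<close> by telescoping, so the lower bound controls
  the norm of \<open>y\<close>. Averaging over all \<open>z\<close> and using Parseval gives the
  sum over the orbit.\<close>

lemma orbit_segment_bound:
  fixes T :: "'h::complex_hilbert \<Rightarrow>\<^sub>L 'h"
  assumes T: "T \<in> bounded_operators" and Y: "cvs.subspace Y" "blinfun_apply T ` Y \<subseteq> Y"
    and c: "0 < c" "\<And>l y. l \<in> sphere 0 1 \<Longrightarrow> y \<in> Y \<Longrightarrow> c * norm y \<le> norm (shifted l T y)"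
    and w: "w \<in> Y" and N: "N > 0"
  shows "c\<^sup>2 * (\<Sum>n<N. (norm ((blinfun_apply T ^^ n) w))\<^sup>2) \<le> (norm w + norm ((blinfun_apply T ^^ N) w))\<^sup>2"
proof -
  let ?x = "\<lambda>n. (blinfun_apply T ^^ n) w"
  define \<omega> where "\<omega> = cis (2 * pi / N)"
  define z where "z k = \<omega> ^ k" for k :: nat
  let ?B = "(norm w + norm (?x N))\<^sup>2"
  have wN: "\<omega> ^ N = 1" unfolding \<omega>_def using N by (rule cis_root_of_unity)
  have zN: "z k ^ N = 1" and zu: "cmod (z k) = 1" for k
    using wN by (auto simp: z_def power_mult[symmetric] mult.commute[of k] norm_power \<omega>_def)
      (simp add: power_mult flip: \<omega>_def)
  have bd: "c\<^sup>2 * (norm (\<Sum>n<N. z k ^ n *\<^sub>C ?x n))\<^sup>2 \<le> ?B" for k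
  proof -
    let ?y = "\<Sum>n<N. z k ^ n *\<^sub>C ?x n"
    have yY: "?y \<in> Y" by (intro cvs.subspace_sum[OF Y(1)] cvs.subspace_scale[OF Y(1)] funpow_mem[OF Y(2) w])
    have Ty: "blinfun_apply T ?y = (\<Sum>n<N. z k ^ n *\<^sub>C ?x (Suc n))"
      using T unfolding bounded_operators_def by (simp add: blinfun.sum_right)
    have "z k *\<^sub>C shifted (inverse (z k)) T ?y = ?y - z k *\<^sub>C blinfun_apply T ?y"
    proof -
      have "z k \<noteq> 0" using zu[of k] by auto
      then show ?thesis by (simp add: shifted_def cvs.scale_right_diff_distrib)
    qed
    also have "\<dots> = (\<Sum>n<N. z k ^ n *\<^sub>C ?x n - z k ^ Suc n *\<^sub>C ?x (Suc n))"
      unfolding Ty by (simp add: cvs.scale_sum_right sum_subtractf)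
    also have "\<dots> = w - ?x N"
      using sum_lessThan_telescope'[of "\<lambda>n. z k ^ n *\<^sub>C ?x n" N] zN[of k] by simp
    finally have E: "z k *\<^sub>C shifted (inverse (z k)) T ?y = w - ?x N" .
    have "norm (shifted (inverse (z k)) T ?y) = norm (z k *\<^sub>C shifted (inverse (z k)) T ?y)"
      unfolding norm_scaleC zu by (rule mult_1[symmetric])
    then have E': "norm (shifted (inverse (z k)) T ?y) = norm (w - ?x N)" unfolding E .
    have "inverse (z k) \<in> sphere 0 1" using zu by (simp add: norm_inverse)
    from c(2)[OF this yY] have "c * norm ?y \<le> norm (w - ?x N)" unfolding E' .
    also have "\<dots> \<le> norm w + norm (?x N)" by (rule norm_triangle_ineq4)
    finally have "(c * norm ?y)\<^sup>2 \<le> ?B" using c(1) by (intro power_mono) auto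
    then show ?thesis by (simp add: power_mult_distrib)
  qed
  have "N * (c\<^sup>2 * (\<Sum>n<N. (norm (?x n))\<^sup>2)) = (\<Sum>k<N. c\<^sup>2 * (norm (\<Sum>n<N. z k ^ n *\<^sub>C ?x n))\<^sup>2)"
    using discrete_Parseval[of N ?x] by (simp add: z_def \<omega>_def sum_distrib_left[symmetric])
  also have "\<dots> \<le> N * ?B" using sum_mono[of "{..<N}" _ "\<lambda>_. ?B", OF bd] by simp
  finally show ?thesis using N by simp
qed

lemma returns_to_zero_funpow:
  assumes "returns_to_zero T v" shows "returns_to_zero T ((T ^^ a) v)"
  unfolding returns_to_zero_def
proof (intro allI impI)
  fix \<epsilon> :: real and N :: nat assume "\<epsilon> > 0"
  then obtain n where "n \<ge> N + a" "norm ((T ^^ n) v) < \<epsilon>" using assms unfolding returns_to_zero_def by blast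
  then show "\<exists>n\<ge>N. norm ((T ^^ n) ((T ^^ a) v)) < \<epsilon>"
    by (intro exI[of _ "n - a"]) (simp add: funpow_add[symmetric, THEN fun_cong, unfolded o_apply])
qed

text \<open>Letting \<open>N\<close> in \<open>orbit_segment_bound\<close> run through times of return to
  \<open>0\<close>, every term of the sequence of squared norms is at least a fixed fraction
  \<open>g\<close> of the tail sum starting at it; hence the tail sums decrease geometrically.\<close>

lemma decay_of_bounded_below:
  fixes T :: "'h::complex_hilbert \<Rightarrow>\<^sub>L 'h"
  assumes T: "T \<in> bounded_operators" and Y: "cvs.subspace Y" "blinfun_apply T ` Y \<subseteq> Y"
    and c: "0 < c" "\<And>l y. l \<in> sphere 0 1 \<Longrightarrow> y \<in> Y \<Longrightarrow> c * norm y \<le> norm (shifted l T y)"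
    and v: "v \<in> Y" "returns_to_zero (blinfun_apply T) v"
  shows "decays_geometrically (blinfun_apply T) v"
proof -
  let ?a = "\<lambda>n. (norm ((blinfun_apply T ^^ n) v))\<^sup>2"
  define g where "g = min (c\<^sup>2) (1/2)"
  have g: "0 < g" "g \<le> c\<^sup>2" "g < 1" using c(1) by (auto simp: g_def)
  have part: "g * (\<Sum>n<M. ?a (n + m)) \<le> ?a m" for M m
  proof (rule field_le_epsilon)
    fix e :: real assume e: "e > 0"
    let ?w = "(blinfun_apply T ^^ m) v"
    have "continuous (at 0) (\<lambda>t. (norm ?w + t)\<^sup>2)" by (intro continuous_intros)
    then have "((\<lambda>t. (norm ?w + t)\<^sup>2) \<longlongrightarrow> (norm ?w + 0)\<^sup>2) (at 0)" unfolding continuous_at by simp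
    then have "eventually (\<lambda>t. (norm ?w + t)\<^sup>2 < (norm ?w)\<^sup>2 + e) (at 0)"
      by (rule order_tendstoD) (use e in simp)
    then obtain d where d: "d > 0" "\<And>t. t \<noteq> 0 \<Longrightarrow> \<bar>t\<bar> < d \<Longrightarrow> (norm ?w + t)\<^sup>2 < (norm ?w)\<^sup>2 + e"
      unfolding eventually_at by (auto simp: dist_real_def)
    obtain N where N: "N \<ge> Suc M" "norm ((blinfun_apply T ^^ N) ?w) < d / 2"
      using returns_to_zero_funpow[OF v(2), of m] d(1) unfolding returns_to_zero_def by (meson half_gt_zero)
    have "(\<Sum>n<M. ?a (n + m)) \<le> (\<Sum>n<N. ?a (n + m))" using N by (intro sum_mono2) auto
    moreover have "0 \<le> (\<Sum>n<N. ?a (n + m))" by (intro sum_nonneg) auto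
    ultimately have "g * (\<Sum>n<M. ?a (n + m)) \<le> c\<^sup>2 * (\<Sum>n<N. ?a (n + m))"
      using g by (intro mult_mono) (auto intro: sum_nonneg)
    also have "\<dots> \<le> (norm ?w + norm ((blinfun_apply T ^^ N) ?w))\<^sup>2"
      using orbit_segment_bound[OF T Y c funpow_mem[OF Y(2) v(1)], of N m] N by (simp add: funpow_add)
    also have "\<dots> \<le> (norm ?w + d / 2)\<^sup>2" using N by (intro power_mono) auto
    also have "\<dots> \<le> ?a m + e" using d(2)[of "d/2"] d(1) by simp
    finally show "g * (\<Sum>n<M. ?a (n + m)) \<le> ?a m + e" .
  qed
  have sm: "summable (\<lambda>n. ?a (n + m))" for m
  proof (rule summableI_nonneg_bounded)
    show "(\<Sum>n<M. ?a (n + m)) \<le> ?a m / g" for M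
      using part[where M = M and m = m] g(1) by (simp add: pos_le_divide_eq mult.commute)
  qed simp
  define S where "S m = (\<Sum>n. ?a (n + m))" for m
  have S0: "0 \<le> S m" for m unfolding S_def by (intro suminf_nonneg sm) simp
  have SS: "S m = ?a m + S (Suc m)" for m
    using suminf_split_head[OF sm[of m]] by (simp add: S_def)
  have gS: "g * S m \<le> ?a m" for m
  proof -
    have "S m \<le> ?a m / g"
      unfolding S_def
    proof (rule suminf_le_const[OF sm])
      show "(\<Sum>n<M. ?a (n + m)) \<le> ?a m / g" for M
        using part[where M = M and m = m] g(1) by (simp add: pos_le_divide_eq mult.commute)
    qed
    then show ?thesis using g(1) by (simp add: pos_le_divide_eq mult.commute)
  qed
  have Sn: "S n \<le> S 0 * (1 - g) ^ n" for n
  proof (induction n)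
    case (Suc n)
    have "S (Suc n) \<le> (1 - g) * S n" using gS[of n] SS[of n] by (simp add: algebra_simps)
    also have "\<dots> \<le> (1 - g) * (S 0 * (1 - g) ^ n)" using Suc g by (intro mult_left_mono) auto
    finally show ?case by (simp add: mult_ac)
  qed simp
  have "norm ((blinfun_apply T ^^ n) v) \<le> sqrt (S 0) * sqrt (1 - g) ^ n" for n
  proof -
    have "?a n \<le> S 0 * (1 - g) ^ n" using SS[of n] S0[of "Suc n"] Sn[of n] by linarith
    then have "norm ((blinfun_apply T ^^ n) v) \<le> sqrt (S 0 * (1 - g) ^ n)" by (rule real_le_rsqrt)
    then show ?thesis by (simp add: real_sqrt_mult real_sqrt_power)
  qed
  moreover have "0 \<le> sqrt (1 - g)" "sqrt (1 - g) < 1" using g by auto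
  ultimately show ?thesis unfolding decays_geometrically_def by blast
qed

lemma funpow_commute_clinear:
  assumes T: "T \<in> bounded_operators"
  shows "(blinfun_apply T ^^ n) (shifted l T v) = shifted l T ((blinfun_apply T ^^ n) v)"
    and "blinfun_apply T ((shifted l T ^^ n) v) = (shifted l T ^^ n) (blinfun_apply T v)"
proof -
  have 1: "blinfun_apply T (shifted l T v) = shifted l T (blinfun_apply T v)" for v
    using T unfolding bounded_operators_def shifted_def by (simp add: blinfun.diff_right)
  show "(blinfun_apply T ^^ n) (shifted l T v) = shifted l T ((blinfun_apply T ^^ n) v)"
    by (induction n) (auto simp: 1)
  show "blinfun_apply T ((shifted l T ^^ n) v) = (shifted l T ^^ n) (blinfun_apply T v)"
    by (induction n) (auto simp: 1)
qed

text \<open>With \<open>y n = (T ^^ n) v\<close> and \<open>\<bar>l\<bar> = 1\<close>, the sequence \<open>l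
  *\<^sub>C y n - y (Suc n)\<close> is the orbit of \<open>shifted l T v\<close>. If it decays
  geometrically, the norm of \<open>y n\<close> exceeds that of a later, arbitrarily small
  \<open>y k\<close> by at most a geometric tail.\<close>

lemma decay_of_shifted_decay:
  fixes T :: "'h::complex_hilbert \<Rightarrow>\<^sub>L 'h"
  assumes T: "T \<in> bounded_operators" and l: "cmod l = 1"
    and ret: "returns_to_zero (blinfun_apply T) v"
    and dec: "returns_to_zero (blinfun_apply T) (shifted l T v) \<Longrightarrow> decays_geometrically (blinfun_apply T) (shifted l T v)"
  shows "decays_geometrically (blinfun_apply T) v"
proof -
  let ?y = "\<lambda>n. (blinfun_apply T ^^ n) v"
  have u: "(blinfun_apply T ^^ n) (shifted l T v) = l *\<^sub>C ?y n - ?y (Suc n)" for n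
    unfolding funpow_commute_clinear(1)[OF T] by (simp add: shifted_def)
  have "returns_to_zero (blinfun_apply T) (shifted l T v)"
    unfolding returns_to_zero_def
  proof (intro allI impI)
    fix e :: real and N assume e: "e > 0"
    have p: "1 + norm T > 0" using norm_ge_zero[of T] by linarith
    then have "e / (1 + norm T) > 0" using e by simp
    then obtain n where n: "n \<ge> N" "norm (?y n) < e / (1 + norm T)"
      using ret unfolding returns_to_zero_def by blast
    have "norm ((blinfun_apply T ^^ n) (shifted l T v)) \<le> norm (l *\<^sub>C ?y n) + norm (?y (Suc n))"
      unfolding u by (rule norm_triangle_ineq4)
    also have "\<dots> \<le> norm (?y n) + norm T * norm (?y n)"
      using l norm_blinfun[of T "?y n"] by (simp add: norm_scaleC)
    also have "\<dots> = norm (?y n) * (1 + norm T)" by (simp add: algebra_simps)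
    also have "\<dots> < e" using n(2) p by (simp add: pos_less_divide_eq)
    finally show "\<exists>n\<ge>N. norm ((blinfun_apply T ^^ n) (shifted l T v)) < e" using n(1) by blast
  qed
  from dec[OF this] obtain C r where C: "0 \<le> r" "r < 1" "\<And>n. norm (l *\<^sub>C ?y n - ?y (Suc n)) \<le> C * r ^ n"
    unfolding decays_geometrically_def u by blast
  have C0: "0 \<le> C" using order_trans[OF norm_ge_zero C(3)[of 0]] by simp
  have step: "norm (?y n) \<le> norm (?y (Suc n)) + C * r ^ n" for n
  proof -
    have "norm (?y n) = norm (l *\<^sub>C ?y n)" using l by (simp add: norm_scaleC)
    also have "\<dots> \<le> norm (?y (Suc n)) + norm (l *\<^sub>C ?y n - ?y (Suc n))"
      using norm_triangle_ineq[of "?y (Suc n)" "l *\<^sub>C ?y n - ?y (Suc n)"] by simp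
    finally show ?thesis using C(3)[of n] by linarith
  qed
  define D where "D = C / (1 - r)"
  have D: "D * (1 - r) = C" "0 \<le> D" using C C0 by (simp_all add: D_def)
  \<comment> \<open>Going forward to a time at which the orbit is small only costs a geometric tail.\<close>
  have fwd: "norm (?y n) + D * r ^ (n + m) \<le> norm (?y (n + m)) + D * r ^ n" for n m
  proof (induction m)
    case (Suc m)
    have "D * r ^ (n + m) - D * r ^ (n + Suc m) = D * (1 - r) * r ^ (n + m)"
      by (simp add: algebra_simps)
    then have "D * r ^ (n + m) - D * r ^ (n + Suc m) = C * r ^ (n + m)" unfolding D(1) .
    then show ?case using Suc step[of "n + m"] by (simp only: add_Suc_right)
  qed simp
  have "norm (?y n) \<le> D * r ^ n" for n
  proof (rule field_le_epsilon)
    fix e :: real assume "e > 0"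
    then obtain k where k: "k \<ge> n" "norm (?y k) < e" using ret unfolding returns_to_zero_def by blast
    have "0 \<le> D * r ^ k" using D(2) C(1) by simp
    then show "norm (?y n) \<le> D * r ^ n + e" using fwd[of n "k - n"] k by simp
  qed
  then show ?thesis unfolding decays_geometrically_def using C(1,2) by blast
qed

lemma decay_of_funpow_image:
  fixes T :: "'h::complex_hilbert \<Rightarrow>\<^sub>L 'h"
  assumes T: "T \<in> bounded_operators" and l: "cmod l = 1"
    and "\<And>v. v \<in> (shifted l T ^^ n) ` Y \<Longrightarrow> returns_to_zero (blinfun_apply T) v \<Longrightarrow> decays_geometrically (blinfun_apply T) v"
    and "v \<in> Y" "returns_to_zero (blinfun_apply T) v"
  shows "decays_geometrically (blinfun_apply T) v"
  using assms(3-)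
proof (induction n arbitrary: Y v)
  case (Suc n)
  show ?case
  proof (rule decay_of_shifted_decay[OF T l Suc.prems(3)])
    assume "returns_to_zero (blinfun_apply T) (shifted l T v)"
    moreover have "(shifted l T ^^ Suc n) ` Y = (shifted l T ^^ n) ` (shifted l T ` Y)"
      unfolding funpow_Suc_right image_comp ..
    ultimately show "decays_geometrically (blinfun_apply T) (shifted l T v)"
      using Suc.IH[of "shifted l T ` Y" "shifted l T v"] Suc.prems(1,2) by (metis imageI)
  qed
qed simp

text \<open>Induction on the finite set of eigenvalues on the circle. Restricting \<open>T\<close> to the
  image of \<open>Y\<close> under a power of \<open>shifted l T\<close> removes the eigenvalue
  \<open>l\<close>, and decay on the smaller space implies decay on the larger one.\<close>

lemma decay_by_removing_eigenvalues:
  fixes T :: "'h::complex_hilbert \<Rightarrow>\<^sub>L 'h"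
  assumes T: "T \<in> bounded_operators"
    and U: "\<And>l. l \<in> sphere 0 1 \<Longrightarrow> upper_semi_Fredholm (shifted l T)"
    and "finite F"
    and F: "\<And>l. l \<in> F \<Longrightarrow> l \<in> sphere 0 1 \<and> (\<exists>n. op_kernel (shifted l T) \<inter> range (shifted l T ^^ n) = {0})"
    and Y: "cvs.subspace Y" "closed Y" "blinfun_apply T ` Y \<subseteq> Y"
    and inj: "\<And>l. l \<in> sphere 0 1 - F \<Longrightarrow> op_kernel (shifted l T) \<inter> Y = {0}"
    and v: "v \<in> Y" "returns_to_zero (blinfun_apply T) v"
  shows "decays_geometrically (blinfun_apply T) v"
  using assms(3-)
proof (induction F arbitrary: Y v)
  case empty
  have "\<And>l. l \<in> sphere 0 1 \<Longrightarrow> op_kernel (shifted l T) \<inter> Y = {0}" using empty.prems(5) by simp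
  from uniform_lower_bound_circle[OF T U empty.prems(2,3) this]
  obtain c where c: "c > 0" "\<And>l y. l \<in> sphere 0 1 \<Longrightarrow> y \<in> Y \<Longrightarrow> c * norm y \<le> norm (shifted l T y)" by blast
  show ?case by (rule decay_of_bounded_below[OF T empty.prems(2,4) c empty.prems(6,7)])
next
  case (insert l F)
  note A = bounded_clinear_shifted[OF T]
  obtain n where l: "l \<in> sphere 0 1" and n: "op_kernel (shifted l T) \<inter> range (shifted l T ^^ n) = {0}"
    using insert.prems(1)[of l] by blast
  let ?Y = "(shifted l T ^^ n) ` Y"
  have Y': "cvs.subspace ?Y" "closed ?Y"
    using funpow_image_closed_subspace[OF A U[OF l] insert.prems(2,3)] by blast+
  have sub: "?Y \<subseteq> Y"
  proof -
    have "shifted l T ` Y \<subseteq> Y"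
      using insert.prems(2,4) unfolding shifted_def by (auto intro!: cvs.subspace_diff cvs.subspace_scale)
    then show ?thesis by (intro image_subsetI) (rule funpow_mem)
  qed
  have inv: "blinfun_apply T ` ?Y \<subseteq> ?Y"
    using insert.prems(4) funpow_commute_clinear(2)[OF T] by (auto simp: image_subset_iff)
  have inj': "op_kernel (shifted m T) \<inter> ?Y = {0}" if m: "m \<in> sphere 0 1 - F" for m
  proof -
    have "op_kernel (shifted m T) \<inter> ?Y \<subseteq> {0}"
    proof (cases "m = l")
      case True then show ?thesis using n by blast
    next
      case False then show ?thesis using insert.prems(5)[of m] m sub by blast
    qed
    then show ?thesis using cvs.subspace_0[OF Y'(1)] zero_in_op_kernel[of m T] by blast
  qed
  have dec: "decays_geometrically (blinfun_apply T) w" if "w \<in> ?Y" "returns_to_zero (blinfun_apply T) w" for w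
    using insert.IH[OF _ Y' inv inj' that] insert.prems(1) by blast
  have "cmod l = 1" using l by simp
  from decay_of_funpow_image[OF T this dec insert.prems(6,7)] show ?case .
qed

text \<open>By \<open>nearby_injective\<close> the eigenvalues on the circle are isolated, hence finite in
  number by compactness; a kernel whose intersection with the hyperrange is trivial already has
  trivial intersection with the range of some power.\<close>

theorem decay_of_circle_regular:
  fixes T :: "'h::complex_hilbert \<Rightarrow>\<^sub>L 'h"
  assumes T: "T \<in> bounded_operators"
    and U: "\<And>l. l \<in> sphere 0 1 \<Longrightarrow> upper_semi_Fredholm (shifted l T)"
    and Z: "\<And>l. l \<in> sphere 0 1 \<Longrightarrow> op_kernel (shifted l T) \<inter> hyperrange (shifted l T) = {0}"
    and v: "returns_to_zero (blinfun_apply T) v"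
  shows "decays_geometrically (blinfun_apply T) v"
proof -
  note A = bounded_clinear_shifted[OF T]
  define F where "F = {l \<in> sphere 0 1. op_kernel (shifted l T) \<noteq> {0}}"
  have "finite F"
  proof (rule ccontr)
    assume "infinite F"
    moreover have "compact (sphere (0::complex) 1)" by (rule compact_sphere)
    moreover have "F \<subseteq> sphere 0 1" by (auto simp: F_def)
    ultimately obtain l where l: "l \<in> sphere 0 1" "l islimpt F"
      unfolding compact_eq_Bolzano_Weierstrass by blast
    obtain r where r: "r > 0" "\<And>m. cmod (m - l) < r \<Longrightarrow> m \<noteq> l \<Longrightarrow> op_kernel (shifted m T) = {0}"
      using nearby_injective[OF T U[OF l(1)] Z[OF l(1)]] by metis
    obtain m where "m \<in> F" "m \<noteq> l" "dist m l < r" using l(2) r(1) unfolding islimpt_approachable by blast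
    then show False using r(2)[of m] by (simp add: F_def dist_norm)
  qed
  moreover have "l \<in> sphere 0 1 \<and> (\<exists>n. op_kernel (shifted l T) \<inter> range (shifted l T ^^ n) = {0})" if "l \<in> F" for l
  proof -
    have l: "l \<in> sphere 0 1" using that by (simp add: F_def)
    obtain n where n: "op_kernel (shifted l T) \<inter> range (shifted l T ^^ n) \<subseteq> hyperrange (shifted l T)"
      using kernel_range_stabilizes[OF A U[OF l]] by blast
    have "cvs.subspace (range (shifted l T ^^ n))"
      using funpow_image_closed_subspace[OF A U[OF l], of UNIV n] by simp
    then have "0 \<in> range (shifted l T ^^ n)" by (rule cvs.subspace_0)
    then show ?thesis using l n Z[OF l] zero_in_op_kernel[of l T] by blast
  qed
  moreover have "op_kernel (shifted l T) \<inter> UNIV = {0}" if "l \<in> sphere 0 1 - F" for l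
    using that by (simp add: F_def)
  ultimately show ?thesis
    using decay_by_removing_eigenvalues[OF T U, of F UNIV v] v by auto
qed

section \<open>Closures of the chaotic operators\<close>

lemma distributionally_chaotic_imp_Li_Yorke:
  assumes "distributionally_chaotic f" shows "Li_Yorke_chaotic f"
proof -
  have "Li_Yorke_pair f x y" if p: "distributionally_chaotic_pair f x y" for x y
  proof -
    let ?d = "\<lambda>n. dist ((f ^^ n) x) ((f ^^ n) y)"
    obtain e where e: "e > 0" "lower_distribution f x y e = 0"
      using p unfolding distributionally_chaotic_pair_def by blast
    have small: "\<exists>n\<ge>N. ?d n < t" if t: "t > 0" for t N
    proof (rule ccontr)
      assume "\<not> ?thesis"
      then have ge: "\<And>n. n \<ge> N \<Longrightarrow> t \<le> ?d n" by (meson not_le)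
      have "orbit_freq f x y n t \<le> 1 / 2" if n: "n \<ge> 2 * N + 1" for n
      proof -
        have "{i. i < n \<and> ?d i < t} \<subseteq> {..<N}" using ge by (auto simp: not_le[symmetric])
        then have "card {i. i < n \<and> ?d i < t} \<le> N" using card_mono[of "{..<N}"] by fastforce
        then show ?thesis unfolding orbit_freq_def using n by (simp add: field_simps)
      qed
      then have "eventually (\<lambda>n. ereal (orbit_freq f x y n t) \<le> ereal (1/2)) sequentially"
        unfolding eventually_sequentially by auto
      then have "upper_distribution f x y t \<le> ereal (1/2)"
        unfolding upper_distribution_def by (rule Limsup_bounded)
      then show False using p t unfolding distributionally_chaotic_pair_def by (simp add: one_ereal_def)
    qed
    have large: "\<exists>n\<ge>N. e \<le> ?d n" for N
    proof (rule ccontr)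
      assume "\<not> ?thesis"
      then have lt: "\<And>n. n \<ge> N \<Longrightarrow> ?d n < e" by (meson not_le)
      have "1 / 2 \<le> orbit_freq f x y n e" if n: "n \<ge> 2 * N + 1" for n
      proof -
        have "card {N..<n} \<le> card {i. i < n \<and> ?d i < e}" using lt by (intro card_mono) auto
        then show ?thesis unfolding orbit_freq_def using n by (simp add: field_simps)
      qed
      then have "eventually (\<lambda>n. ereal (1/2) \<le> ereal (orbit_freq f x y n e)) sequentially"
        unfolding eventually_sequentially by auto
      then have "ereal (1/2) \<le> lower_distribution f x y e"
        unfolding lower_distribution_def by (rule Liminf_bounded)
      then show False using e(2) by (simp add: zero_ereal_def)
    qed
    have "ereal e \<le> limsup (\<lambda>n. ereal (?d n))" using large by (intro limsup_ge_frequently) auto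
    then have "0 < limsup (\<lambda>n. ereal (?d n))" 
      using order_less_le_trans[of 0 "ereal e"] e(1) by simp
    moreover have "liminf (\<lambda>n. ereal (?d n)) \<le> 0"
    proof (rule ereal_le_epsilon2)
      fix t :: real assume "t > 0"
      show "liminf (\<lambda>n. ereal (?d n)) \<le> 0 + ereal t"
      proof (rule liminf_le_frequently)
        fix N
        obtain n where "n \<ge> N" "?d n < t" using small[OF \<open>t > 0\<close>, of N] by blast
        then show "\<exists>n\<ge>N. ereal (?d n) \<le> 0 + ereal t" by (intro exI[of _ n]) simp
      qed
    qed
    moreover have "0 \<le> liminf (\<lambda>n. ereal (?d n))" by (rule Liminf_bounded) auto
    ultimately show ?thesis unfolding Li_Yorke_pair_def by (simp add: antisym)
  qed
  then show ?thesis
    using assms unfolding distributionally_chaotic_def Li_Yorke_chaotic_def pairwise_def by meson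
qed

lemma LY_imp_returns_without_decay:
  fixes T :: "'h::complex_hilbert \<Rightarrow>\<^sub>L 'h"
  assumes "T \<in> LY"
  shows "\<exists>v. returns_to_zero (blinfun_apply T) v \<and> \<not> decays_geometrically (blinfun_apply T) v"
proof -
  obtain \<Gamma> where \<Gamma>: "uncountable \<Gamma>" "pairwise (Li_Yorke_pair (blinfun_apply T)) \<Gamma>"
    using assms unfolding LY_def Li_Yorke_chaotic_def by blast
  have "\<Gamma> \<noteq> {}" using \<Gamma>(1) by auto
  then obtain x where x: "x \<in> \<Gamma>" by blast
  have "\<not> \<Gamma> \<subseteq> {x}" using \<Gamma>(1) countable_subset[of \<Gamma> "{x}"] by auto
  then obtain y where y: "y \<in> \<Gamma>" "y \<noteq> x" by blast
  have p: "Li_Yorke_pair (blinfun_apply T) x y" using \<Gamma>(2) x y unfolding pairwise_def by metis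
  have lin: "linear (blinfun_apply T ^^ n)" for n
    by (intro funpow_linear bounded_linear.linear blinfun.bounded_linear_right)
  let ?n = "\<lambda>n. norm ((blinfun_apply T ^^ n) (x - y))"
  have d: "dist ((blinfun_apply T ^^ n) x) ((blinfun_apply T ^^ n) y) = ?n n" for n
    by (simp add: dist_norm linear_diff[OF lin])
  have ls: "limsup (\<lambda>n. ereal (?n n)) > 0" and li: "liminf (\<lambda>n. ereal (?n n)) = 0"
    using p unfolding Li_Yorke_pair_def d by blast+
  have "returns_to_zero (blinfun_apply T) (x - y)"
    unfolding returns_to_zero_def
  proof (intro allI impI, rule ccontr)
    fix e :: real and N assume e: "e > 0" and "\<not> (\<exists>n\<ge>N. ?n n < e)"
    then have "eventually (\<lambda>n. ereal e \<le> ereal (?n n)) sequentially"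
      unfolding eventually_sequentially by (auto simp: not_less)
    then have "ereal e \<le> liminf (\<lambda>n. ereal (?n n))" by (rule Liminf_bounded)
    then show False using e li by (simp add: zero_ereal_def)
  qed
  moreover have "\<not> decays_geometrically (blinfun_apply T) (x - y)"
  proof
    assume "decays_geometrically (blinfun_apply T) (x - y)"
    then obtain C r where C: "0 \<le> r" "r < 1" "\<And>n. ?n n \<le> C * r ^ n" unfolding decays_geometrically_def by blast
    have "?n \<longlonglongrightarrow> 0"
    proof (rule real_tendsto_sandwich[OF _ _ tendsto_const])
      show "(\<lambda>n. C * r ^ n) \<longlonglongrightarrow> 0" using C by (intro tendsto_mult_right_zero LIMSEQ_power_zero) auto
    qed (use C in auto)
    then have "(\<lambda>n. ereal (?n n)) \<longlonglongrightarrow> ereal 0" by (intro tendsto_ereal)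
    then have "limsup (\<lambda>n. ereal (?n n)) = ereal 0" by (intro lim_imp_Limsup) auto
    then show False using ls by (simp add: zero_ereal_def)
  qed
  ultimately show ?thesis by blast
qed

theorem theorem2p8:
  fixes E1 E2 :: "('h::complex_hilbert \<Rightarrow>\<^sub>L 'h) set"
  assumes separable: "separable_space (euclidean :: 'h topology)"
    and E1: "E1 = {T \<in> bounded_operators. sphere 0 1 \<inter> Wolf_spectrum T \<noteq> {}}"
    and E2: "E2 = {T \<in> bounded_operators. sphere 0 1 \<subseteq> semi_Fredholm_domain T \<and>
                     (\<forall>l \<in> sphere 0 1. cdim (op_kernel (shifted l T)) > 0)}"
  shows "op_closure DC = op_closure (LY :: ('h \<Rightarrow>\<^sub>L 'h) set) \<and>
         op_closure (LY :: ('h \<Rightarrow>\<^sub>L 'h) set) = E1 \<union> E2"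
proof -
  let ?E = "E1 \<union> E2"
  have clos: "op_closure S = bounded_operators \<inter> closure S" if "S \<subseteq> bounded_operators" for S :: "('h \<Rightarrow>\<^sub>L 'h) set"
    unfolding op_closure_def using that by (simp add: closure_of_subtopology Int_absorb1)
  have DB: "DC \<subseteq> bounded_operators" and LB: "LY \<subseteq> bounded_operators" by (auto simp: DC_def LY_def)
  have DL: "DC \<subseteq> (LY :: ('h \<Rightarrow>\<^sub>L 'h) set)"
    unfolding DC_def LY_def using distributionally_chaotic_imp_Li_Yorke by blast
  have kpos: "cdim (op_kernel (shifted l T)) > 0 \<longleftrightarrow> op_kernel (shifted l T) \<noteq> {0}"
    if "T \<in> bounded_operators" for l and T :: "'h \<Rightarrow>\<^sub>L 'h"
    by (intro cdim_pos_iff subspace_op_kernel bounded_clinear_shifted that)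
  have notE: "\<forall>l\<in>sphere 0 1. semi_Fredholm (shifted l T)" "\<exists>l\<in>sphere 0 1. op_kernel (shifted l T) = {0}"
    if "T \<in> bounded_operators" "T \<notin> ?E" for T
    using that kpos[OF that(1)] unfolding E1 E2 Wolf_spectrum_def semi_Fredholm_domain_def by auto
  have inE: "T \<notin> ?E"
    if T: "T \<in> bounded_operators" and U: "\<And>l. l \<in> sphere 0 1 \<Longrightarrow> upper_semi_Fredholm (shifted l T)"
      and l0: "l0 \<in> sphere 0 1" "op_kernel (shifted l0 T) = {0}" for T l0
  proof -
    have "semi_Fredholm (shifted l T)" if "l \<in> sphere 0 1" for l
      using upper_semi_Fredholm_imp_semi_Fredholm[OF bounded_clinear_shifted[OF T] U[OF that]] .
    then have "T \<notin> E1" unfolding E1 Wolf_spectrum_def semi_Fredholm_domain_def by auto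
    moreover have "\<not> cdim (op_kernel (shifted l0 T)) > 0" using kpos[OF T, of l0] l0(2) by blast
    then have "T \<notin> E2" using l0(1) unfolding E2 by blast
    ultimately show ?thesis by blast
  qed
  \<comment> \<open>Either a perturbation creates a Jordan chain, or one exists already at the point \<open>1\<close>.\<close>
  have E_DC: "?E \<subseteq> bounded_operators \<inter> closure DC"
  proof
    fix T assume TE: "T \<in> ?E"
    then have T: "T \<in> bounded_operators" unfolding E1 E2 by blast
    have "T \<in> closure DC"
    proof (cases "\<forall>l\<in>sphere 0 1. upper_semi_Fredholm (shifted l T)")
      case False
      then obtain l where l: "cmod l = 1" "\<not> upper_semi_Fredholm (shifted l T)" by auto
      show ?thesis unfolding closure_approachable
      proof (intro allI impI)
        fix e :: real assume "e > 0"
        then obtain S where "S \<in> DC" "norm (S - T) \<le> e / 2"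
          using DC_near_not_upper_semi_Fredholm[OF T l, of "e / 2"] by auto
        then show "\<exists>S\<in>DC. dist S T < e" using \<open>e > 0\<close> by (intro bexI[of _ S]) (auto simp: dist_norm)
      qed
    next
      case True
      then have U: "\<And>l. l \<in> sphere 0 1 \<Longrightarrow> upper_semi_Fredholm (shifted l T)" by blast
      have ker: "op_kernel (shifted l T) \<noteq> {0}" if "l \<in> sphere 0 1" for l
        using inE[OF T U that] TE by blast
      have 1: "(1::complex) \<in> sphere 0 1" by simp
      have "op_kernel (shifted 1 T) \<inter> hyperrange (shifted 1 T) \<noteq> {0}"
      proof
        assume Z: "op_kernel (shifted 1 T) \<inter> hyperrange (shifted 1 T) = {0}"
        obtain r where r: "r > 0" "\<And>m. cmod (m - 1) < r \<Longrightarrow> m \<noteq> 1 \<Longrightarrow> op_kernel (shifted m T) = {0}"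
          using nearby_injective[OF T U[OF 1] Z] by metis
        have "connected (sphere (0::complex) 1)" by (rule connected_sphere) simp
        moreover have "(-1::complex) \<in> sphere 0 1" by simp
        then have "\<nexists>x. sphere (0::complex) 1 = {x}" using 1 by (metis one_neq_neg_one singletonD)
        ultimately have "(1::complex) islimpt sphere 0 1" using 1 by (intro connected_imp_perfect) auto
        then obtain m where "m \<in> sphere (0::complex) 1" "m \<noteq> 1" "dist m 1 < r"
          using r(1) unfolding islimpt_approachable by blast
        then show False using r(2)[of m] ker[of m] by (simp add: dist_norm)
      qed
      then obtain e K C where "Jordan_chain (shifted 1 T) e K C"
        using Jordan_chain_exists[OF bounded_clinear_shifted[OF T] U[OF 1]] by blast
      then have "T \<in> DC" by (rule Jordan_chain_imp_DC[OF T norm_one])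
      then show ?thesis using closure_subset[of DC] by blast
    qed
    then show "T \<in> bounded_operators \<inter> closure DC" using T by blast
  qed
  \<comment> \<open>Off \<open>E1 \<union> E2\<close> an orbit that returns to \<open>0\<close> decays, contrary to the positive upper limit in a Li-Yorke pair.\<close>
  have LE: "T \<in> ?E" if T: "T \<in> LY" for T
  proof (rule ccontr)
    assume nE: "T \<notin> ?E"
    have TB: "T \<in> bounded_operators" using T LB by blast
    obtain l0 where l0: "l0 \<in> sphere 0 1" "op_kernel (shifted l0 T) = {0}" using notE(2)[OF TB nE] by blast
    have sF: "semi_Fredholm (shifted l T)" if "l \<in> sphere 0 1" for l using notE(1)[OF TB nE] that by blast
    obtain v where v: "returns_to_zero (blinfun_apply T) v" "\<not> decays_geometrically (blinfun_apply T) v"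
      using LY_imp_returns_without_decay[OF T] by blast
    show False using v(2) decay_of_circle_regular[OF TB circle_regular[OF TB sF l0] v(1)] by blast
  qed
  have "bounded_operators \<inter> closure LY \<subseteq> ?E"
  proof
    fix T :: "'h \<Rightarrow>\<^sub>L 'h" assume T: "T \<in> bounded_operators \<inter> closure LY"
    show "T \<in> ?E"
    proof (rule ccontr)
      assume nE: "T \<notin> ?E"
      have TB: "T \<in> bounded_operators" using T by blast
      obtain l0 where l0: "l0 \<in> sphere 0 1" "op_kernel (shifted l0 T) = {0}" using notE(2)[OF TB nE] by blast
      have sF: "semi_Fredholm (shifted l T)" if "l \<in> sphere 0 1" for l using notE(1)[OF TB nE] that by blast
      obtain d where d: "d > 0" "\<And>S l. norm (S - T) < d \<Longrightarrow> l \<in> sphere 0 1 \<Longrightarrow> upper_semi_Fredholm (shifted l S)"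
        "\<And>S. norm (S - T) < d \<Longrightarrow> op_kernel (shifted l0 S) = {0}"
        using circle_regular_open[OF TB circle_regular(1)[OF TB sF l0] l0] by metis
      have "T \<in> closure LY" using T by blast
      then obtain S where S: "S \<in> LY" "norm (S - T) < d"
        using d(1) unfolding closure_approachable dist_norm by blast
      have "S \<notin> ?E" by (rule inE[OF _ d(2)[OF S(2)] l0(1) d(3)[OF S(2)]]) (use S(1) LB in auto)
      then show False using LE[OF S(1)] by blast
    qed
  qed
  moreover have "closure DC \<subseteq> closure (LY :: ('h \<Rightarrow>\<^sub>L 'h) set)" by (rule closure_mono[OF DL])
  ultimately show ?thesis unfolding clos[OF DB] clos[OF LB] using E_DC by blast
qed

end
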